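(* Up to automorphism of $\mathbb P^2_{\mathbb C}$, the foliations $\mathcal F_1$ and $\mathcal F_2$, described in an affine chart respectively by $\overline{\omega}_1=y^3\mathrm dx+x^3(x\mathrm dy-y\mathrm dx)$ and $\overline{\omega}_2=x^3\mathrm dx+y^3(x\mathrm dy-y\mathrm dx)$, are the only foliations of degree $3$ on $\mathbb P^2_{\mathbb C}$ which realize the minimal dimension of orbits in degree $3$ (this minimal dimension is $6$). That is, a foliation $\mathcal F$ of degree $3$ satisfies $\dim\mathcal O(\mathcal F)=6$ if and only if it is conjugate to $\mathcal F_1$ or to $\mathcal F_2$.
   Context: A foliation $\mathcal F$ of degree $d$ on $\mathbb P^2_{\mathbb C}$ is given in homogeneous coordinates $[x:y:z]$, up to a nonzero scalar, by a $1$-form $a\,\mathrm dx+b\,\mathrm dy+c\,\mathrm dz$ with $a,b,c$ homogeneous polynomials of degree $d+1$ without common factor satisfying $xa+yb+zc=0$. In the affine chart $z=1$ it is described by a polynomial $1$-form $A\,\mathrm dx+B\,\mathrm dy$ with $\gcd(A,B)=1$. The set $\mathbf F(d)$ of foliations of degree $d$ is a Zariski open subset of $\mathbb P_{\mathbb C}^{(d+2)^2-2}$, on which $\mathrm{Aut}(\mathbb P^2_{\mathbb C})=\mathrm{PGL}_3(\mathbb C)$ acts; $\mathcal O(\mathcal F)$ denotes the orbit of $\mathcal F\in\mathbf F(d)$, and two foliations are conjugate if they lie in the same orbit. It is known that for every $d\ge2$ all orbits in $\mathbf F(d)$ have dimension at least $6$ and that this bound is attained. *)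

theory Defs
  imports "HOL-Analysis.Analysis" "HOL-Library.Poly_Mapping" "HOL-Library.Extended_Nat"
begin

section \<open>Complex polynomials in variables indexed by a type\<close>

text \<open>A polynomial maps exponent vectors (finitely supported functions from variables to
  naturals) to coefficients. Ring operations and divisibility are those of \<^type>\<open>poly_mapping\<close>.\<close>

type_synonym 'v cpoly = "('v \<Rightarrow>\<^sub>0 nat) \<Rightarrow>\<^sub>0 complex"

definition Const :: "complex \<Rightarrow> 'v cpoly" where
  "Const c = Poly_Mapping.single 0 c"

definition Var :: "'v \<Rightarrow> 'v cpoly" where
  "Var v = Poly_Mapping.single (Poly_Mapping.single v 1) 1"

definition mdeg :: "('v \<Rightarrow>\<^sub>0 nat) \<Rightarrow> nat" where
  "mdeg m = (\<Sum>v\<in>Poly_Mapping.keys m. Poly_Mapping.lookup m v)"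

definition homogeneous :: "nat \<Rightarrow> 'v cpoly \<Rightarrow> bool" where
  "homogeneous n p \<longleftrightarrow> (\<forall>m\<in>Poly_Mapping.keys p. mdeg m = n)"

definition insertion_by :: "(complex \<Rightarrow> 'a) \<Rightarrow> ('v \<Rightarrow> 'a) \<Rightarrow> 'v cpoly \<Rightarrow> 'a::comm_ring_1" where
  "insertion_by h x p = (\<Sum>m\<in>Poly_Mapping.keys p.
     h (Poly_Mapping.lookup p m) * (\<Prod>v\<in>Poly_Mapping.keys m. x v ^ Poly_Mapping.lookup m v))"

abbreviation eval_poly :: "('v \<Rightarrow> complex) \<Rightarrow> 'v cpoly \<Rightarrow> complex" where
  "eval_poly x p \<equiv> insertion_by (\<lambda>c. c) x p"

abbreviation subst_poly :: "('v \<Rightarrow> 'w cpoly) \<Rightarrow> 'v cpoly \<Rightarrow> 'w cpoly" where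
  "subst_poly f p \<equiv> insertion_by Const f p"


section \<open>Foliations on the complex projective plane\<close>

text \<open>A polynomial 1-form is the vector of its coefficients; in homogeneous coordinates the
  components \<open>1, 2, 3\<close> are those of \<open>dx, dy, dz\<close>. Thus \<open>axis i 1\<close> is the differential of
  \<open>Var i\<close>, and \<open>p *s \<omega>\<close> multiplies a form by a polynomial.\<close>

type_synonym 'v form = "'v cpoly ^ 'v"

definition twisted_forms :: "nat \<Rightarrow> 3 form set" where
  "twisted_forms d = {\<omega>. (\<forall>i. homogeneous (d + 1) (\<omega> $ i)) \<and> (\<Sum>i\<in>UNIV. Var i * \<omega> $ i) = 0}"

definition no_common_factor :: "3 form \<Rightarrow> bool" where
  "no_common_factor \<omega> \<longleftrightarrow> (\<forall>p. (\<forall>i. p dvd \<omega> $ i) \<longrightarrow> p dvd 1)"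

text \<open>A point of the projective space of a space of forms is represented by the set of its
  homogeneous representatives.\<close>

definition proj_point :: "3 form \<Rightarrow> 3 form set" where
  "proj_point \<omega> = {Const k *s \<omega> | k. k \<noteq> 0}"

definition proj_forms :: "nat \<Rightarrow> 3 form set set" where
  "proj_forms d = proj_point ` (twisted_forms d - {0})"

definition foliations :: "nat \<Rightarrow> 3 form set set" where
  "foliations d = proj_point ` {\<omega> \<in> twisted_forms d. no_common_factor \<omega>}"

text \<open>Restriction of a form to the affine chart \<open>z = 1\<close>, i.e. its pullback under
  \<open>(x, y) \<mapsto> (x, y, 1)\<close>.\<close>

definition chart_form :: "3 form \<Rightarrow> 2 form" where
  "chart_form \<omega> =
     (let \<iota> = subst_poly (\<lambda>i. vector [Var 1, Var 2, 1] $ i) in vector [\<iota> (\<omega> $ 1), \<iota> (\<omega> $ 2)])"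

text \<open>All homogeneous representatives of the foliation of degree \<open>d\<close> described by \<open>\<theta>\<close> in the chart
  \<open>z = 1\<close>. This is empty if there is no such foliation.\<close>

definition foliation_of_chart :: "nat \<Rightarrow> 2 form \<Rightarrow> 3 form set" where
  "foliation_of_chart d \<theta> = {\<omega> \<in> twisted_forms d. no_common_factor \<omega> \<and>
     (\<exists>k. k \<noteq> 0 \<and> chart_form \<omega> = Const k *s \<theta>)}"

definition omega_bar1 :: "2 form" where
  "omega_bar1 = (let x = Var 1; y = Var 2; dx = axis 1 1; dy = axis 2 1 in
     y ^ 3 *s dx + x ^ 3 *s (x *s dy - y *s dx))"

definition omega_bar2 :: "2 form" where
  "omega_bar2 = (let x = Var 1; y = Var 2; dx = axis 1 1; dy = axis 2 1 in
     x ^ 3 *s dx + y ^ 3 *s (x *s dy - y *s dx))"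

text \<open>Pullback of a 1-form under the linear map with matrix \<open>M\<close>.\<close>

definition pullback :: "complex^3^3 \<Rightarrow> 3 form \<Rightarrow> 3 form" where
  "pullback M \<omega> = (\<chi> j. \<Sum>i\<in>UNIV.
     Const (M $ i $ j) * subst_poly (\<lambda>l. \<Sum>n\<in>UNIV. Const (M $ l $ n) * Var n) (\<omega> $ i))"

definition fol_orbit :: "3 form set \<Rightarrow> 3 form set set" where
  "fol_orbit F = {pullback M ` F | M. invertible M}"

definition fol_conjugate :: "3 form set \<Rightarrow> 3 form set \<Rightarrow> bool" where
  "fol_conjugate F G \<longleftrightarrow> F \<in> fol_orbit G"


section \<open>The Zariski topology and dimension\<close>

text \<open>The homogeneous coordinates of a form are the coefficients of its components. Only finitely
  many are nonzero on \<^term>\<open>twisted_forms d\<close>, which is a linear subspace of the corresponding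
  coordinate space; hence zero loci of homogeneous polynomials in these coordinates are precisely
  the Zariski closed sets of its projectivization.\<close>

definition form_coord :: "3 form \<Rightarrow> 3 \<times> (3 \<Rightarrow>\<^sub>0 nat) \<Rightarrow> complex" where
  "form_coord \<omega> = (\<lambda>(i, m). Poly_Mapping.lookup (\<omega> $ i) m)"

definition proj_zeros :: "nat \<Rightarrow> (3 \<times> (3 \<Rightarrow>\<^sub>0 nat)) cpoly set \<Rightarrow> 3 form set set" where
  "proj_zeros d S = {P \<in> proj_forms d. \<forall>p\<in>S. \<forall>\<omega>\<in>P. eval_poly (form_coord \<omega>) p = 0}"

definition zariski :: "nat \<Rightarrow> 3 form set topology" where
  "zariski d = topology (\<lambda>U. \<exists>S. (\<forall>p\<in>S. \<exists>n. homogeneous n p) \<and> U = proj_forms d - proj_zeros d S)"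

definition irreducible_space :: "'a topology \<Rightarrow> bool" where
  "irreducible_space X \<longleftrightarrow> topspace X \<noteq> {} \<and>
     (\<forall>A B. closedin X A \<and> closedin X B \<and> topspace X = A \<union> B \<longrightarrow> A = topspace X \<or> B = topspace X)"

text \<open>Krull dimension; it is only meaningful for nonempty spaces (the empty space gets \<open>0\<close>).\<close>

definition krull_dim :: "'a topology \<Rightarrow> enat" where
  "krull_dim X = Sup {enat n | n. \<exists>Z :: nat \<Rightarrow> 'a set.
     (\<forall>i\<le>n. closedin X (Z i) \<and> irreducible_space (subtopology X (Z i))) \<and>
     (\<forall>i<n. Z i \<subset> Z (Suc i))}"

definition orbit_dim :: "nat \<Rightarrow> 3 form set \<Rightarrow> enat" where
  "orbit_dim d F = krull_dim (subtopology (zariski d) (fol_orbit F))"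


section \<open>The Zariski topology is a topology\<close>

lemma insertion_by_supset:
  assumes "finite A" "Poly_Mapping.keys p \<subseteq> A" "h 0 = 0"
  shows "insertion_by h x p = (\<Sum>m\<in>A.
     h (Poly_Mapping.lookup p m) * (\<Prod>v\<in>Poly_Mapping.keys m. x v ^ Poly_Mapping.lookup m v))"
proof -
  have "Poly_Mapping.lookup p m = 0" if "m \<in> A - Poly_Mapping.keys p" for m
    using that by (simp add: in_keys_iff)
  then show ?thesis
    unfolding insertion_by_def using assms by (intro sum.mono_neutral_left) simp_all
qed

lemma insertion_by_add:
  assumes "h 0 = 0" "\<And>a b. h (a + b) = h a + h b"
  shows "insertion_by h x (p + q) = insertion_by h x p + insertion_by h x q"
proof -
  let ?A = "Poly_Mapping.keys p \<union> Poly_Mapping.keys q"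
  have "Poly_Mapping.keys (p + q) \<subseteq> ?A" by (rule Poly_Mapping.keys_add)
  then show ?thesis
    using assms
    by (simp add: insertion_by_supset[where A = ?A] lookup_add distrib_right sum.distrib)
qed

lemma insertion_by_sum:
  assumes "h 0 = 0" "\<And>a b. h (a + b) = h a + h b"
  shows "insertion_by h x (\<Sum>i\<in>I. f i) = (\<Sum>i\<in>I. insertion_by h x (f i))"
proof (induction I rule: infinite_finite_induct)
  case (insert i I)
  then show ?case by (simp add: insertion_by_add[OF assms])
qed (simp_all add: insertion_by_def)

lemma insertion_by_single:
  assumes "h 0 = 0"
  shows "insertion_by h x (Poly_Mapping.single m c) =
    h c * (\<Prod>v\<in>Poly_Mapping.keys m. x v ^ Poly_Mapping.lookup m v)"
proof (cases "c = 0")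
  case False
  then have "Poly_Mapping.keys (Poly_Mapping.single m c) = {m}" by simp
  then show ?thesis by (simp add: insertion_by_def)
qed (simp add: insertion_by_def assms)

lemma poly_mapping_eq_sum_single:
  "p = (\<Sum>m\<in>Poly_Mapping.keys p. Poly_Mapping.single m (Poly_Mapping.lookup p m))"
proof (rule poly_mapping_eqI)
  fix k
  show "Poly_Mapping.lookup p k = Poly_Mapping.lookup
      (\<Sum>m\<in>Poly_Mapping.keys p. Poly_Mapping.single m (Poly_Mapping.lookup p m)) k"
    by (simp add: lookup_sum lookup_single when_def in_keys_iff)
qed

lemma monomial_prod_add:
  fixes x :: "'v \<Rightarrow> 'a::comm_monoid_mult"
  shows "(\<Prod>v\<in>Poly_Mapping.keys (m + n). x v ^ Poly_Mapping.lookup (m + n) v) =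
    (\<Prod>v\<in>Poly_Mapping.keys m. x v ^ Poly_Mapping.lookup m v) *
    (\<Prod>v\<in>Poly_Mapping.keys n. x v ^ Poly_Mapping.lookup n v)"
proof -
  let ?A = "Poly_Mapping.keys m \<union> Poly_Mapping.keys n"
  have *: "(\<Prod>v\<in>Poly_Mapping.keys k. x v ^ Poly_Mapping.lookup k v) =
      (\<Prod>v\<in>?A. x v ^ Poly_Mapping.lookup k v)" if "Poly_Mapping.keys k \<subseteq> ?A" for k
    by (rule prod.mono_neutral_left) (use that in \<open>auto simp: in_keys_iff\<close>)
  have "Poly_Mapping.keys (m + n) \<subseteq> ?A" by (rule Poly_Mapping.keys_add)
  then show ?thesis
    unfolding *[of "m + n", OF \<open>Poly_Mapping.keys (m + n) \<subseteq> ?A\<close>] *[of m, OF Un_upper1] *[of n, OF Un_upper2]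
    by (simp add: lookup_add power_add prod.distrib)
qed

lemma insertion_by_mult:
  assumes "h 0 = 0" "\<And>a b. h (a + b) = h a + h b" "\<And>a b. h (a * b) = h a * h b"
  shows "insertion_by h x (p * q) = insertion_by h x p * insertion_by h x q"
proof -
  let ?s = "\<lambda>p m. Poly_Mapping.single m (Poly_Mapping.lookup p m)"
  have "p * q = (\<Sum>m\<in>Poly_Mapping.keys p. ?s p m) * (\<Sum>n\<in>Poly_Mapping.keys q. ?s q n)"
    using poly_mapping_eq_sum_single[of p] poly_mapping_eq_sum_single[of q] by simp
  also have "\<dots> = (\<Sum>m\<in>Poly_Mapping.keys p. \<Sum>n\<in>Poly_Mapping.keys q.
      Poly_Mapping.single (m + n) (Poly_Mapping.lookup p m * Poly_Mapping.lookup q n))"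
    by (simp add: sum_product mult_single)
  finally show ?thesis
    using assms
    by (simp add: insertion_by_sum insertion_by_single monomial_prod_add)
      (simp add: insertion_by_def sum_product mult_ac)
qed

lemma mdeg_add: "mdeg (m + n) = mdeg m + mdeg n"
proof -
  let ?A = "Poly_Mapping.keys m \<union> Poly_Mapping.keys n"
  have *: "mdeg k = (\<Sum>v\<in>?A. Poly_Mapping.lookup k v)" if "Poly_Mapping.keys k \<subseteq> ?A" for k
    unfolding mdeg_def by (rule sum.mono_neutral_left) (use that in \<open>auto simp: in_keys_iff\<close>)
  have "Poly_Mapping.keys (m + n) \<subseteq> ?A" by (rule Poly_Mapping.keys_add)
  then show ?thesis by (simp add: * lookup_add sum.distrib)
qed

lemma homogeneous_mult:
  assumes "homogeneous a p" "homogeneous b q"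
  shows "homogeneous (a + b) (p * q)"
  using assms keys_mult[of p q] by (auto simp: homogeneous_def mdeg_add subset_iff)

lemma eval_homogeneous_scale:
  assumes "homogeneous n p"
  shows "eval_poly (\<lambda>v. k * x v) p = k ^ n * eval_poly x p"
proof -
  have "(\<Prod>v\<in>Poly_Mapping.keys m. (k * x v) ^ Poly_Mapping.lookup m v) =
      k ^ n * (\<Prod>v\<in>Poly_Mapping.keys m. x v ^ Poly_Mapping.lookup m v)"
    if "m \<in> Poly_Mapping.keys p" for m
  proof -
    have "n = mdeg m" using that assms by (auto simp: homogeneous_def)
    then show ?thesis
      by (simp add: power_mult_distrib prod.distrib mdeg_def power_sum)
  qed
  then show ?thesis
    by (simp add: insertion_by_def sum_distrib_left mult.left_commute)
qed

lemma Const_1: "Const 1 = 1"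
  by (simp add: Const_def)

lemma Const_mult_lookup: "Poly_Mapping.lookup (Const k * p) m = k * Poly_Mapping.lookup p m"
proof -
  have "Const k * p = (\<Sum>m\<in>Poly_Mapping.keys p. Poly_Mapping.single m (k * Poly_Mapping.lookup p m))"
    by (subst poly_mapping_eq_sum_single[of p]) (simp add: sum_distrib_left Const_def mult_single)
  then show ?thesis
    by (simp add: lookup_sum lookup_single when_def in_keys_iff)
qed

lemma form_coord_scale: "form_coord (Const k *s \<omega>) = (\<lambda>v. k * form_coord \<omega> v)"
  by (rule ext) (simp add: form_coord_def Const_mult_lookup split: prod.split)

lemma mem_proj_zeros_iff:
  assumes "\<forall>p\<in>S. \<exists>n. homogeneous n p" "proj_point \<omega> \<in> proj_forms d"
  shows "proj_point \<omega> \<in> proj_zeros d S \<longleftrightarrow> (\<forall>p\<in>S. eval_poly (form_coord \<omega>) p = 0)"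
proof -
  have "(\<forall>\<eta>\<in>proj_point \<omega>. eval_poly (form_coord \<eta>) p = 0) \<longleftrightarrow> eval_poly (form_coord \<omega>) p = 0"
    if p: "p \<in> S" for p
  proof -
    obtain n where n: "homogeneous n p" using assms(1) p by blast
    have "\<omega> \<in> proj_point \<omega>"
      unfolding proj_point_def by (rule CollectI, rule exI[of _ 1]) (simp add: Const_1)
    moreover have "eval_poly (form_coord \<eta>) p = 0"
      if "\<eta> \<in> proj_point \<omega>" "eval_poly (form_coord \<omega>) p = 0" for \<eta>
    proof -
      obtain k where "\<eta> = Const k *s \<omega>" using \<open>\<eta> \<in> proj_point \<omega>\<close> by (auto simp: proj_point_def)
      then show ?thesis
        using that(2) by (simp add: form_coord_scale eval_homogeneous_scale[OF n])
    qed
    ultimately show ?thesis by blast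
  qed
  then show ?thesis using assms(2) by (auto simp: proj_zeros_def)
qed

lemma openin_zariski:
  "openin (zariski d) U \<longleftrightarrow>
     (\<exists>S. (\<forall>p\<in>S. \<exists>n. homogeneous n p) \<and> U = proj_forms d - proj_zeros d S)"
proof -
  let ?hom = "\<lambda>S :: (3 \<times> (3 \<Rightarrow>\<^sub>0 nat)) cpoly set. \<forall>p\<in>S. \<exists>n. homogeneous n p"
  let ?open = "\<lambda>U. \<exists>S. ?hom S \<and> U = proj_forms d - proj_zeros d S"
  have inter: "?open (U \<inter> V)" if U: "?open U" and V: "?open V" for U V
  proof -
    obtain S T where S: "?hom S" "U = proj_forms d - proj_zeros d S"
      and T: "?hom T" "V = proj_forms d - proj_zeros d T"
      using U V by blast
    let ?R = "{p * q | p q. p \<in> S \<and> q \<in> T}"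
    have R: "?hom ?R" using S(1) T(1) homogeneous_mult by fast
    have "P \<in> U \<inter> V \<longleftrightarrow> P \<in> proj_forms d - proj_zeros d ?R" for P
    proof (cases "P \<in> proj_forms d")
      case True
      then obtain \<omega> where P: "P = proj_point \<omega>" by (auto simp: proj_forms_def)
      have "(\<forall>r\<in>?R. eval_poly (form_coord \<omega>) r = 0) \<longleftrightarrow>
          (\<forall>p\<in>S. eval_poly (form_coord \<omega>) p = 0) \<or> (\<forall>q\<in>T. eval_poly (form_coord \<omega>) q = 0)"
      proof -
        have "(\<forall>r\<in>?R. eval_poly (form_coord \<omega>) r = 0) \<longleftrightarrow>
            (\<forall>p\<in>S. \<forall>q\<in>T. eval_poly (form_coord \<omega>) (p * q) = 0)"
          by blast
        also have "\<dots> \<longleftrightarrow> (\<forall>p\<in>S. \<forall>q\<in>T. eval_poly (form_coord \<omega>) p = 0 \<or> eval_poly (form_coord \<omega>) q = 0)"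
          by (simp add: insertion_by_mult)
        finally show ?thesis by blast
      qed
      then show ?thesis
        using True mem_proj_zeros_iff[OF S(1)] mem_proj_zeros_iff[OF T(1)] mem_proj_zeros_iff[OF R]
        by (simp add: P S(2) T(2))
    qed (simp add: S T)
    then have "U \<inter> V = proj_forms d - proj_zeros d ?R" by blast
    with R show ?thesis by blast
  qed
  have union: "?open (\<Union>K)" if K: "\<forall>U\<in>K. ?open U" for K
  proof -
    obtain S where S: "\<And>U. U \<in> K \<Longrightarrow> ?hom (S U) \<and> U = proj_forms d - proj_zeros d (S U)"
      using bchoice[OF K] by blast
    have "?hom (\<Union>U\<in>K. S U)" using S by blast
    moreover have "\<Union>K = (\<Union>U\<in>K. proj_forms d - proj_zeros d (S U))" using S by blast
    then have "\<Union>K = proj_forms d - proj_zeros d (\<Union>U\<in>K. S U)"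
      by (auto simp: proj_zeros_def)
    ultimately show ?thesis by blast
  qed
  have "istopology ?open"
    unfolding istopology_def using inter union by blast
  then show ?thesis
    by (simp add: zariski_def topology_inverse')
qed

lemma topspace_zariski: "topspace (zariski d) = proj_forms d"
proof
  show "topspace (zariski d) \<subseteq> proj_forms d"
    using openin_topspace[of "zariski d"] unfolding openin_zariski by blast
  have "\<exists>n. homogeneous n (1 :: (3 \<times> (3 \<Rightarrow>\<^sub>0 nat)) cpoly)"
    by (auto simp: homogeneous_def)
  moreover have "eval_poly x (1 :: (3 \<times> (3 \<Rightarrow>\<^sub>0 nat)) cpoly) = 1" for x
    by (simp add: insertion_by_def)
  then have "proj_zeros d {1} = {}"
    by (auto simp: proj_zeros_def proj_forms_def proj_point_def intro!: exI[of _ "1::complex"])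
  ultimately have "openin (zariski d) (proj_forms d)"
    unfolding openin_zariski by (intro exI[of _ "{1}"]) auto
  then show "proj_forms d \<subseteq> topspace (zariski d)" by (rule openin_subset)
qed

lemma closedin_zariski:
  "closedin (zariski d) C \<longleftrightarrow> (\<exists>S. (\<forall>p\<in>S. \<exists>n. homogeneous n p) \<and> C = proj_zeros d S)"
proof -
  have "proj_zeros d S \<subseteq> proj_forms d" for S by (auto simp: proj_zeros_def)
  then have "C \<subseteq> proj_forms d \<and> proj_forms d - C = proj_forms d - proj_zeros d S \<longleftrightarrow> C = proj_zeros d S" for S
    by blast
  then show ?thesis
    unfolding closedin_def openin_zariski topspace_zariski by blast
qed

end

theory Submission
  imports Defs "HOL-Computational_Algebra.Fundamental_Theorem_Algebra"
begin

text \<open>The orbit map of a foliation given by \<open>\<omega>\<close> has the derivative \<open>X \<mapsto> lie X \<omega>\<close> at the identity, so the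
  orbit has dimension \<open>8 - s\<close>, where \<open>s\<close> is the dimension of the stabiliser algebra
  \<open>{X. lie X \<omega> = 0}\<close> inside the Lie algebra of all \<open>3 \<times> 3\<close> matrices. The theorem thus says that \<open>s \<le> 2\<close>
  in degree three, and that \<open>s = 2\<close> only for the
  conjugates of two models.

  Dimension. Krull dimensions are computed by counting monomials. The functions that cut out the successive
  members of a chain of irreducible closed sets are algebraically independent (\<open>chain_independent\<close>), whereas
  \<open>k + 1\<close> polynomials in \<open>k\<close> parameters are not, because the monomials in them outnumber the dimension of the
  space of polynomials of proportional degree (\<open>polyfun_relation\<close>, \<open>box_count\<close>). A set dominated by \<open>k\<close>
  parameters therefore has dimension at most \<open>k\<close> (\<open>krull_dim_le\<close>); the orbits of the two models are dominated
  by six parameters, since almost every matrix is the product of a symmetry and a matrix with first column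
  \<open>(1, 1, 0)\<close> (\<open>krull_dim_model_le\<close>). Conversely, the images in the orbit of a flag of linear spaces of
  matrices transverse to the stabiliser form a chain. It is strict, because a polynomial map with surjective
  derivative at a point has an image with nonempty interior (\<open>relation_on_smaller_span\<close>,
  \<open>krull_dim_orbit_ge\<close>, \<open>krull_dim_orbit_stabiliser\<close>).

  Classification. The stabiliser is a Lie algebra (\<open>lie_bracket\<close>) and contains the semisimple and nilpotent
  parts of its elements (\<open>lie_jordan_parts\<close>). If it is not contained in a line, then eigenvectors of adjoint
  actions provide either two independent diagonal matrices or a nilpotent one. Two diagonal symmetries leave a
  single exponent for the coefficients of the form, which makes the form divisible by a variable
  (\<open>two_diagonals\<close>). A nilpotent symmetry of rank one brings the form to
  \<open>p (z dx - x dz) + q (x dy - y dx)\<close> with coprime binary cubics \<open>p, q\<close> in \<open>x, y\<close>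
  (\<open>E31_symmetric_form\<close>), and any further symmetry forces them to be the cubes of \<open>x\<close> and \<open>y\<close> in one of the two
  orders (\<open>E31_case\<close>), which are the two models. A nilpotent symmetry of rank two either comes with its square,
  or with a diagonal symmetry, in which case the form is zero or has a common factor
  (\<open>no_J3_diagonal\<close>, \<open>J3_case\<close>).\<close>

section \<open>Polynomials and their substitutions\<close>

lemma Const_0 [simp]: "Const 0 = 0"
  by (simp add: Const_def)

lemma Const_add: "Const (a + b) = Const a + Const b"
  by (simp add: Const_def single_add)

lemma Const_sum: "Const (\<Sum>i\<in>I. f i) = (\<Sum>i\<in>I. Const (f i))"
  by (induction I rule: infinite_finite_induct) (simp_all add: Const_add)

lemma Const_mult: "Const (a * b) = Const a * Const b"
  by (simp add: Const_def mult_single)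

lemma Const_minus: "Const (- a) = - Const a"
  by (simp add: Const_def single_uminus)

lemma Const_diff: "Const (a - b) = Const a - Const b"
  by (simp add: Const_def single_diff)

lemma Const_power: "Const (a ^ n) = Const a ^ n"
  by (induction n) (simp_all add: Const_mult Const_1)

lemma Const_prod: "Const (\<Prod>i\<in>I. f i) = (\<Prod>i\<in>I. Const (f i))"
  by (induction I rule: infinite_finite_induct) (simp_all add: Const_mult Const_1)

lemma lookup_Const: "Poly_Mapping.lookup (Const c) m = (if m = 0 then c else 0)"
  by (simp add: Const_def lookup_single when_def)

lemma keys_finite_sum_single:
  assumes "finite A" "Poly_Mapping.keys p \<subseteq> A"
  shows "p = (\<Sum>m\<in>A. Poly_Mapping.single m (Poly_Mapping.lookup p m))"
proof -
  have "p = (\<Sum>m\<in>Poly_Mapping.keys p. Poly_Mapping.single m (Poly_Mapping.lookup p m))"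
    by (rule poly_mapping_eq_sum_single)
  also have "\<dots> = (\<Sum>m\<in>A. Poly_Mapping.single m (Poly_Mapping.lookup p m))"
    by (rule sum.mono_neutral_left) (use assms in \<open>auto simp: in_keys_iff\<close>)
  finally show ?thesis .
qed

lemma lookup_mult_superset:
  fixes p q :: "'v cpoly"
  assumes "finite A" "Poly_Mapping.keys p \<subseteq> A" "finite B" "Poly_Mapping.keys q \<subseteq> B"
  shows "Poly_Mapping.lookup (p * q) m =
    (\<Sum>a\<in>A. \<Sum>b\<in>B. if a + b = m then Poly_Mapping.lookup p a * Poly_Mapping.lookup q b else 0)"
proof -
  have "p * q = (\<Sum>a\<in>A. Poly_Mapping.single a (Poly_Mapping.lookup p a)) *
      (\<Sum>b\<in>B. Poly_Mapping.single b (Poly_Mapping.lookup q b))"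
    using keys_finite_sum_single[OF assms(1,2)] keys_finite_sum_single[OF assms(3,4)] by simp
  then show ?thesis
    by (simp add: sum_product mult_single lookup_sum lookup_single when_def)
qed

lemma cpoly_induct [case_names single add]:
  fixes p :: "'v cpoly"
  assumes "\<And>m c. P (Poly_Mapping.single m c)" "\<And>p q. P p \<Longrightarrow> P q \<Longrightarrow> P (p + q)"
  shows "P p"
proof -
  have "P (\<Sum>m\<in>A. Poly_Mapping.single m (Poly_Mapping.lookup p m))" if "finite A" for A
    using that
  proof (induction A)
    case empty
    then show ?case using assms(1)[of 0 0] by simp
  qed (simp add: assms)
  then show ?thesis
    by (subst poly_mapping_eq_sum_single) simp
qed

lemma single_in_subring:
  fixes m :: "'v \<Rightarrow>\<^sub>0 nat"
  assumes "\<And>c. P (Const c)" "\<And>v. P (Var v)" "\<And>p q. P p \<Longrightarrow> P q \<Longrightarrow> P (p * q)"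
  shows "P (Poly_Mapping.single m c)"
proof (induction "mdeg m" arbitrary: m)
  case 0
  then have "m = 0"
    by (auto simp: mdeg_def in_keys_iff intro!: poly_mapping_eqI)
  then show ?case using assms(1)[of c] by (simp add: Const_def)
next
  case (Suc n)
  then have "m \<noteq> 0" by (auto simp: mdeg_def)
  then obtain v where v: "Poly_Mapping.lookup m v \<noteq> 0"
    by (metis lookup_zero poly_mapping_eqI)
  let ?e = "Poly_Mapping.single v (1::nat)"
  have m: "m = (m - ?e) + ?e"
    using v by (intro poly_mapping_eqI) (auto simp: lookup_add lookup_minus lookup_single when_def)
  have "mdeg m = mdeg (m - ?e) + 1"
    by (subst m) (simp add: mdeg_add, simp add: mdeg_def)
  then have "P (Poly_Mapping.single (m - ?e) c)" using Suc by simp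
  then have "P (Poly_Mapping.single (m - ?e) c * Var v)" using assms by blast
  then show ?case using m by (simp add: Var_def mult_single)
qed

text \<open>The polynomial ring is generated by constants and variables, so identities between
  homomorphisms or derivations need only be checked on these.\<close>

lemma cpoly_generators_induct [case_names Const Var add mult]:
  fixes p :: "'v cpoly"
  assumes "\<And>c. P (Const c)" "\<And>v. P (Var v)" "\<And>p q. P p \<Longrightarrow> P q \<Longrightarrow> P (p + q)"
    "\<And>p q. P p \<Longrightarrow> P q \<Longrightarrow> P (p * q)"
  shows "P p"
  by (induction p rule: cpoly_induct) (auto intro: single_in_subring assms)

lemma subst_add: "subst_poly f (p + q) = subst_poly f p + subst_poly f q"
  by (rule insertion_by_add) (simp_all add: Const_add)

lemma subst_mult: "subst_poly f (p * q) = subst_poly f p * subst_poly f q"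
  by (rule insertion_by_mult) (simp_all add: Const_add Const_mult)

lemma subst_sum: "subst_poly f (\<Sum>i\<in>I. g i) = (\<Sum>i\<in>I. subst_poly f (g i))"
  by (rule insertion_by_sum) (simp_all add: Const_add)

lemma subst_Const [simp]: "subst_poly f (Const c) = Const c"
  unfolding Const_def[of c] by (subst insertion_by_single) (simp_all add: Const_def)

lemma subst_Var [simp]: "subst_poly f (Var v) = f v"
  unfolding Var_def by (subst insertion_by_single) (simp_all add: Const_1)

lemma subst_0 [simp]: "subst_poly f 0 = 0"
  using subst_Const[of f 0] by simp

lemma subst_1 [simp]: "subst_poly f 1 = 1"
  using subst_Const[of f 1] by (simp add: Const_1)

lemma subst_minus: "subst_poly f (- p) = - subst_poly f p"
  using subst_add[of f p "- p"] by (simp add: eq_neg_iff_add_eq_0 add.commute)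

lemma subst_diff: "subst_poly f (p - q) = subst_poly f p - subst_poly f q"
  using subst_add[of f p "- q"] by (simp add: subst_minus)

lemma subst_power: "subst_poly f (p ^ n) = subst_poly f p ^ n"
  by (induction n) (simp_all add: subst_mult)

lemmas subst_simps = subst_add subst_mult subst_sum subst_minus subst_diff subst_power

lemma eval_Const [simp]: "eval_poly x (Const c) = c"
  unfolding Const_def by (subst insertion_by_single) simp_all

lemma eval_Var [simp]: "eval_poly x (Var v) = x v"
  unfolding Var_def by (subst insertion_by_single) simp_all

lemma eval_add: "eval_poly x (p + q) = eval_poly x p + eval_poly x q"
  by (rule insertion_by_add) simp_all

lemma eval_mult: "eval_poly x (p * q) = eval_poly x p * eval_poly x q"
  by (rule insertion_by_mult) simp_all

lemma eval_sum: "eval_poly x (\<Sum>i\<in>I. g i) = (\<Sum>i\<in>I. eval_poly x (g i))"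
  by (rule insertion_by_sum) simp_all

lemma eval_0 [simp]: "eval_poly x 0 = 0"
  by (simp add: insertion_by_def)

lemma eval_1 [simp]: "eval_poly x 1 = 1"
  using eval_Const[of x 1] by (simp add: Const_1)

lemma eval_minus: "eval_poly x (- p) = - eval_poly x p"
  using eval_add[of x p "- p"] by (simp add: eq_neg_iff_add_eq_0 add.commute)

lemma eval_diff: "eval_poly x (p - q) = eval_poly x p - eval_poly x q"
  using eval_add[of x p "- q"] by (simp add: eval_minus)

lemma eval_power: "eval_poly x (p ^ n) = eval_poly x p ^ n"
  by (induction n) (simp_all add: eval_mult)

lemmas eval_simps = eval_add eval_mult eval_sum eval_minus eval_diff eval_power

lemma eval_subst: "eval_poly x (subst_poly f p) = eval_poly (\<lambda>v. eval_poly x (f v)) p"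
  by (induction p rule: cpoly_generators_induct) (simp_all add: eval_simps subst_simps)

lemma subst_subst: "subst_poly g (subst_poly f p) = subst_poly (\<lambda>v. subst_poly g (f v)) p"
  by (induction p rule: cpoly_generators_induct) (simp_all add: subst_simps)

lemma subst_id: "subst_poly Var p = p"
  by (induction p rule: cpoly_generators_induct) (simp_all add: subst_simps)

lemma homogeneous_0 [simp]: "homogeneous n 0"
  by (simp add: homogeneous_def)

lemma homogeneous_add: "homogeneous n p \<Longrightarrow> homogeneous n q \<Longrightarrow> homogeneous n (p + q)"
  using Poly_Mapping.keys_add[of p q] by (auto simp: homogeneous_def)

lemma homogeneous_sum: "(\<And>i. i \<in> I \<Longrightarrow> homogeneous n (f i)) \<Longrightarrow> homogeneous n (\<Sum>i\<in>I. f i)"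
  by (induction I rule: infinite_finite_induct) (auto intro: homogeneous_add)

lemma homogeneous_minus: "homogeneous n p \<Longrightarrow> homogeneous n (- p)"
  by (simp add: homogeneous_def)

lemma homogeneous_diff: "homogeneous n p \<Longrightarrow> homogeneous n q \<Longrightarrow> homogeneous n (p - q)"
  using homogeneous_add[of n p "- q"] by (simp add: homogeneous_minus)

lemma homogeneous_Const: "homogeneous 0 (Const c)"
  by (auto simp: homogeneous_def Const_def mdeg_def split: if_splits)

lemma homogeneous_1: "homogeneous 0 1"
  using homogeneous_Const[of 1] by (simp add: Const_1)

lemma homogeneous_Var: "homogeneous 1 (Var v)"
  by (auto simp: homogeneous_def Var_def mdeg_def)

lemma homogeneous_scale: "homogeneous n p \<Longrightarrow> homogeneous n (Const c * p)"
  using homogeneous_mult[OF homogeneous_Const, of n p c] by simp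

lemma homogeneous_power: "homogeneous n p \<Longrightarrow> homogeneous (k * n) (p ^ k)"
  by (induction k) (auto intro: homogeneous_1 homogeneous_mult)

lemma homogeneous_prod:
  "(\<And>i. i \<in> I \<Longrightarrow> homogeneous (n i) (f i)) \<Longrightarrow> homogeneous (\<Sum>i\<in>I. n i) (\<Prod>i\<in>I. f i)"
  by (induction I rule: infinite_finite_induct) (auto intro: homogeneous_mult homogeneous_1)

lemma homogeneous_eval_0:
  assumes "homogeneous n p" "n > 0"
  shows "eval_poly (\<lambda>_. 0) p = 0"
  using eval_homogeneous_scale[OF assms(1), of 0 "\<lambda>_. 0"] assms(2) by (auto simp: power_0_left)

lemma lookup_Var_mult:
  "Poly_Mapping.lookup (Var v * p) m =
    (if Poly_Mapping.lookup m v = 0 then 0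
     else Poly_Mapping.lookup p (m - Poly_Mapping.single v 1))"
proof (induction p rule: cpoly_induct)
  case (single a c)
  let ?e = "Poly_Mapping.single v (1::nat)"
  have "?e + a = m \<longleftrightarrow> Poly_Mapping.lookup m v \<noteq> 0 \<and> a = m - ?e"
  proof
    assume "?e + a = m"
    then show "Poly_Mapping.lookup m v \<noteq> 0 \<and> a = m - ?e"
      by (auto simp: lookup_add)
  next
    assume *: "Poly_Mapping.lookup m v \<noteq> 0 \<and> a = m - ?e"
    show "?e + a = m"
      by (rule poly_mapping_eqI) (use * in \<open>auto simp: lookup_add lookup_minus lookup_single when_def\<close>)
  qed
  then show ?case
    by (auto simp: Var_def mult_single lookup_single when_def)
qed (auto simp: distrib_left lookup_add)


section \<open>Partial derivatives and linear vector fields\<close>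

definition pd :: "'v \<Rightarrow> 'v cpoly \<Rightarrow> 'v cpoly" where
  "pd v p = Abs_poly_mapping (\<lambda>m. of_nat (Poly_Mapping.lookup m v + 1) *
     Poly_Mapping.lookup p (m + Poly_Mapping.single v 1))"

lemma lookup_pd:
  "Poly_Mapping.lookup (pd v p) m = of_nat (Poly_Mapping.lookup m v + 1) *
     Poly_Mapping.lookup p (m + Poly_Mapping.single v 1)"
proof -
  let ?f = "\<lambda>m. of_nat (Poly_Mapping.lookup m v + 1) * Poly_Mapping.lookup p (m + Poly_Mapping.single v 1)"
  have "finite ((\<lambda>m. m + Poly_Mapping.single v 1) -` Poly_Mapping.keys p)"
    by (rule finite_vimageI) (auto intro: injI)
  moreover have "{m. ?f m \<noteq> 0} \<subseteq> (\<lambda>m. m + Poly_Mapping.single v 1) -` Poly_Mapping.keys p"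
    by (auto simp: in_keys_iff)
  ultimately have "finite {m. ?f m \<noteq> 0}" by (rule rev_finite_subset)
  then show ?thesis by (simp add: pd_def del: of_nat_add)
qed

lemma pd_add: "pd v (p + q) = pd v p + pd v q"
  by (rule poly_mapping_eqI) (simp add: lookup_pd lookup_add algebra_simps)

lemma pd_single: "pd v (Poly_Mapping.single m c) =
    Poly_Mapping.single (m - Poly_Mapping.single v 1) (of_nat (Poly_Mapping.lookup m v) * c)"
proof (rule poly_mapping_eqI)
  fix k
  let ?e = "Poly_Mapping.single v (1::nat)"
  show "Poly_Mapping.lookup (pd v (Poly_Mapping.single m c)) k =
    Poly_Mapping.lookup (Poly_Mapping.single (m - ?e) (of_nat (Poly_Mapping.lookup m v) * c)) k"
  proof (cases "Poly_Mapping.lookup m v = 0")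
    case True
    then have "m \<noteq> k + ?e" by (auto simp: lookup_add)
    then show ?thesis using True by (simp add: lookup_pd lookup_single when_def)
  next
    case False
    have "m = k + ?e \<longleftrightarrow> m - ?e = k"
    proof
      assume *: "m - ?e = k"
      show "m = k + ?e"
        by (rule poly_mapping_eqI) (use * False in \<open>auto simp: lookup_add lookup_minus lookup_single when_def\<close>)
    qed auto
    then show ?thesis
      by (cases "m = k + ?e") (auto simp: lookup_pd lookup_single when_def lookup_add)
  qed
qed

lemma pd_mult_single:
  "pd v (Poly_Mapping.single a c * Poly_Mapping.single b d) =
    pd v (Poly_Mapping.single a c) * Poly_Mapping.single b d +
    Poly_Mapping.single a c * pd v (Poly_Mapping.single b d)"
proof -
  let ?e = "Poly_Mapping.single v (1::nat)"
  have 1: "a - ?e + b = a + b - ?e" if "Poly_Mapping.lookup a v \<noteq> 0" for a b :: "'a \<Rightarrow>\<^sub>0 nat"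
    by (rule poly_mapping_eqI) (use that in \<open>auto simp: lookup_add lookup_minus lookup_single when_def\<close>)
  show ?thesis
    using 1[of a b] 1[of b a]
    by (cases "Poly_Mapping.lookup a v = 0"; cases "Poly_Mapping.lookup b v = 0")
      (simp_all add: mult_single pd_single lookup_add single_add[symmetric] algebra_simps)
qed

lemma pd_mult: "pd v (p * q) = pd v p * q + p * pd v q"
proof (induction p rule: cpoly_induct)
  case (single m c)
  show ?case
    by (induction q rule: cpoly_induct) (simp_all add: pd_mult_single pd_add algebra_simps)
qed (simp_all add: pd_add algebra_simps)

lemma pd_Const [simp]: "pd v (Const c) = 0"
  by (simp add: Const_def pd_single)

lemma pd_Var: "pd v (Var w) = (if v = w then 1 else 0)"
  by (auto simp: Var_def pd_single lookup_single)

text \<open>A square matrix \<open>X\<close> is identified with the linear vector field that sends the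
  coordinate \<open>Var i\<close> to the linear form given by the \<open>i\<close>-th row of \<open>X\<close>.\<close>

definition row_form :: "complex^'n^'n \<Rightarrow> 'n \<Rightarrow> 'n::finite cpoly" where
  "row_form X i = (\<Sum>n\<in>UNIV. Const (X $ i $ n) * Var n)"

definition der :: "complex^'n^'n \<Rightarrow> 'n::finite cpoly \<Rightarrow> 'n cpoly" where
  "der X p = (\<Sum>i\<in>UNIV. row_form X i * pd i p)"

lemma der_add: "der X (p + q) = der X p + der X q"
  by (simp add: der_def pd_add distrib_left sum.distrib)

lemma der_mult: "der X (p * q) = der X p * q + p * der X q"
  by (simp add: der_def pd_mult distrib_left sum.distrib sum_distrib_left sum_distrib_right mult_ac)

lemma der_Const [simp]: "der X (Const c) = 0"
  by (simp add: der_def)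

lemma der_Var [simp]: "der X (Var i) = row_form X i"
  by (simp add: der_def pd_Var if_distrib cong: if_cong)

lemma der_0 [simp]: "der X 0 = 0"
  using der_Const[of X 0] by simp

lemma der_sum: "der X (\<Sum>i\<in>I. f i) = (\<Sum>i\<in>I. der X (f i))"
  by (induction I rule: infinite_finite_induct) (simp_all add: der_add)

lemma subst_row_form:
  "subst_poly (row_form A) (row_form B i) = row_form (B ** A) i"
proof -
  have "subst_poly (row_form A) (row_form B i) =
      (\<Sum>n\<in>UNIV. \<Sum>m\<in>UNIV. Const (B $ i $ n * A $ n $ m) * Var m)"
    by (simp add: row_form_def subst_simps sum_distrib_left mult_ac Const_mult)
  also have "\<dots> = (\<Sum>m\<in>UNIV. \<Sum>n\<in>UNIV. Const (B $ i $ n * A $ n $ m) * Var m)"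
    by (rule sum.swap)
  also have "\<dots> = row_form (B ** A) i"
    by (simp add: row_form_def matrix_matrix_mult_def sum_distrib_right Const_sum)
  finally show ?thesis .
qed

lemma row_form_mat: "row_form (mat c) i = Const c * Var i"
  by (simp add: row_form_def mat_def if_distrib[of Const] mult_delta_left cong: if_cong)

lemma der_row_form: "der X (row_form Y i) = row_form (Y ** X) i"
proof -
  have "der X (row_form Y i) = (\<Sum>n\<in>UNIV. Const (Y $ i $ n) * row_form X n)"
    by (simp add: row_form_def[of Y] der_sum der_mult)
  also have "\<dots> = subst_poly (row_form X) (row_form Y i)"
    by (simp add: row_form_def[of Y] subst_simps)
  finally show ?thesis by (simp add: subst_row_form)
qed

lemma row_form_diff: "row_form (X - Y) i = row_form X i - row_form Y i"
  by (simp add: row_form_def sum_subtractf left_diff_distrib Const_diff)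

lemma row_form_add: "row_form (X + Y) i = row_form X i + row_form Y i"
  by (simp add: row_form_def sum.distrib distrib_right Const_add)

text \<open>A difference of products of derivations is again a derivation, so both sides are determined by their values
  on the variables.\<close>

lemma der_bracket: "der X (der Y p) - der Y (der X p) = der (Y ** X - X ** Y) p"
proof (induction p rule: cpoly_generators_induct)
  case (mult p q)
  have "der X (der Y (p * q)) - der Y (der X (p * q)) =
    (der X (der Y p) - der Y (der X p)) * q + p * (der X (der Y q) - der Y (der X q))"
    by (simp add: der_mult der_add algebra_simps)
  then show ?case by (simp add: mult der_mult)
qed (simp_all add: der_row_form row_form_diff der_add algebra_simps)

text \<open>The vector field \<open>X\<close> is mapped to \<open>Y\<close> by the linear map \<open>P\<close>.\<close>

lemma der_subst:
  assumes "P ** X = Y ** P"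
  shows "der X (subst_poly (row_form P) p) = subst_poly (row_form P) (der Y p)"
  by (induction p rule: cpoly_generators_induct)
    (simp_all add: subst_simps der_add der_mult der_row_form subst_row_form assms)


section \<open>Pullback of forms and its infinitesimal version\<close>

text \<open>The Lie derivative along the vector field \<open>X\<close>. The sum comes from the differentials of the linear forms
  \<open>row_form X i\<close>.\<close>

definition lie :: "complex^3^3 \<Rightarrow> 3 form \<Rightarrow> 3 form" where
  "lie X \<omega> = (\<chi> j. der X (\<omega> $ j) + (\<Sum>i\<in>UNIV. Const (X $ i $ j) * \<omega> $ i))"

lemma pullback_nth:
  "pullback M \<omega> $ j = (\<Sum>i\<in>UNIV. Const (M $ i $ j) * subst_poly (row_form M) (\<omega> $ i))"
  by (simp add: pullback_def row_form_def[abs_def])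

lemma lie_nth: "lie X \<omega> $ j = der X (\<omega> $ j) + (\<Sum>i\<in>UNIV. Const (X $ i $ j) * \<omega> $ i)"
  by (simp add: lie_def)

lemma sum_matrix_swap:
  "(\<Sum>k\<in>UNIV. Const (X $ k $ j) * (\<Sum>i\<in>UNIV. Const (P $ i $ k) * f i)) =
    (\<Sum>i\<in>UNIV. Const ((P ** X) $ i $ j) * f i)" for f :: "'n::finite \<Rightarrow> 'v cpoly"
proof -
  have "(\<Sum>k\<in>UNIV. Const (X $ k $ j) * (\<Sum>i\<in>UNIV. Const (P $ i $ k) * f i)) =
    (\<Sum>k\<in>UNIV. \<Sum>i\<in>UNIV. Const (P $ i $ k * X $ k $ j) * f i)"
    by (simp add: sum_distrib_left Const_mult mult_ac)
  also have "\<dots> = (\<Sum>i\<in>UNIV. \<Sum>k\<in>UNIV. Const (P $ i $ k * X $ k $ j) * f i)"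
    by (rule sum.swap)
  finally show ?thesis
    by (simp add: matrix_matrix_mult_def Const_sum sum_distrib_right)
qed

lemma pullback_pullback: "pullback B (pullback A \<omega>) = pullback (A ** B) \<omega>"
  by (simp add: vec_eq_iff pullback_nth subst_simps subst_subst subst_row_form sum_matrix_swap)

lemma pullback_mat: "pullback (mat 1) \<omega> = \<omega>"
proof -
  have "row_form (mat 1) = (Var :: 3 \<Rightarrow> _)"
    by (rule ext) (simp add: row_form_mat Const_1)
  then show ?thesis
    by (simp add: vec_eq_iff pullback_nth subst_id mat_def if_distrib[of Const] mult_delta_left Const_1
        cong: if_cong)
qed

lemma pullback_inverse:
  assumes "P ** Q = mat 1"
  shows "pullback Q (pullback P \<omega>) = \<omega>"
  by (simp add: pullback_pullback assms pullback_mat)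

lemma pullback_scale: "pullback M (Const c *s \<omega>) = Const c *s pullback M \<omega>"
  by (simp add: vec_eq_iff pullback_nth subst_simps sum_distrib_left mult_ac)

lemma lie_pullback:
  assumes "P ** X = Y ** P"
  shows "lie X (pullback P \<omega>) = pullback P (lie Y \<omega>)"
proof -
  have "lie X (pullback P \<omega>) $ j = (\<Sum>i\<in>UNIV. Const (P $ i $ j) * der X (subst_poly (row_form P) (\<omega> $ i))) +
     (\<Sum>i\<in>UNIV. Const ((P ** X) $ i $ j) * subst_poly (row_form P) (\<omega> $ i))" for j
    by (simp add: lie_nth pullback_nth sum_matrix_swap der_sum der_mult)
  moreover have "pullback P (lie Y \<omega>) $ j = (\<Sum>i\<in>UNIV. Const (P $ i $ j) * subst_poly (row_form P) (der Y (\<omega> $ i))) +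
     (\<Sum>i\<in>UNIV. Const ((Y ** P) $ i $ j) * subst_poly (row_form P) (\<omega> $ i))" for j
    by (simp add: lie_nth pullback_nth sum_matrix_swap[symmetric] subst_simps distrib_left sum.distrib)
  ultimately show ?thesis
    by (simp add: vec_eq_iff der_subst[OF assms] assms)
qed

text \<open>As the rows of a matrix are the images of the coordinates, composition of vector fields reverses the order
  of the matrix product.\<close>

lemma lie_bracket: "lie X (lie Y \<omega>) - lie Y (lie X \<omega>) = lie (Y ** X - X ** Y) \<omega>"
proof -
  have "lie X (lie Y \<omega>) $ j = der X (der Y (\<omega> $ j)) + (\<Sum>i\<in>UNIV. Const (Y $ i $ j) * der X (\<omega> $ i))
     + (\<Sum>i\<in>UNIV. Const (X $ i $ j) * der Y (\<omega> $ i)) + (\<Sum>i\<in>UNIV. Const ((Y ** X) $ i $ j) * \<omega> $ i)" for X Y j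
    by (simp add: lie_nth der_add der_sum der_mult distrib_left sum.distrib sum_matrix_swap)
  moreover have "(\<Sum>i\<in>UNIV. Const ((Y ** X - X ** Y) $ i $ j) * \<omega> $ i) =
     (\<Sum>i\<in>UNIV. Const ((Y ** X) $ i $ j) * \<omega> $ i) - (\<Sum>i\<in>UNIV. Const ((X ** Y) $ i $ j) * \<omega> $ i)" for j
    by (simp add: sum_subtractf left_diff_distrib Const_diff)
  moreover have "lie (Y ** X - X ** Y) \<omega> $ j = der X (der Y (\<omega> $ j)) - der Y (der X (\<omega> $ j)) +
      (\<Sum>i\<in>UNIV. Const ((Y ** X - X ** Y) $ i $ j) * \<omega> $ i)" for j
    by (simp add: lie_nth der_bracket)
  ultimately show ?thesis
    unfolding vec_eq_iff vector_minus_component by (simp only:) (simp add: algebra_simps)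
qed

abbreviation smul :: "complex \<Rightarrow> complex^3^3 \<Rightarrow> complex^3^3" where
  "smul c X \<equiv> (\<chi> i j. c * X $ i $ j)"

lemma row_form_smul: "row_form (smul c X) i = Const c * row_form X i"
  by (simp add: row_form_def sum_distrib_left Const_mult mult_ac)

lemma lie_smul: "lie (smul c X) \<omega> = Const c *s lie X \<omega>"
  by (simp add: vec_eq_iff lie_nth der_def row_form_smul sum_distrib_left distrib_left Const_mult mult_ac)

lemma lie_add: "lie (X + Y) \<omega> = lie X \<omega> + lie Y \<omega>"
  by (simp add: vec_eq_iff lie_nth der_def row_form_add sum.distrib distrib_right Const_add algebra_simps)

lemma lie_diff: "lie (X - Y) \<omega> = lie X \<omega> - lie Y \<omega>"
  using lie_add[of "X - Y" Y \<omega>] by (simp add: algebra_simps)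

lemma lie_0 [simp]: "lie 0 \<omega> = 0"
  using lie_add[of 0 0 \<omega>] by simp

lemma homogeneous_row_form: "homogeneous 1 (row_form X i)"
  unfolding row_form_def by (intro homogeneous_sum homogeneous_scale homogeneous_Var)

lemma homogeneous_subst:
  assumes "homogeneous n p" "\<And>v. homogeneous 1 (f v)"
  shows "homogeneous n (subst_poly f p)"
  unfolding insertion_by_def
proof (intro homogeneous_sum homogeneous_scale)
  fix m assume "m \<in> Poly_Mapping.keys p"
  then have n: "n = (\<Sum>v\<in>Poly_Mapping.keys m. Poly_Mapping.lookup m v * 1)"
    using assms by (simp add: homogeneous_def mdeg_def)
  show "homogeneous n (\<Prod>v\<in>Poly_Mapping.keys m. f v ^ Poly_Mapping.lookup m v)"
    unfolding n by (intro homogeneous_prod homogeneous_power assms)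
qed

lemma pullback_twisted:
  assumes "\<omega> \<in> twisted_forms d"
  shows "pullback M \<omega> \<in> twisted_forms d"
proof -
  have "homogeneous (d + 1) (pullback M \<omega> $ j)" for j
    unfolding pullback_nth using assms
    by (intro homogeneous_sum homogeneous_scale homogeneous_subst homogeneous_row_form)
      (simp add: twisted_forms_def)
  moreover have "(\<Sum>j\<in>UNIV. Var j * pullback M \<omega> $ j) =
      subst_poly (row_form M) (\<Sum>i\<in>UNIV. Var i * \<omega> $ i)"
  proof -
    have "(\<Sum>j\<in>UNIV. Var j * pullback M \<omega> $ j) =
      (\<Sum>j\<in>UNIV. \<Sum>i\<in>UNIV. Const (M $ i $ j) * Var j * subst_poly (row_form M) (\<omega> $ i))"
      by (simp add: pullback_nth sum_distrib_left mult_ac)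
    also have "\<dots> = (\<Sum>i\<in>UNIV. \<Sum>j\<in>UNIV. Const (M $ i $ j) * Var j * subst_poly (row_form M) (\<omega> $ i))"
      by (rule sum.swap)
    finally show ?thesis
      by (simp add: subst_simps row_form_def[of M] sum_distrib_right)
  qed
  moreover have "(\<Sum>i\<in>UNIV. Var i * \<omega> $ i) = 0"
    using assms by (simp add: twisted_forms_def)
  ultimately show ?thesis
    by (simp add: twisted_forms_def)
qed

lemma subst_dvd: "p dvd q \<Longrightarrow> subst_poly f p dvd subst_poly f q"
  by (auto simp: dvd_def subst_simps)

lemma pullback_no_common_factor:
  assumes "no_common_factor \<omega>" "P ** Q = mat 1"
  shows "no_common_factor (pullback P \<omega>)"
  unfolding no_common_factor_def
proof (intro allI impI)
  fix p assume p: "\<forall>i. p dvd pullback P \<omega> $ i"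
  have "subst_poly (row_form Q) p dvd pullback Q (pullback P \<omega>) $ i" for i
    unfolding pullback_nth[of Q] using p by (intro dvd_sum dvd_mult subst_dvd) auto
  then have "subst_poly (row_form Q) p dvd 1"
    using assms(1) by (simp add: pullback_inverse[OF assms(2)] no_common_factor_def)
  then have "subst_poly (row_form P) (subst_poly (row_form Q) p) dvd subst_poly (row_form P) 1"
    by (rule subst_dvd)
  moreover have "subst_poly (row_form P) (subst_poly (row_form Q) p) = p"
  proof -
    have "Q ** P = mat 1" using assms(2) matrix_left_right_inverse by blast
    then show ?thesis
      by (simp add: subst_subst subst_row_form row_form_mat Const_1 subst_id)
  qed
  ultimately show "p dvd 1" by simp
qed

section \<open>Polynomial functions of finitely many parameters\<close>

text \<open>Polynomials of total degree at most \<open>D\<close> in the parameters \<open>t i\<close>, \<open>i \<in> I\<close>, as functions. The slack in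
  the rules for the degree makes \<open>D\<close> an upper bound only.\<close>

inductive polyfun :: "nat set \<Rightarrow> nat \<Rightarrow> ((nat \<Rightarrow> complex) \<Rightarrow> complex) \<Rightarrow> bool" for I where
  polyfun_const: "polyfun I D (\<lambda>t. c)"
| polyfun_var: "i \<in> I \<Longrightarrow> D \<ge> 1 \<Longrightarrow> polyfun I D (\<lambda>t. t i)"
| polyfun_add: "polyfun I D f \<Longrightarrow> polyfun I D g \<Longrightarrow> polyfun I D (\<lambda>t. f t + g t)"
| polyfun_mult: "polyfun I D f \<Longrightarrow> polyfun I E g \<Longrightarrow> D + E \<le> F \<Longrightarrow> polyfun I F (\<lambda>t. f t * g t)"

lemma polyfun_cmult: "polyfun I D f \<Longrightarrow> polyfun I D (\<lambda>t. c * f t)"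
  using polyfun_mult[OF polyfun_const[of I 0 c], of D f D] by simp

lemma polyfun_sum:
  "(\<And>a. a \<in> A \<Longrightarrow> polyfun I D (f a)) \<Longrightarrow> polyfun I D (\<lambda>t. \<Sum>a\<in>A. f a t)"
  by (induction A rule: infinite_finite_induct) (auto intro: polyfun.intros)

lemma polyfun_prod:
  "(\<And>a. a \<in> A \<Longrightarrow> polyfun I (D a) (f a)) \<Longrightarrow> polyfun I (\<Sum>a\<in>A. D a) (\<lambda>t. \<Prod>a\<in>A. f a t)"
  by (induction A rule: infinite_finite_induct) (auto intro: polyfun_const polyfun_mult[OF _ _ order_refl])

lemma polyfun_power: "polyfun I D f \<Longrightarrow> polyfun I (n * D) (\<lambda>t. f t ^ n)"
  by (induction n) (auto intro: polyfun.intros)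

text \<open>On a line a polynomial in several variables becomes a polynomial in one variable, which has finitely many
  zeros unless it vanishes.\<close>

lemma polyfun_line:
  assumes "polyfun I D f"
  shows "\<exists>p. \<forall>s. f (\<lambda>i. a i + s * b i) = poly p s"
  using assms
proof (induction rule: polyfun.induct)
  case (polyfun_const D c)
  then show ?case by (intro exI[of _ "[:c:]"]) simp
next
  case (polyfun_var i D)
  then show ?case by (intro exI[of _ "[:a i, b i:]"]) simp
next
  case (polyfun_add D f g)
  then obtain p q where "\<forall>s. f (\<lambda>i. a i + s * b i) = poly p s" "\<forall>s. g (\<lambda>i. a i + s * b i) = poly q s"
    by blast
  then show ?case by (intro exI[of _ "p + q"]) simp
next
  case (polyfun_mult D f E g F)
  then obtain p q where "\<forall>s. f (\<lambda>i. a i + s * b i) = poly p s" "\<forall>s. g (\<lambda>i. a i + s * b i) = poly q s"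
    by blast
  then show ?case by (intro exI[of _ "p * q"]) simp
qed

text \<open>The ring of polynomial functions has no zero divisors: join a point where the first factor
  does not vanish to one where the second does not; on this line both have finitely many zeros.\<close>

lemma polyfun_mult_nonzero:
  assumes f: "polyfun I D f" "f a \<noteq> 0" and g: "polyfun J E g" "g b \<noteq> 0"
  shows "\<exists>t. f t \<noteq> 0 \<and> g t \<noteq> 0"
proof -
  obtain p where p: "\<And>s. f (\<lambda>i. a i + s * (b i - a i)) = poly p s"
    using polyfun_line[OF f(1), of a "\<lambda>i. b i - a i"] by blast
  obtain q where q: "\<And>s. g (\<lambda>i. a i + s * (b i - a i)) = poly q s"
    using polyfun_line[OF g(1), of a "\<lambda>i. b i - a i"] by blast
  have "poly p 0 \<noteq> 0" "poly q 1 \<noteq> 0"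
    using f(2) g(2) by (simp_all flip: p q)
  then have "p * q \<noteq> 0" by auto
  then have "finite {s. poly (p * q) s = 0}" by (rule poly_roots_finite)
  then obtain s where "poly (p * q) s \<noteq> 0"
    using infinite_UNIV_char_0[where 'a = complex] by (metis (mono_tags) UNIV_eq_I mem_Collect_eq)
  then show ?thesis
    using p[of s] q[of s] by (intro exI[of _ "\<lambda>i. a i + s * (b i - a i)"]) simp
qed

lemma sum_PiE_insert:
  assumes "j \<notin> I"
  shows "(\<Sum>\<alpha>\<in>PiE (insert j I) (\<lambda>_. S). F \<alpha>) = (\<Sum>k\<in>S. \<Sum>\<beta>\<in>PiE I (\<lambda>_. S). F (\<beta>(j := k)))"
proof -
  have "inj_on (\<lambda>(k, \<alpha>). \<alpha>(j := k)) (S \<times> PiE I (\<lambda>_. S))"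
    using inj_combinator[of j I "\<lambda>_. S"] assms by simp
  then show ?thesis
    unfolding PiE_insert_eq
    by (subst sum.reindex) (simp_all add: case_prod_unfold comp_def sum.cartesian_product)
qed

lemma box_monomials_independent:
  fixes c :: "(nat \<Rightarrow> nat) \<Rightarrow> complex"
  assumes "finite I" "\<And>y. (\<Sum>\<alpha>\<in>PiE I (\<lambda>_. {..<N}). c \<alpha> * (\<Prod>i\<in>I. y i ^ \<alpha> i)) = 0"
    "\<alpha> \<in> PiE I (\<lambda>_. {..<N})"
  shows "c \<alpha> = 0"
  using assms
proof (induction I arbitrary: c \<alpha> rule: finite_induct)
  case empty
  then show ?case by simp
next
  case (insert j I)
  let ?B = "PiE I (\<lambda>_. {..<N})"
  have split: "(\<Sum>\<alpha>\<in>PiE (insert j I) (\<lambda>_. {..<N}). c \<alpha> * (\<Prod>i\<in>insert j I. y i ^ \<alpha> i)) =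
      (\<Sum>k<N. (\<Sum>\<alpha>\<in>?B. c (\<alpha>(j := k)) * (\<Prod>i\<in>I. y i ^ \<alpha> i)) * y j ^ k)" for y :: "nat \<Rightarrow> complex"
  proof -
    have "c (\<alpha>(j := k)) * (\<Prod>i\<in>insert j I. y i ^ (\<alpha>(j := k)) i) =
        c (\<alpha>(j := k)) * (\<Prod>i\<in>I. y i ^ \<alpha> i) * y j ^ k" for k \<alpha>
    proof -
      have "(\<Prod>i\<in>I. y i ^ (\<alpha>(j := k)) i) = (\<Prod>i\<in>I. y i ^ \<alpha> i)"
        by (rule prod.cong) (use insert.hyps in auto)
      then show ?thesis using insert.hyps by simp
    qed
    then show ?thesis
      using insert.hyps by (simp only: sum_PiE_insert sum_distrib_right not_False_eq_True)
  qed
  have zero: "(\<Sum>\<alpha>\<in>?B. c (\<alpha>(j := k)) * (\<Prod>i\<in>I. y i ^ \<alpha> i)) = 0" if "k < N" for k y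
  proof -
    let ?d = "\<lambda>k. \<Sum>\<alpha>\<in>?B. c (\<alpha>(j := k)) * (\<Prod>i\<in>I. y i ^ \<alpha> i)"
    let ?p = "\<Sum>k<N. monom (?d k) k"
    have "poly ?p s = 0" for s
    proof -
      have "(\<Sum>\<alpha>\<in>?B. c (\<alpha>(j := k)) * (\<Prod>i\<in>I. (y(j := s)) i ^ \<alpha> i)) = ?d k" for k
        by (intro sum.cong refl arg_cong2[where f = "(*)"] prod.cong) (use insert.hyps in auto)
      then have "(\<Sum>k<N. ?d k * s ^ k) = 0"
        using split[of "y(j := s)"] insert.prems(1)[of "y(j := s)"] by simp
      then show ?thesis by (simp add: poly_sum poly_monom)
    qed
    then have "?p = 0" using poly_all_0_iff_0 by blast
    then have "coeff ?p k = 0" by simp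
    then show ?thesis using that by (simp add: coeff_sum)
  qed
  obtain k \<beta> where k: "k < N" "\<beta> \<in> ?B" "\<alpha> = \<beta>(j := k)"
    using insert.prems(2) by (auto simp: PiE_insert_eq)
  show ?case
    using insert.IH[of "\<lambda>\<alpha>. c (\<alpha>(j := k))" \<beta>] zero[OF k(1)] k by blast
qed

text \<open>Gaussian elimination, one coordinate at a time.\<close>

lemma linear_relation_exists:
  fixes m :: "'a \<Rightarrow> 'b \<Rightarrow> complex"
  assumes "finite T" "finite A" "card T < card A"
  shows "\<exists>c. (\<exists>a\<in>A. c a \<noteq> 0) \<and> (\<forall>t\<in>T. (\<Sum>a\<in>A. c a * m a t) = 0)"
  using assms
proof (induction T arbitrary: A m rule: finite_induct)
  case empty
  then obtain a where "a \<in> A" by fastforce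
  then show ?case by (intro exI[of _ "\<lambda>_. 1"]) auto
next
  case (insert u T)
  show ?case
  proof (cases "\<forall>a\<in>A. m a u = 0")
    case True
    obtain c where "\<exists>a\<in>A. c a \<noteq> 0" "\<forall>t\<in>T. (\<Sum>a\<in>A. c a * m a t) = 0"
      using insert.IH[of A m] insert.prems insert.hyps by auto
    then show ?thesis using True by (intro exI[of _ c]) auto
  next
    case False
    then obtain b where b: "b \<in> A" "m b u \<noteq> 0" by blast
    let ?m = "\<lambda>a t. m a t - m a u / m b u * m b t"
    have "card T < card (A - {b})"
      using insert.prems insert.hyps b by simp
    then obtain c where c: "\<exists>a\<in>A - {b}. c a \<noteq> 0" "\<forall>t\<in>T. (\<Sum>a\<in>A - {b}. c a * ?m a t) = 0"
      using insert.IH[of "A - {b}" ?m] insert.prems by auto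
    define c' where "c' = c(b := - (\<Sum>a\<in>A - {b}. c a * (m a u / m b u)))"
    have sum: "(\<Sum>a\<in>A. c' a * m a t) = (\<Sum>a\<in>A - {b}. c a * ?m a t)" for t
    proof -
      have "(\<Sum>a\<in>A. c' a * m a t) = c' b * m b t + (\<Sum>a\<in>A - {b}. c' a * m a t)"
        using b insert.prems by (simp add: sum.remove)
      also have "(\<Sum>a\<in>A - {b}. c' a * m a t) = (\<Sum>a\<in>A - {b}. c a * m a t)"
        by (rule sum.cong) (auto simp: c'_def)
      also have "c' b * m b t + (\<Sum>a\<in>A - {b}. c a * m a t) = (\<Sum>a\<in>A - {b}. c a * ?m a t)"
        by (simp add: c'_def sum_distrib_right right_diff_distrib sum_subtractf mult.assoc)
      finally show ?thesis .
    qed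
    have "\<exists>a\<in>A. c' a \<noteq> 0" using c(1) by (auto simp: c'_def)
    moreover have "(\<Sum>a\<in>A. c' a * m a t) = 0" if "t \<in> insert u T" for t
      using that c(2) b by (auto simp: sum)
    ultimately show ?thesis by blast
  qed
qed

lemma polyfun_span:
  assumes "polyfun I D f" "finite I"
  shows "\<exists>c. \<forall>t. f t = (\<Sum>\<alpha>\<in>PiE I (\<lambda>_. {..D}). c \<alpha> * (\<Prod>i\<in>I. t i ^ \<alpha> i))"
  using assms(1)
proof (induction rule: polyfun.induct)
  case (polyfun_const D c)
  let ?z = "\<lambda>i\<in>I. 0::nat"
  have "(\<Sum>\<alpha>\<in>PiE I (\<lambda>_. {..D}). (if \<alpha> = ?z then c else 0) * (\<Prod>i\<in>I. t i ^ \<alpha> i)) =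
      c * (\<Prod>i\<in>I. t i ^ ?z i)" for t :: "nat \<Rightarrow> complex"
    using assms(2) by (simp add: mult_delta_left sum.delta finite_PiE)
  then show ?case
    by (intro exI[of _ "\<lambda>\<alpha>. if \<alpha> = ?z then c else 0"]) simp
next
  case (polyfun_var j D)
  let ?z = "\<lambda>i\<in>I. if i = j then 1 else 0::nat"
  have "(\<Sum>\<alpha>\<in>PiE I (\<lambda>_. {..D}). (if \<alpha> = ?z then 1 else 0) * (\<Prod>i\<in>I. t i ^ \<alpha> i)) =
      (\<Prod>i\<in>I. t i ^ ?z i)" for t :: "nat \<Rightarrow> complex"
    using assms(2) polyfun_var by (simp add: mult_delta_left sum.delta finite_PiE)
  moreover have "(\<Prod>i\<in>I. t i ^ ?z i) = t j" for t :: "nat \<Rightarrow> complex"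
  proof -
    have "(\<Prod>i\<in>I. t i ^ ?z i) = (\<Prod>i\<in>I. if i = j then t j else 1)"
      by (rule prod.cong) auto
    then show ?thesis using assms(2) polyfun_var by simp
  qed
  ultimately show ?case
    by (intro exI[of _ "\<lambda>\<alpha>. if \<alpha> = ?z then 1 else 0"]) simp
next
  case (polyfun_add D f g)
  then obtain c d where "\<And>t. f t = (\<Sum>\<alpha>\<in>PiE I (\<lambda>_. {..D}). c \<alpha> * (\<Prod>i\<in>I. t i ^ \<alpha> i))"
    "\<And>t. g t = (\<Sum>\<alpha>\<in>PiE I (\<lambda>_. {..D}). d \<alpha> * (\<Prod>i\<in>I. t i ^ \<alpha> i))" by blast
  then show ?case
    by (intro exI[of _ "\<lambda>\<alpha>. c \<alpha> + d \<alpha>"]) (simp add: distrib_right sum.distrib)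
next
  case (polyfun_mult D f E g F)
  let ?M = "\<lambda>t \<alpha>. \<Prod>i\<in>I. t i ^ \<alpha> i :: complex"
  let ?A = "PiE I (\<lambda>_. {..D})" and ?B = "PiE I (\<lambda>_. {..E})" and ?C = "PiE I (\<lambda>_. {..F})"
  obtain c d where c: "\<And>t. f t = (\<Sum>\<alpha>\<in>?A. c \<alpha> * ?M t \<alpha>)" and d: "\<And>t. g t = (\<Sum>\<alpha>\<in>?B. d \<alpha> * ?M t \<alpha>)"
    using polyfun_mult.IH by blast
  let ?s = "\<lambda>x. \<lambda>i\<in>I. fst x i + snd x i :: nat"
  define e where "e \<gamma> = (\<Sum>x\<in>{x \<in> ?A \<times> ?B. ?s x = \<gamma>}. c (fst x) * d (snd x))" for \<gamma>
  have sub: "?s ` (?A \<times> ?B) \<subseteq> ?C"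
  proof (rule image_subsetI)
    fix x assume "x \<in> ?A \<times> ?B"
    then have x: "fst x \<in> ?A" "snd x \<in> ?B" by auto
    have "fst x i + snd x i \<le> F" if "i \<in> I" for i
      by (rule order_trans[OF add_mono[of _ D _ E]]) (use x that polyfun_mult.hyps(3) in auto)
    then show "?s x \<in> ?C" by auto
  qed
  have "f t * g t = (\<Sum>\<gamma>\<in>?C. e \<gamma> * ?M t \<gamma>)" for t
  proof -
    have "?M t (?s x) = ?M t (fst x) * ?M t (snd x)" for x
      unfolding prod.distrib[symmetric] by (rule prod.cong) (auto simp: power_add)
    then have *: "c (fst x) * d (snd x) * ?M t (?s x) = (c (fst x) * ?M t (fst x)) * (d (snd x) * ?M t (snd x))" for x
      by (simp only: mult_ac)
    have "f t * g t = (\<Sum>x\<in>?A \<times> ?B. (c (fst x) * ?M t (fst x)) * (d (snd x) * ?M t (snd x)))"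
      unfolding c d sum_product sum.cartesian_product by (simp add: case_prod_unfold)
    also have "\<dots> = (\<Sum>x\<in>?A \<times> ?B. c (fst x) * d (snd x) * ?M t (?s x))"
      by (simp only: *)
    also have "\<dots> = (\<Sum>\<gamma>\<in>?C. \<Sum>x\<in>{x \<in> ?A \<times> ?B. ?s x = \<gamma>}. c (fst x) * d (snd x) * ?M t (?s x))"
      by (rule sum.group[symmetric]) (use sub assms(2) in \<open>auto intro!: finite_PiE\<close>)
    also have "\<dots> = (\<Sum>\<gamma>\<in>?C. e \<gamma> * ?M t \<gamma>)"
      unfolding e_def sum_distrib_right by (intro sum.cong refl) auto
    finally show ?thesis .
  qed
  then show ?case by blast
qed

text \<open>Polynomials of degree at most \<open>D\<close> in \<open>card I\<close> parameters span a space of dimension at most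
  \<open>(D + 1) ^ card I\<close>.\<close>

lemma polyfun_relation:
  fixes g :: "'a \<Rightarrow> (nat \<Rightarrow> complex) \<Rightarrow> complex"
  assumes "finite I" "finite A" "(D + 1) ^ card I < card A" "\<And>a. a \<in> A \<Longrightarrow> polyfun I D (g a)"
  shows "\<exists>c. (\<exists>a\<in>A. c a \<noteq> 0) \<and> (\<forall>t. (\<Sum>a\<in>A. c a * g a t) = 0)"
proof -
  let ?T = "PiE I (\<lambda>_. {..D})"
  have "\<forall>a\<in>A. \<exists>m. \<forall>t. g a t = (\<Sum>\<alpha>\<in>?T. m \<alpha> * (\<Prod>i\<in>I. t i ^ \<alpha> i))"
    using polyfun_span assms(1,4) by blast
  then obtain m where m: "\<And>a t. a \<in> A \<Longrightarrow> g a t = (\<Sum>\<alpha>\<in>?T. m a \<alpha> * (\<Prod>i\<in>I. t i ^ \<alpha> i))"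
    using bchoice[of A "\<lambda>a m. \<forall>t. g a t = (\<Sum>\<alpha>\<in>?T. m \<alpha> * (\<Prod>i\<in>I. t i ^ \<alpha> i))"] by blast
  have "card ?T < card A"
    using assms(1,3) by (simp add: card_PiE)
  then obtain c where c: "\<exists>a\<in>A. c a \<noteq> 0" "\<forall>\<alpha>\<in>?T. (\<Sum>a\<in>A. c a * m a \<alpha>) = 0"
    using linear_relation_exists[of ?T A m] assms(1,2) by (auto simp: finite_PiE)
  have "(\<Sum>a\<in>A. c a * g a t) = 0" for t
  proof -
    have "(\<Sum>a\<in>A. c a * g a t) = (\<Sum>a\<in>A. \<Sum>\<alpha>\<in>?T. c a * m a \<alpha> * (\<Prod>i\<in>I. t i ^ \<alpha> i))"
      by (simp add: m sum_distrib_left mult_ac)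
    also have "\<dots> = (\<Sum>\<alpha>\<in>?T. (\<Sum>a\<in>A. c a * m a \<alpha>) * (\<Prod>i\<in>I. t i ^ \<alpha> i))"
      unfolding sum_distrib_right by (rule sum.swap)
    finally show ?thesis using c(2) by simp
  qed
  then show ?thesis using c(1) by blast
qed

section \<open>Polynomial families of polynomials and of forms\<close>

lemma finite_monomials: "finite {m :: 'v::finite \<Rightarrow>\<^sub>0 nat. mdeg m = d}"
proof -
  have le: "Poly_Mapping.lookup m v \<le> mdeg m" for m :: "'v \<Rightarrow>\<^sub>0 nat" and v
  proof (cases "v \<in> Poly_Mapping.keys m")
    case True
    then show ?thesis unfolding mdeg_def by (intro member_le_sum) auto
  qed (simp add: in_keys_iff)
  have "Poly_Mapping.lookup ` {m :: 'v \<Rightarrow>\<^sub>0 nat. mdeg m = d} \<subseteq> PiE UNIV (\<lambda>_. {..d})"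
    using le by (auto simp only: image_subset_iff mem_Collect_eq PiE_UNIV_domain Pi_iff atMost_iff)
  then have "finite (Poly_Mapping.lookup ` {m :: 'v \<Rightarrow>\<^sub>0 nat. mdeg m = d})"
    by (rule finite_subset) (intro finite_PiE finite finite_atMost)
  then show ?thesis
    by (rule finite_imageD) (simp add: inj_on_def lookup_inject)
qed

text \<open>The common degree confines the exponents to a finite set, so that the coefficients of a product are finite sums.\<close>

definition polyfam :: "nat set \<Rightarrow> nat \<Rightarrow> nat \<Rightarrow> ((nat \<Rightarrow> complex) \<Rightarrow> 'v::finite cpoly) \<Rightarrow> bool" where
  "polyfam I d D P \<longleftrightarrow> (\<forall>t. homogeneous d (P t)) \<and> (\<forall>m. polyfun I D (\<lambda>t. Poly_Mapping.lookup (P t) m))"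

lemma polyfam_mult:
  assumes "polyfam I d D P" "polyfam I e E Q"
  shows "polyfam I (d + e) (D + E) (\<lambda>t. P t * Q t)"
proof -
  have *: "Poly_Mapping.lookup (P t * Q t) m = (\<Sum>a\<in>{m. mdeg m = d}. \<Sum>b\<in>{m. mdeg m = e}.
     (if a + b = m then 1 else 0) * (Poly_Mapping.lookup (P t) a * Poly_Mapping.lookup (Q t) b))" for t m
  proof -
    have "Poly_Mapping.keys (P t) \<subseteq> {m. mdeg m = d}" "Poly_Mapping.keys (Q t) \<subseteq> {m. mdeg m = e}"
      using assms by (auto simp: polyfam_def homogeneous_def)
    then show ?thesis
      by (subst lookup_mult_superset[OF finite_monomials _ finite_monomials])
        (auto intro!: sum.cong)
  qed
  have "polyfun I (D + E) (\<lambda>t. Poly_Mapping.lookup (P t) a * Poly_Mapping.lookup (Q t) b)" for a b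
    by (rule polyfun_mult[of I D _ E]) (use assms in \<open>simp_all add: polyfam_def\<close>)
  then have "polyfun I (D + E) (\<lambda>t. Poly_Mapping.lookup (P t * Q t) m)" for m
    unfolding * by (intro polyfun_sum polyfun_cmult)
  then show ?thesis
    using assms by (simp add: polyfam_def homogeneous_mult)
qed

lemma polyfam_Const: "polyfun I D f \<Longrightarrow> polyfam I 0 D (\<lambda>t. Const (f t))"
  unfolding polyfam_def
proof (intro conjI allI homogeneous_Const)
  fix m assume "polyfun I D f"
  then show "polyfun I D (\<lambda>t. Poly_Mapping.lookup (Const (f t)) m)"
    by (cases "m = 0") (simp_all add: lookup_Const polyfun_const)
qed

lemma polyfam_fixed: "homogeneous d p \<Longrightarrow> polyfam I d 0 (\<lambda>t. p)"
  by (simp add: polyfam_def polyfun_const)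

lemma polyfam_sum:
  "(\<And>a. a \<in> A \<Longrightarrow> polyfam I d D (P a)) \<Longrightarrow> polyfam I d D (\<lambda>t. \<Sum>a\<in>A. P a t)"
  by (auto simp: polyfam_def lookup_sum intro: homogeneous_sum polyfun_sum)

lemma polyfam_power: "polyfam I d D P \<Longrightarrow> polyfam I (n * d) (n * D) (\<lambda>t. P t ^ n)"
  by (induction n) (auto intro: polyfam_mult polyfam_fixed homogeneous_1)

lemma polyfam_prod:
  "(\<And>a. a \<in> A \<Longrightarrow> polyfam I (d a) (D a) (P a)) \<Longrightarrow>
     polyfam I (\<Sum>a\<in>A. d a) (\<Sum>a\<in>A. D a) (\<lambda>t. \<Prod>a\<in>A. P a t)"
  by (induction A rule: infinite_finite_induct) (auto intro: polyfam_mult polyfam_fixed homogeneous_1)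

lemma polyfam_Const_mult:
  "polyfun I D f \<Longrightarrow> polyfam I d E P \<Longrightarrow> polyfam I d (D + E) (\<lambda>t. Const (f t) * P t)"
  using polyfam_mult[OF polyfam_Const] by fastforce

lemma polyfun_pullback:
  assumes S: "\<And>i j. polyfun I 1 (\<lambda>t. S t $ i $ j)" and \<omega>: "\<omega> \<in> twisted_forms d"
  shows "polyfun I (d + 2) (\<lambda>t. form_coord (pullback (S t) \<omega>) v)"
proof -
  have lin: "polyfam I 1 1 (\<lambda>t. row_form (S t) i)" for i
    unfolding row_form_def
    using polyfam_sum[OF polyfam_Const_mult[OF S polyfam_fixed[OF homogeneous_Var]]] by simp
  have sub: "polyfam I (d + 1) (d + 1) (\<lambda>t. subst_poly (row_form (S t)) (\<omega> $ i))" for i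
    unfolding insertion_by_def
  proof (intro polyfam_sum)
    fix m assume "m \<in> Poly_Mapping.keys (\<omega> $ i)"
    then have m: "(\<Sum>v\<in>Poly_Mapping.keys m. Poly_Mapping.lookup m v * 1) = d + 1"
      using \<omega> by (simp add: twisted_forms_def homogeneous_def mdeg_def)
    have "polyfam I (d + 1) (d + 1) (\<lambda>t. \<Prod>v\<in>Poly_Mapping.keys m. row_form (S t) v ^ Poly_Mapping.lookup m v)"
      using polyfam_prod[of "Poly_Mapping.keys m" I "\<lambda>v. Poly_Mapping.lookup m v * 1" "\<lambda>v. Poly_Mapping.lookup m v * 1"
          "\<lambda>v t. row_form (S t) v ^ Poly_Mapping.lookup m v", OF polyfam_power[OF lin]] unfolding m .
    then show "polyfam I (d + 1) (d + 1) (\<lambda>t. Const (Poly_Mapping.lookup (\<omega> $ i) m) *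
        (\<Prod>v\<in>Poly_Mapping.keys m. row_form (S t) v ^ Poly_Mapping.lookup m v))"
      using polyfam_Const_mult[OF polyfun_const[of I 0]] by fastforce
  qed
  have "polyfam I (d + 1) (1 + (d + 1)) (\<lambda>t. pullback (S t) \<omega> $ j)" for j
    unfolding pullback_nth by (intro polyfam_sum polyfam_Const_mult S sub)
  then show ?thesis
    by (cases v) (simp add: form_coord_def polyfam_def)
qed

lemma polyfun_eval:
  assumes "\<And>v. polyfun I D (\<lambda>t. x t v)" "homogeneous M p"
  shows "polyfun I (M * D) (\<lambda>t. eval_poly (x t) p)"
  unfolding insertion_by_def
proof (intro polyfun_sum polyfun_cmult)
  fix m assume "m \<in> Poly_Mapping.keys p"
  then have m: "(\<Sum>v\<in>Poly_Mapping.keys m. Poly_Mapping.lookup m v * D) = M * D"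
    using assms by (simp add: homogeneous_def mdeg_def flip: sum_distrib_right)
  show "polyfun I (M * D) (\<lambda>t. \<Prod>v\<in>Poly_Mapping.keys m. x t v ^ Poly_Mapping.lookup m v)"
    unfolding m[symmetric] by (intro polyfun_prod polyfun_power assms)
qed


section \<open>Homogeneous functions on the space of forms\<close>

text \<open>The coordinate ring behind the Zariski topology has infinitely many variables, most of which vanish on the forms
  of a given degree. Polynomials are therefore replaced by the functions that they define.\<close>

definition hom_fun :: "nat \<Rightarrow> (3 form \<Rightarrow> complex) \<Rightarrow> bool" where
  "hom_fun M u \<longleftrightarrow> (\<exists>p. homogeneous M p \<and> u = (\<lambda>\<omega>. eval_poly (form_coord \<omega>) p))"

lemma hom_fun_mult: "hom_fun M u \<Longrightarrow> hom_fun N v \<Longrightarrow> hom_fun (M + N) (\<lambda>\<omega>. u \<omega> * v \<omega>)"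
  unfolding hom_fun_def
proof (elim exE conjE)
  fix p q assume "homogeneous M p" "u = (\<lambda>\<omega>. eval_poly (form_coord \<omega>) p)"
    "homogeneous N q" "v = (\<lambda>\<omega>. eval_poly (form_coord \<omega>) q)"
  then show "\<exists>p. homogeneous (M + N) p \<and> (\<lambda>\<omega>. u \<omega> * v \<omega>) = (\<lambda>\<omega>. eval_poly (form_coord \<omega>) p)"
    by (intro exI[of _ "p * q"]) (simp add: homogeneous_mult eval_mult)
qed

lemma hom_fun_add: "hom_fun M u \<Longrightarrow> hom_fun M v \<Longrightarrow> hom_fun M (\<lambda>\<omega>. u \<omega> + v \<omega>)"
  unfolding hom_fun_def
proof (elim exE conjE)
  fix p q assume "homogeneous M p" "u = (\<lambda>\<omega>. eval_poly (form_coord \<omega>) p)"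
    "homogeneous M q" "v = (\<lambda>\<omega>. eval_poly (form_coord \<omega>) q)"
  then show "\<exists>p. homogeneous M p \<and> (\<lambda>\<omega>. u \<omega> + v \<omega>) = (\<lambda>\<omega>. eval_poly (form_coord \<omega>) p)"
    by (intro exI[of _ "p + q"]) (simp add: homogeneous_add eval_add)
qed

lemma hom_fun_0: "hom_fun M (\<lambda>\<omega>. 0)"
  unfolding hom_fun_def by (intro exI[of _ 0]) simp

lemma hom_fun_const: "hom_fun 0 (\<lambda>\<omega>. c)"
  unfolding hom_fun_def by (intro exI[of _ "Const c"]) (simp add: homogeneous_Const)

lemma hom_fun_coord: "hom_fun 1 (\<lambda>\<omega>. form_coord \<omega> v)"
  unfolding hom_fun_def by (intro exI[of _ "Var v"]) (use homogeneous_Var in simp)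

lemma hom_fun_cmult: "hom_fun M u \<Longrightarrow> hom_fun M (\<lambda>\<omega>. c * u \<omega>)"
  using hom_fun_mult[OF hom_fun_const, of M u c] by simp

lemma hom_fun_sum: "(\<And>a. a \<in> A \<Longrightarrow> hom_fun M (u a)) \<Longrightarrow> hom_fun M (\<lambda>\<omega>. \<Sum>a\<in>A. u a \<omega>)"
  by (induction A rule: infinite_finite_induct) (auto intro: hom_fun_add hom_fun_0)

lemma hom_fun_power: "hom_fun M u \<Longrightarrow> hom_fun (n * M) (\<lambda>\<omega>. u \<omega> ^ n)"
  by (induction n) (auto intro: hom_fun_mult hom_fun_const)

lemma hom_fun_prod:
  "(\<And>a. a \<in> A \<Longrightarrow> hom_fun (M a) (u a)) \<Longrightarrow> hom_fun (\<Sum>a\<in>A. M a) (\<lambda>\<omega>. \<Prod>a\<in>A. u a \<omega>)"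
  by (induction A rule: infinite_finite_induct) (auto intro: hom_fun_mult hom_fun_const)

lemma hom_fun_scale: "hom_fun M u \<Longrightarrow> u (Const k *s \<omega>) = k ^ M * u \<omega>"
  unfolding hom_fun_def by (auto simp: form_coord_scale eval_homogeneous_scale)

lemma polyfun_hom_fun:
  assumes "\<And>v. polyfun I D (\<lambda>t. form_coord (\<psi> t) v)" "hom_fun M u"
  shows "polyfun I (M * D) (\<lambda>t. u (\<psi> t))"
  using assms(2) polyfun_eval[of I D "\<lambda>t. form_coord (\<psi> t)", OF assms(1)] unfolding hom_fun_def by blast

definition vanishes_on :: "(3 form \<Rightarrow> complex) \<Rightarrow> 3 form set set \<Rightarrow> bool" where
  "vanishes_on u Z \<longleftrightarrow> (\<forall>\<omega>. proj_point \<omega> \<in> Z \<longrightarrow> u \<omega> = 0)"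

lemma vanishes_on_subset: "vanishes_on u Z \<Longrightarrow> Y \<subseteq> Z \<Longrightarrow> vanishes_on u Y"
  by (auto simp: vanishes_on_def)

text \<open>The homogeneous coordinate ring of an irreducible set has no zero divisors.\<close>

lemma irreducible_vanishes_on:
  assumes Z: "Z \<subseteq> proj_forms d" "irreducible_space (subtopology (zariski d) Z)"
    and u: "hom_fun M u" and v: "hom_fun N v" and uv: "vanishes_on (\<lambda>\<omega>. u \<omega> * v \<omega>) Z"
  shows "vanishes_on u Z \<or> vanishes_on v Z"
proof -
  obtain p q where p: "homogeneous M p" "u = (\<lambda>\<omega>. eval_poly (form_coord \<omega>) p)"
    and q: "homogeneous N q" "v = (\<lambda>\<omega>. eval_poly (form_coord \<omega>) q)"
    using u v by (auto simp: hom_fun_def)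
  have top: "topspace (subtopology (zariski d) Z) = Z"
    using Z by (auto simp: topspace_subtopology topspace_zariski)
  let ?C = "\<lambda>p. Z \<inter> proj_zeros d {p}"
  have cl: "closedin (subtopology (zariski d) Z) (?C r)" if "homogeneous n r" for n r
  proof -
    have "closedin (zariski d) (proj_zeros d {r})"
      unfolding closedin_zariski using that by (intro exI[of _ "{r}"]) auto
    then show ?thesis by (auto simp: closedin_subtopology)
  qed
  have pz: "proj_point \<omega> \<in> proj_zeros d {r} \<longleftrightarrow> eval_poly (form_coord \<omega>) r = 0"
    if "homogeneous n r" "proj_point \<omega> \<in> Z" for n r \<omega>
    using mem_proj_zeros_iff[of "{r}" \<omega> d] that Z by auto
  have rep: "\<exists>\<omega>. P = proj_point \<omega>" if "P \<in> Z" for P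
    using that Z by (auto simp: proj_forms_def)
  have eq: "Z = ?C r \<longleftrightarrow> vanishes_on (\<lambda>\<omega>. eval_poly (form_coord \<omega>) r) Z" if "homogeneous n r" for n r
    using pz[OF that] rep unfolding vanishes_on_def by blast
  have "Z \<subseteq> ?C p \<union> ?C q"
  proof
    fix P assume P: "P \<in> Z"
    then obtain \<omega> where \<omega>: "P = proj_point \<omega>" using Z by (auto simp: proj_forms_def)
    have "proj_point \<omega> \<in> proj_zeros d {p} \<or> proj_point \<omega> \<in> proj_zeros d {q}"
      using uv P Z \<omega> p q mem_proj_zeros_iff[of "{p}" \<omega> d] mem_proj_zeros_iff[of "{q}" \<omega> d]
      by (auto simp: vanishes_on_def)
    then show "P \<in> ?C p \<union> ?C q" using P \<omega> by blast
  qed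
  then have "Z = ?C p \<union> ?C q" by blast
  then have "?C p = Z \<or> ?C q = Z"
    using Z(2) cl[OF p(1)] cl[OF q(1)] unfolding irreducible_space_def top by blast
  then show ?thesis using eq[OF p(1)] eq[OF q(1)] p q by metis
qed

lemma closedin_zariski_sub:
  assumes "V \<subseteq> proj_forms d"
  shows "closedin (subtopology (zariski d) V) Z \<longleftrightarrow>
     (\<exists>S. (\<forall>p\<in>S. \<exists>n. homogeneous n p) \<and> Z = V \<inter> proj_zeros d S)"
  by (auto simp: closedin_subtopology closedin_zariski)

lemma proj_zeros_vanishes_on:
  assumes "p \<in> S"
  shows "vanishes_on (\<lambda>\<omega>. eval_poly (form_coord \<omega>) p) (proj_zeros d S)"
proof -
  have "\<omega> \<in> proj_point \<omega>" for \<omega>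
    unfolding proj_point_def by (rule CollectI, rule exI[of _ 1]) (simp add: Const_1)
  then show ?thesis using assms by (auto simp: vanishes_on_def proj_zeros_def)
qed

text \<open>This yields the functions that cut out the successive members of a chain of closed sets.\<close>

lemma closed_psubset_separated:
  assumes V: "V \<subseteq> proj_forms d" and Y: "closedin (subtopology (zariski d) V) Y"
    and Z: "Z \<subseteq> V" "\<not> Z \<subseteq> Y"
  shows "\<exists>M u. hom_fun M u \<and> vanishes_on u Y \<and> \<not> vanishes_on u Z"
proof -
  obtain S where S: "\<forall>p\<in>S. \<exists>n. homogeneous n p" "Y = V \<inter> proj_zeros d S"
    using Y by (auto simp: closedin_zariski_sub[OF V])
  obtain P where P: "P \<in> Z" "P \<notin> proj_zeros d S" using S Z by blast
  then obtain \<omega> where \<omega>: "P = proj_point \<omega>" using Z V by (auto simp: proj_forms_def)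
  then obtain p where p: "p \<in> S" "eval_poly (form_coord \<omega>) p \<noteq> 0"
    using P Z V mem_proj_zeros_iff[OF S(1), of \<omega> d] by auto
  then obtain n where "homogeneous n p" using S by blast
  moreover have "vanishes_on (\<lambda>\<omega>. eval_poly (form_coord \<omega>) p) Y"
    using proj_zeros_vanishes_on[OF p(1)] vanishes_on_subset S(2) by blast
  moreover have "\<not> vanishes_on (\<lambda>\<omega>. eval_poly (form_coord \<omega>) p) Z"
    using p P \<omega> by (auto simp: vanishes_on_def)
  ultimately show ?thesis by (auto simp: hom_fun_def)
qed


section \<open>An upper bound for the Krull dimension\<close>

text \<open>Exponents of monomials in \<open>f 1, \<dots>, f n\<close> are homogenised with powers of \<open>f 0\<close>, which has
  degree one.\<close>

definition box_monomial :: "nat \<Rightarrow> nat \<Rightarrow> (nat \<Rightarrow> nat) \<Rightarrow> (nat \<Rightarrow> 3 form \<Rightarrow> complex) \<Rightarrow> (nat \<Rightarrow> nat) \<Rightarrow> 3 form \<Rightarrow> complex" where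
  "box_monomial n M e f \<alpha> \<omega> = f 0 \<omega> ^ (M - (\<Sum>i\<in>{1..n}. \<alpha> i * e i)) * (\<Prod>i\<in>{1..n}. f i \<omega> ^ \<alpha> i)"

lemma hom_fun_box_monomial:
  assumes "hom_fun 1 (f 0)" "\<And>i. i \<in> {1..n} \<Longrightarrow> hom_fun (e i) (f i)"
    "\<alpha> \<in> PiE {1..n} (\<lambda>_. {..<N})" "N * (\<Sum>i\<in>{1..n}. e i) \<le> M"
  shows "hom_fun M (box_monomial n M e f \<alpha>)"
proof -
  have "(\<Sum>i\<in>{1..n}. \<alpha> i * e i) \<le> (\<Sum>i\<in>{1..n}. N * e i)"
    using assms(3) by (intro sum_mono mult_right_mono) (force simp: PiE_iff)+
  then have le: "(\<Sum>i\<in>{1..n}. \<alpha> i * e i) \<le> M"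
    using assms(4) by (simp add: sum_distrib_left)
  have "hom_fun ((M - (\<Sum>i\<in>{1..n}. \<alpha> i * e i)) * 1 + (\<Sum>i\<in>{1..n}. \<alpha> i * e i)) (box_monomial n M e f \<alpha>)"
    unfolding box_monomial_def by (intro hom_fun_mult hom_fun_power hom_fun_prod assms)
  then show ?thesis using le by simp
qed

text \<open>Functions that cut out, one after the other, the members of a strictly increasing chain of
  irreducible sets are algebraically independent: restricting a relation on the last set \<open>Z n\<close> to the
  zero locus of \<open>f n\<close>, which contains \<open>Z (n - 1)\<close>, kills the terms without \<open>f n\<close> by induction, and
  then \<open>f n\<close> can be cancelled.\<close>

lemma chain_independent:
  assumes Z: "\<And>i. i \<le> n \<Longrightarrow> Z i \<subseteq> proj_forms d \<and> irreducible_space (subtopology (zariski d) (Z i))"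
    and sub: "\<And>i. i < n \<Longrightarrow> Z i \<subseteq> Z (Suc i)"
    and f0: "hom_fun 1 (f 0)" "\<not> vanishes_on (f 0) (Z 0)"
    and f: "\<And>i. i < n \<Longrightarrow> hom_fun (e (Suc i)) (f (Suc i)) \<and> vanishes_on (f (Suc i)) (Z i) \<and>
       \<not> vanishes_on (f (Suc i)) (Z (Suc i))"
    and M: "N * (\<Sum>i\<in>{1..n}. e i) \<le> M"
    and rel: "vanishes_on (\<lambda>\<omega>. \<Sum>\<alpha>\<in>PiE {1..n} (\<lambda>_. {..<N}). c \<alpha> * box_monomial n M e f \<alpha> \<omega>) (Z n)"
    and \<alpha>: "\<alpha> \<in> PiE {1..n} (\<lambda>_. {..<N})"
  shows "c \<alpha> = 0"
  using assms
proof (induction n arbitrary: M c \<alpha>)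
  case 0
  obtain \<omega> where "proj_point \<omega> \<in> Z 0" "f 0 \<omega> \<noteq> 0" using 0 by (auto simp: vanishes_on_def)
  then show ?case using 0 by (auto simp: vanishes_on_def box_monomial_def)
next
  case (Suc n)
  let ?B = "PiE {1..n} (\<lambda>_. {..<N})"
  let ?f = "f (Suc n)" and ?e = "e (Suc n)"
  let ?g = "\<lambda>k \<omega>. \<Sum>\<beta>\<in>?B. c (\<beta>(Suc n := k)) * box_monomial n (M - k * ?e) e f \<beta> \<omega>"
  have hf: "hom_fun ?e ?f" using Suc.prems(5) by blast
  have Mk: "N * (\<Sum>i\<in>{1..n}. e i) \<le> M - k * ?e \<and> k * ?e \<le> M" if "k < N" for k
  proof -
    have "k * ?e \<le> N * ?e" using that by simp
    moreover have "N * (\<Sum>i\<in>{1..n}. e i) + N * ?e \<le> M"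
      using Suc.prems(6) by (simp add: distrib_left)
    ultimately show ?thesis by linarith
  qed
  have hg: "hom_fun (M - k * ?e) (?g k)" if "k < N" for k
    using Mk[OF that] Suc.prems(3,5)
    by (intro hom_fun_sum hom_fun_cmult hom_fun_box_monomial[where N = N])
      (auto simp: Suc_le_eq dest!: gr0_implies_Suc)
  have split: "(\<Sum>\<alpha>\<in>PiE {1..Suc n} (\<lambda>_. {..<N}). c \<alpha> * box_monomial (Suc n) M e f \<alpha> \<omega>) =
      (\<Sum>k<N. ?f \<omega> ^ k * ?g k \<omega>)" for \<omega>
  proof -
    have "box_monomial (Suc n) M e f (\<beta>(Suc n := k)) \<omega> = ?f \<omega> ^ k * box_monomial n (M - k * ?e) e f \<beta> \<omega>" for \<beta> k
      by (simp add: box_monomial_def atLeastAtMostSuc_conv mult_ac diff_diff_add add.commute)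
    then show ?thesis
      using sum_PiE_insert[of "Suc n" "{1..n}" "\<lambda>\<alpha>. c \<alpha> * box_monomial (Suc n) M e f \<alpha> \<omega>" "{..<N}"]
      by (simp add: atLeastAtMostSuc_conv sum_distrib_left mult_ac)
  qed
  have zero: "\<forall>\<beta>\<in>?B. c (\<beta>(Suc n := k)) = 0" if "k < N" for k
    using that
  proof (induction k rule: less_induct)
    case (less k)
    let ?h = "\<lambda>\<omega>. \<Sum>j\<in>{k..<N}. ?f \<omega> ^ (j - k) * ?g j \<omega>"
    have "?f \<omega> ^ k * ?h \<omega> = (\<Sum>j<N. ?f \<omega> ^ j * ?g j \<omega>)" for \<omega>
    proof -
      have "(\<Sum>j<N. ?f \<omega> ^ j * ?g j \<omega>) = (\<Sum>j\<in>{k..<N}. ?f \<omega> ^ j * ?g j \<omega>)"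
      proof (rule sum.mono_neutral_right)
        show "\<forall>i\<in>{..<N} - {k..<N}. ?f \<omega> ^ i * ?g i \<omega> = 0"
        proof
          fix i assume i: "i \<in> {..<N} - {k..<N}"
          have "\<forall>\<beta>\<in>?B. c (\<beta>(Suc n := i)) = 0"
            by (rule less.IH) (use i in auto)
          then have "?g i \<omega> = 0"
            by (intro sum.neutral) simp
          then show "?f \<omega> ^ i * ?g i \<omega> = 0" by simp
        qed
      qed auto
      also have "\<dots> = (\<Sum>j\<in>{k..<N}. ?f \<omega> ^ k * (?f \<omega> ^ (j - k) * ?g j \<omega>))"
        by (rule sum.cong) (simp_all add: mult.assoc[symmetric] flip: power_add)
      finally show ?thesis by (simp add: sum_distrib_left)
    qed
    then have prod0: "vanishes_on (\<lambda>\<omega>. ?f \<omega> ^ k * ?h \<omega>) (Z (Suc n))"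
      using Suc.prems(7) by (simp only: split)
    have "hom_fun (M - k * ?e) ?h"
    proof (intro hom_fun_sum)
      fix j assume j: "j \<in> {k..<N}"
      have "hom_fun ((j - k) * ?e + (M - j * ?e)) (\<lambda>\<omega>. ?f \<omega> ^ (j - k) * ?g j \<omega>)"
        using j by (intro hom_fun_mult hom_fun_power hf hg) auto
      moreover have "(j - k) * ?e + (M - j * ?e) = M - k * ?e"
      proof -
        have "k * ?e \<le> j * ?e" using j by simp
        then show ?thesis using Mk[of j] j by (simp add: diff_mult_distrib)
      qed
      ultimately show "hom_fun (M - k * ?e) (\<lambda>\<omega>. ?f \<omega> ^ (j - k) * ?g j \<omega>)" by simp
    qed
    then have "vanishes_on (\<lambda>\<omega>. ?f \<omega> ^ k) (Z (Suc n)) \<or> vanishes_on ?h (Z (Suc n))"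
      using Suc.prems(1)[of "Suc n"] prod0 hom_fun_power[OF hf] by (intro irreducible_vanishes_on) auto
    then have "vanishes_on ?h (Z (Suc n))"
      using Suc.prems(5)[of n] by (auto simp: vanishes_on_def)
    then have h0: "vanishes_on ?h (Z n)"
      using Suc.prems(2)[of n] vanishes_on_subset by blast
    have "?h \<omega> = ?g k \<omega>" if "?f \<omega> = 0" for \<omega>
    proof -
      have "?h \<omega> = (\<Sum>j\<in>{k}. ?f \<omega> ^ (j - k) * ?g j \<omega>)"
        by (rule sum.mono_neutral_right) (use that less.prems in \<open>auto simp: power_0_left\<close>)
      then show ?thesis by simp
    qed
    then have g0: "vanishes_on (?g k) (Z n)"
      using h0 Suc.prems(5)[of n] by (auto simp: vanishes_on_def)
    show ?case
    proof
      fix \<beta> assume \<beta>: "\<beta> \<in> ?B"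
      show "c (\<beta>(Suc n := k)) = 0"
      proof (rule Suc.IH[of "M - k * ?e" "\<lambda>\<beta>. c (\<beta>(Suc n := k))" \<beta>])
        show "Z i \<subseteq> proj_forms d \<and> irreducible_space (subtopology (zariski d) (Z i))" if "i \<le> n" for i
          using Suc.prems(1) that le_SucI by blast
        show "Z i \<subseteq> Z (Suc i)" if "i < n" for i
          using Suc.prems(2) that less_SucI by blast
        show "hom_fun (e (Suc i)) (f (Suc i)) \<and> vanishes_on (f (Suc i)) (Z i) \<and>
            \<not> vanishes_on (f (Suc i)) (Z (Suc i))" if "i < n" for i
          using Suc.prems(5) that less_SucI by blast
        show "N * (\<Sum>i\<in>{1..n}. e i) \<le> M - k * ?e" using Mk[OF less.prems] by blast
      qed (fact Suc.prems(3) Suc.prems(4) g0 \<beta>)+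
    qed
  qed
  obtain k \<beta> where "k < N" "\<beta> \<in> ?B" "\<alpha> = \<beta>(Suc n := k)"
    using Suc.prems(8) by (auto simp: PiE_insert_eq atLeastAtMostSuc_conv)
  then show ?case using zero by blast
qed

text \<open>The \<open>N ^ n\<close> monomials in \<open>n\<close> functions have degree proportional to \<open>N\<close>; polynomials of such degree in \<open>k\<close>
  parameters only span a space of dimension \<open>O(N ^ k)\<close>.\<close>

lemma box_count:
  fixes D E n k :: nat
  assumes "k < n"
  shows "\<exists>N. (D * (N * E) + 1) ^ k < N ^ n"
proof -
  let ?N = "(D * E + 1) ^ k + 1"
  have "(D * (?N * E) + 1) ^ k \<le> (?N * (D * E + 1)) ^ k"
    by (intro power_mono) (simp_all add: algebra_simps)
  also have "\<dots> = ?N ^ k * (D * E + 1) ^ k" by (rule power_mult_distrib)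
  also have "\<dots> < ?N ^ k * ?N" by simp
  also have "\<dots> = ?N ^ Suc k" by simp
  also have "\<dots> \<le> ?N ^ n" using assms by (intro power_increasing) auto
  finally show ?thesis by blast
qed

text \<open>A chain of length \<open>n\<close> provides \<open>N ^ n\<close> independent monomials of degree proportional to \<open>N\<close>. Their pullbacks
  along a dominating map \<open>\<psi>\<close> from a \<open>k\<close>-dimensional affine space are still independent.\<close>

lemma krull_dim_le:
  assumes V: "V \<subseteq> proj_forms d" and I: "finite I" "card I = k"
    and \<psi>: "\<And>v. polyfun I D (\<lambda>t. form_coord (\<psi> t) v)"
    and dom: "\<And>M u. hom_fun M u \<Longrightarrow> (\<And>t. u (\<psi> t) = 0) \<Longrightarrow> vanishes_on u V"
  shows "krull_dim (subtopology (zariski d) V) \<le> enat k"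
  unfolding krull_dim_def
proof (rule Sup_least, clarify)
  fix n and Z :: "nat \<Rightarrow> 3 form set set"
  assume Z: "\<forall>i\<le>n. closedin (subtopology (zariski d) V) (Z i) \<and>
      irreducible_space (subtopology (subtopology (zariski d) V) (Z i))"
    and chain: "\<forall>i<n. Z i \<subset> Z (Suc i)"
  have ZO: "Z i \<subseteq> V" if "i \<le> n" for i
    using Z that closedin_subset by fastforce
  have irr: "Z i \<subseteq> proj_forms d \<and> irreducible_space (subtopology (zariski d) (Z i))" if "i \<le> n" for i
  proof -
    have "V \<inter> Z i = Z i" using ZO[OF that] by blast
    then show ?thesis using Z[rule_format, OF that] ZO[OF that] V by (simp add: subtopology_subtopology)
  qed
  have "\<forall>i\<in>{..<n}. \<exists>Mu. hom_fun (fst Mu) (snd Mu) \<and> vanishes_on (snd Mu) (Z i) \<and> \<not> vanishes_on (snd Mu) (Z (Suc i))"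
  proof
    fix i assume "i \<in> {..<n}"
    then show "\<exists>Mu. hom_fun (fst Mu) (snd Mu) \<and> vanishes_on (snd Mu) (Z i) \<and> \<not> vanishes_on (snd Mu) (Z (Suc i))"
      using closed_psubset_separated[OF V, of "Z i" "Z (Suc i)"] Z ZO[of "Suc i"] chain by fastforce
  qed
  then obtain Mu where Mu: "\<And>i. i < n \<Longrightarrow> hom_fun (fst (Mu i)) (snd (Mu i)) \<and>
      vanishes_on (snd (Mu i)) (Z i) \<and> \<not> vanishes_on (snd (Mu i)) (Z (Suc i))"
    using bchoice[of "{..<n}"] by (metis (no_types, lifting) lessThan_iff)
  obtain P where P: "P \<in> Z 0"
    using irr[of 0] unfolding irreducible_space_def by (auto simp: topspace_subtopology)
  then obtain \<omega> where \<omega>: "P = proj_point \<omega>" "\<omega> \<noteq> 0"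
    using irr[of 0] by (auto simp: proj_forms_def)
  then obtain v where v: "form_coord \<omega> v \<noteq> 0"
  proof -
    from \<omega>(2) obtain i m where "Poly_Mapping.lookup (\<omega> $ i) m \<noteq> 0"
      by (metis lookup_zero poly_mapping_eqI vec_eq_iff zero_index)
    then show ?thesis using that[of "(i, m)"] by (simp add: form_coord_def)
  qed
  define f where "f i = (if i = 0 then (\<lambda>\<omega>. form_coord \<omega> v) else snd (Mu (i - 1)))" for i :: nat
  define e where "e i = fst (Mu (i - 1))" for i :: nat
  let ?E = "\<Sum>i\<in>{1..n}. e i"
  show "enat n \<le> enat k"
  proof (rule ccontr)
    assume "\<not> enat n \<le> enat k"
    then obtain N where N: "(D * (N * ?E) + 1) ^ k < N ^ n" using box_count[of k n D ?E] by auto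
    let ?A = "PiE {1..n} (\<lambda>_. {..<N})" and ?M = "N * ?E"
    have hf: "hom_fun 1 (f 0)" "\<And>i. i \<in> {1..n} \<Longrightarrow> hom_fun (e i) (f i)"
    proof -
      show "hom_fun 1 (f 0)" unfolding f_def by (simp only: simp_thms if_True hom_fun_coord)
      show "hom_fun (e i) (f i)" if "i \<in> {1..n}" for i
      proof -
        have "i - 1 < n" using that by auto
        then show ?thesis using Mu[of "i - 1"] that by (simp add: f_def e_def)
      qed
    qed
    then have hb: "hom_fun ?M (box_monomial n ?M e f \<alpha>)" if "\<alpha> \<in> ?A" for \<alpha>
      using that by (intro hom_fun_box_monomial[where N = N]) auto
    have "\<exists>c. (\<exists>\<alpha>\<in>?A. c \<alpha> \<noteq> 0) \<and> (\<forall>t. (\<Sum>\<alpha>\<in>?A. c \<alpha> * box_monomial n ?M e f \<alpha> (\<psi> t)) = 0)"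
    proof (rule polyfun_relation[OF I(1)])
      show "(?M * D + 1) ^ card I < card ?A" using N I by (simp add: card_PiE mult_ac)
      show "polyfun I (?M * D) (\<lambda>t. box_monomial n ?M e f \<alpha> (\<psi> t))" if "\<alpha> \<in> ?A" for \<alpha>
        using hb[OF that] by (rule polyfun_hom_fun[OF \<psi>])
    qed (auto simp: finite_PiE)
    then obtain c \<alpha> where c: "\<alpha> \<in> ?A" "c \<alpha> \<noteq> 0" "\<And>t. (\<Sum>\<alpha>\<in>?A. c \<alpha> * box_monomial n ?M e f \<alpha> (\<psi> t)) = 0"
      by blast
    have "vanishes_on (\<lambda>\<omega>. \<Sum>\<alpha>\<in>?A. c \<alpha> * box_monomial n ?M e f \<alpha> \<omega>) V"
      using c(3) hb by (intro dom[of ?M] hom_fun_sum hom_fun_cmult)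
    then have "vanishes_on (\<lambda>\<omega>. \<Sum>\<alpha>\<in>?A. c \<alpha> * box_monomial n ?M e f \<alpha> \<omega>) (Z n)"
      using ZO[of n] vanishes_on_subset by blast
    then have rel: "vanishes_on (\<lambda>\<omega>. \<Sum>\<alpha>\<in>?A. c \<alpha> * box_monomial n ?M e f \<alpha> \<omega>) (Z n)" .
    have "c \<alpha> = 0"
    proof (rule chain_independent[of n Z d f e N ?M c \<alpha>])
      show "Z i \<subseteq> proj_forms d \<and> irreducible_space (subtopology (zariski d) (Z i))" if "i \<le> n" for i
        using irr that by blast
      show "Z i \<subseteq> Z (Suc i)" if "i < n" for i
        using chain that by blast
      show "\<not> vanishes_on (f 0) (Z 0)"
        using v P \<omega>(1) unfolding vanishes_on_def f_def by auto
      show "hom_fun (e (Suc i)) (f (Suc i)) \<and> vanishes_on (f (Suc i)) (Z i) \<and>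
          \<not> vanishes_on (f (Suc i)) (Z (Suc i))" if "i < n" for i
        using Mu[OF that] unfolding f_def e_def by simp
    qed (fact hf(1) order_refl rel c(1))+
    then show False using c(2) by simp
  qed
qed

section \<open>A lower bound for the Krull dimension of orbits\<close>

text \<open>A first order expansion at \<open>s = 0\<close>, coefficient by coefficient. The uniformly finite support reduces the product
  rule to that for finite sums of products.\<close>

definition poly_deriv :: "(complex \<Rightarrow> 'v cpoly) \<Rightarrow> 'v cpoly \<Rightarrow> 'v cpoly \<Rightarrow> bool" where
  "poly_deriv P p q \<longleftrightarrow> (\<exists>A. finite A \<and> (\<forall>s. Poly_Mapping.keys (P s) \<subseteq> A)) \<and> P 0 = p \<and>
     (\<forall>m. ((\<lambda>s. Poly_Mapping.lookup (P s) m) has_field_derivative Poly_Mapping.lookup q m) (at 0))"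

lemma poly_deriv_const: "poly_deriv (\<lambda>s. p) p 0"
  unfolding poly_deriv_def by (intro conjI exI[of _ "Poly_Mapping.keys p"]) auto

lemma poly_deriv_add:
  assumes "poly_deriv P p p'" "poly_deriv Q q q'"
  shows "poly_deriv (\<lambda>s. P s + Q s) (p + q) (p' + q')"
proof -
  obtain A B where "finite A" "\<forall>s. Poly_Mapping.keys (P s) \<subseteq> A" "finite B" "\<forall>s. Poly_Mapping.keys (Q s) \<subseteq> B"
    using assms by (auto simp: poly_deriv_def)
  then have "finite (A \<union> B) \<and> (\<forall>s. Poly_Mapping.keys (P s + Q s) \<subseteq> A \<union> B)"
    using Poly_Mapping.keys_add by (metis finite_UnI order_trans Un_mono)
  then show ?thesis
    using assms unfolding poly_deriv_def by (auto simp: lookup_add intro!: DERIV_add)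
qed

lemma poly_deriv_mult:
  assumes "poly_deriv P p p'" "poly_deriv Q q q'"
  shows "poly_deriv (\<lambda>s. P s * Q s) (p * q) (p' * q + p * q')"
proof -
  have keys: "Poly_Mapping.keys p' \<subseteq> A"
    if "poly_deriv P p p'" "\<forall>s. Poly_Mapping.keys (P s) \<subseteq> A" for P p p' and A :: "('a \<Rightarrow>\<^sub>0 nat) set"
  proof
    fix m assume m: "m \<in> Poly_Mapping.keys p'"
    show "m \<in> A"
    proof (rule ccontr)
      assume "m \<notin> A"
      then have "m \<notin> Poly_Mapping.keys (P s)" for s using that(2) by blast
      then have eq: "(\<lambda>s. Poly_Mapping.lookup (P s) m) = (\<lambda>s. 0)"
        by (simp add: in_keys_iff)
      have "((\<lambda>s. Poly_Mapping.lookup (P s) m) has_field_derivative Poly_Mapping.lookup p' m) (at 0)"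
        using that(1) by (simp add: poly_deriv_def)
      then have "((\<lambda>s. 0) has_field_derivative Poly_Mapping.lookup p' m) (at 0)"
        by (simp only: eq)
      then have "Poly_Mapping.lookup p' m = 0" using DERIV_unique[OF _ DERIV_const] by blast
      then show False using m by (simp add: in_keys_iff)
    qed
  qed
  obtain A where A: "finite A" "\<forall>s. Poly_Mapping.keys (P s) \<subseteq> A"
    using assms(1) by (auto simp: poly_deriv_def)
  obtain B where B: "finite B" "\<forall>s. Poly_Mapping.keys (Q s) \<subseteq> B"
    using assms(2) by (auto simp: poly_deriv_def)
  have p: "Poly_Mapping.keys p \<subseteq> A" and p': "Poly_Mapping.keys p' \<subseteq> A"
    and q: "Poly_Mapping.keys q \<subseteq> B" and q': "Poly_Mapping.keys q' \<subseteq> B"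
    and P0: "P 0 = p" "Q 0 = q"
    using assms A(2) B(2) keys[OF assms(1) A(2)] keys[OF assms(2) B(2)] by (auto simp: poly_deriv_def)
  let ?l = "Poly_Mapping.lookup"
  have "((\<lambda>s. ?l (P s * Q s) m) has_field_derivative ?l (p' * q + p * q') m) (at 0)" for m
  proof -
    have "((\<lambda>s. \<Sum>a\<in>A. \<Sum>b\<in>B. if a + b = m then ?l (P s) a * ?l (Q s) b else 0) has_field_derivative
        (\<Sum>a\<in>A. \<Sum>b\<in>B. if a + b = m then ?l p' a * ?l q b + ?l q' b * ?l p a else 0)) (at 0)"
    proof (intro DERIV_sum)
      fix a b
      have "((\<lambda>s. ?l (P s) a * ?l (Q s) b) has_field_derivative (?l p' a * ?l (Q 0) b + ?l q' b * ?l (P 0) a)) (at 0)"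
        using assms by (intro DERIV_mult) (auto simp: poly_deriv_def)
      then show "((\<lambda>s. if a + b = m then ?l (P s) a * ?l (Q s) b else 0) has_field_derivative
          (if a + b = m then ?l p' a * ?l q b + ?l q' b * ?l p a else 0)) (at 0)"
        by (simp add: P0)
    qed
    also have "(\<lambda>s. \<Sum>a\<in>A. \<Sum>b\<in>B. if a + b = m then ?l (P s) a * ?l (Q s) b else 0) = (\<lambda>s. ?l (P s * Q s) m)"
      using A B by (intro ext lookup_mult_superset[symmetric]) auto
    also have "(\<Sum>a\<in>A. \<Sum>b\<in>B. if a + b = m then ?l p' a * ?l q b + ?l q' b * ?l p a else 0) = ?l (p' * q + p * q') m"
      unfolding lookup_add lookup_mult_superset[OF A(1) p' B(1) q] lookup_mult_superset[OF A(1) p B(1) q']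
        sum.distrib[symmetric] by (intro sum.cong refl) (simp add: mult.commute)
    finally show ?thesis .
  qed
  moreover have "finite ((\<lambda>(a, b). a + b) ` (A \<times> B)) \<and> (\<forall>s. Poly_Mapping.keys (P s * Q s) \<subseteq> (\<lambda>(a, b). a + b) ` (A \<times> B))"
  proof (intro conjI allI)
    show "Poly_Mapping.keys (P s * Q s) \<subseteq> (\<lambda>(a, b). a + b) ` (A \<times> B)" for s
      using keys_mult[of "P s" "Q s"] A(2)[rule_format, of s] B(2)[rule_format, of s] by fastforce
  qed (use A B in simp)
  ultimately show ?thesis
    unfolding poly_deriv_def using P0 by blast
qed

lemma poly_deriv_sum:
  "(\<And>a. a \<in> A \<Longrightarrow> poly_deriv (P a) (p a) (q a)) \<Longrightarrow>
     poly_deriv (\<lambda>s. \<Sum>a\<in>A. P a s) (\<Sum>a\<in>A. p a) (\<Sum>a\<in>A. q a)"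
  by (induction A rule: infinite_finite_induct) (auto intro: poly_deriv_add poly_deriv_const)

lemma poly_deriv_Const: "poly_deriv (\<lambda>s. Const (a + s * b)) (Const a) (Const b)"
proof -
  have "((\<lambda>s. if m = 0 then a + s * b else 0) has_field_derivative (if m = 0 then b else 0)) (at 0)" for m :: "'a \<Rightarrow>\<^sub>0 nat"
    by (cases "m = 0") (auto intro!: derivative_eq_intros)
  then show ?thesis
    unfolding poly_deriv_def lookup_Const by (intro conjI exI[of _ "{0}"]) (auto simp: Const_def split: if_splits)
qed

lemma poly_deriv_subst:
  "poly_deriv (\<lambda>s. subst_poly (row_form (mat 1 + smul s X)) p) p (der X p)"
proof (induction p rule: cpoly_generators_induct)
  case (Const c)
  then show ?case by (simp add: poly_deriv_const)
next
  case (Var v)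
  have "poly_deriv (\<lambda>s. Const (mat 1 $ v $ n + s * X $ v $ n) * Var n)
      (Const (mat 1 $ v $ n) * Var n) (Const (X $ v $ n) * Var n)" for n
    using poly_deriv_mult[OF poly_deriv_Const poly_deriv_const] by fastforce
  then have "poly_deriv (\<lambda>s. row_form (mat 1 + smul s X) v) (row_form (mat 1) v) (row_form X v)"
    unfolding row_form_def by (intro poly_deriv_sum) simp
  then show ?case by (simp add: row_form_mat Const_1)
qed (auto simp: subst_simps der_add der_mult intro: poly_deriv_add poly_deriv_mult)

text \<open>The derivative of the orbit map at the identity.\<close>

lemma form_coord_deriv:
  "((\<lambda>s. form_coord (pullback (mat 1 + smul s X) \<omega>) v) has_field_derivative form_coord (lie X \<omega>) v) (at 0)"
proof (cases v)
  case (Pair j m)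
  have "poly_deriv (\<lambda>s. Const (mat 1 $ i $ j + s * X $ i $ j) * subst_poly (row_form (mat 1 + smul s X)) (\<omega> $ i))
     (Const (mat 1 $ i $ j) * \<omega> $ i) (Const (X $ i $ j) * \<omega> $ i + Const (mat 1 $ i $ j) * der X (\<omega> $ i))" for i
    using poly_deriv_mult[OF poly_deriv_Const poly_deriv_subst] .
  then have "poly_deriv (\<lambda>s. pullback (mat 1 + smul s X) \<omega> $ j) (\<Sum>i\<in>UNIV. Const (mat 1 $ i $ j) * \<omega> $ i)
     (\<Sum>i\<in>UNIV. Const (X $ i $ j) * \<omega> $ i + Const (mat 1 $ i $ j) * der X (\<omega> $ i))"
    unfolding pullback_nth by (intro poly_deriv_sum) simp
  moreover have "(\<Sum>i\<in>UNIV. Const (X $ i $ j) * \<omega> $ i + Const (mat 1 $ i $ j) * der X (\<omega> $ i)) = lie X \<omega> $ j"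
    by (simp add: lie_nth sum.distrib mat_def if_distrib[of Const] mult_delta_left Const_1 add.commute cong: if_cong)
  ultimately show ?thesis
    by (simp add: Pair form_coord_def poly_deriv_def)
qed

lemma polyfun_cong: "polyfun I D f \<Longrightarrow> (\<And>i. i \<in> I \<Longrightarrow> t i = t' i) \<Longrightarrow> f t = f t'"
  by (induction rule: polyfun.induct) auto

lemma polyfun_differentiable:
  assumes "polyfun I D f"
  shows "\<exists>f'. ((\<lambda>x :: complex^'n. f (\<lambda>i. x $ \<beta> i)) has_derivative f') (at x)"
  using assms
proof (induction rule: polyfun.induct)
  case (polyfun_const D c)
  then show ?case by (blast intro: has_derivative_const)
next
  case (polyfun_var i D)
  then show ?case by (blast intro: bounded_linear_imp_has_derivative bounded_linear_vec_nth)
next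
  case (polyfun_add D f g)
  then obtain f' g' where "((\<lambda>x :: complex^'n. f (\<lambda>i. x $ \<beta> i)) has_derivative f') (at x)"
    "((\<lambda>x :: complex^'n. g (\<lambda>i. x $ \<beta> i)) has_derivative g') (at x)" by blast
  from has_derivative_add[OF this] show ?case by blast
next
  case (polyfun_mult D f E g F)
  then obtain f' g' where "((\<lambda>x :: complex^'n. f (\<lambda>i. x $ \<beta> i)) has_derivative f') (at x)"
    "((\<lambda>x :: complex^'n. g (\<lambda>i. x $ \<beta> i)) has_derivative g') (at x)" by blast
  from has_derivative_mult[OF this] show ?case by blast
qed

text \<open>A line through a point of the open set meets it in infinitely many points.\<close>

lemma polyfun_zero_on_open:
  fixes W :: "(complex^'n) set"
  assumes f: "polyfun I D f" and \<beta>: "inj_on \<beta> I" and W: "open W" "w \<in> W"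
    and zero: "\<And>y. y \<in> W \<Longrightarrow> f (\<lambda>i. y $ \<beta> i) = 0"
  shows "f y = 0"
proof -
  define z :: "complex^'n" where "z = (\<chi> b. y (inv_into I \<beta> b))"
  have fz: "f (\<lambda>i. z $ \<beta> i) = f y"
    by (rule polyfun_cong[OF f]) (simp add: z_def \<beta>)
  obtain p where p: "\<And>s. f (\<lambda>i. w $ \<beta> i + s * (z $ \<beta> i - w $ \<beta> i)) = poly p s"
    using polyfun_line[OF f, of "\<lambda>i. w $ \<beta> i" "\<lambda>i. z $ \<beta> i - w $ \<beta> i"] by blast
  let ?l = "\<lambda>s. w + s *s (z - w)"
  have l: "?l = (\<lambda>s. \<chi> i. w $ i + s * (z - w) $ i)"
    by (simp add: fun_eq_iff vec_eq_iff right_diff_distrib)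
  have cont: "continuous_on UNIV ?l"
    unfolding l by (intro continuous_on_vec_lambda continuous_intros)
  then have "open (?l -` W)"
    using W(1) by (simp add: continuous_on_open_vimage)
  moreover have "0 \<in> ?l -` W" using W(2) by simp
  ultimately have "infinite (?l -` W)"
    by (metis empty_iff finite_imp_not_open)
  moreover have "?l -` W \<subseteq> {s. poly p s = 0}"
  proof
    fix s assume "s \<in> ?l -` W"
    then show "s \<in> {s. poly p s = 0}" using zero[of "?l s"] by (simp add: right_diff_distrib flip: p)
  qed
  ultimately have "p = 0"
    using poly_roots_finite finite_subset by blast
  then show ?thesis using p[of 1] fz by simp
qed


lemma has_derivative_vec_lambda:
  fixes f :: "'a::real_normed_vector \<Rightarrow> 'n::finite \<Rightarrow> complex"
  assumes "\<And>i. ((\<lambda>x. f x i) has_derivative (\<lambda>h. f' h i)) (at x)"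
  shows "((\<lambda>x. \<chi> i. f x i) has_derivative (\<lambda>h. \<chi> i. f' h i)) (at x)"
  by (subst has_derivative_componentwise_within)
    (auto simp: Basis_vec_def inner_axis intro!: has_derivative_inner_left assms)

lemma subst_homogeneous_scale:
  assumes "homogeneous n p"
  shows "subst_poly (\<lambda>v. Const k * f v) p = Const (k ^ n) * subst_poly f p"
proof -
  have "(\<Prod>v\<in>Poly_Mapping.keys m. (Const k * f v) ^ Poly_Mapping.lookup m v) =
      Const (k ^ n) * (\<Prod>v\<in>Poly_Mapping.keys m. f v ^ Poly_Mapping.lookup m v)"
    if "m \<in> Poly_Mapping.keys p" for m
  proof -
    have "n = mdeg m" using that assms by (auto simp: homogeneous_def)
    then show ?thesis
      by (simp add: Const_power Const_prod power_mult_distrib prod.distrib mdeg_def power_sum)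
  qed
  then show ?thesis
    by (simp add: insertion_by_def sum_distrib_left mult.left_commute)
qed

lemma pullback_smul:
  assumes "\<omega> \<in> twisted_forms d"
  shows "pullback (smul c M) \<omega> = Const (c ^ (d + 2)) *s pullback M \<omega>"
proof -
  have "row_form (smul c M) = (\<lambda>i. Const c * row_form M i)"
    by (rule ext) (rule row_form_smul)
  moreover have hom: "homogeneous (d + 1) (\<omega> $ i)" for i
    using assms by (simp add: twisted_forms_def)
  ultimately have "pullback (smul c M) \<omega> $ j =
     (\<Sum>i\<in>UNIV. Const (c * M $ i $ j) * (Const (c ^ (d + 1)) * subst_poly (row_form M) (\<omega> $ i)))" for j
    by (simp add: pullback_nth subst_homogeneous_scale[OF hom] del: power_Suc)
  then show ?thesis
    by (simp add: vec_eq_iff pullback_nth sum_distrib_left Const_mult mult_ac)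
qed

lemma proj_point_scale:
  assumes "c \<noteq> 0"
  shows "proj_point (Const c *s \<omega>) = proj_point \<omega>"
proof -
  have scale: "Const k *s (Const c *s \<omega>) = Const (k * c) *s \<omega>" for k
    by (simp add: vec_eq_iff Const_mult mult_ac)
  show ?thesis
    unfolding proj_point_def scale
  proof safe
    fix k :: complex assume "k \<noteq> 0"
    then show "\<exists>l. Const (k * c) *s \<omega> = Const l *s \<omega> \<and> l \<noteq> 0"
      using assms by (intro exI[of _ "k * c"]) simp
    show "\<exists>l. Const k *s \<omega> = Const (l * c) *s \<omega> \<and> l \<noteq> 0"
      using assms \<open>k \<noteq> 0\<close> by (intro exI[of _ "k / c"]) simp
  qed
qed

lemma det_smul: "det (smul c X) = c ^ 3 * det X"
  by (simp add: det_3 power3_eq_cube algebra_simps)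

lemma polyfun_diff: "polyfun I D f \<Longrightarrow> polyfun I D g \<Longrightarrow> polyfun I D (\<lambda>t. f t - g t)"
  using polyfun_add[OF _ polyfun_cmult[of I D g "-1"], of f] by simp

lemma polyfun_det:
  assumes "\<And>i j. polyfun I 1 (\<lambda>t. S t $ i $ j)"
  shows "polyfun I 3 (\<lambda>t. det (S t :: complex^3^3))"
proof -
  have "polyfun I 3 (\<lambda>t. S t $ a $ b * S t $ c $ d * S t $ e $ f)" for a b c d e f
    by (rule polyfun_mult[OF polyfun_mult[OF assms assms order_refl] assms]) simp
  then show ?thesis
    unfolding det_3 by (intro polyfun_diff polyfun_add)
qed

lemma polyfun_comb_entry:
  "polyfun I 1 (\<lambda>t. (\<Sum>j\<in>I. smul (t j) (v j)) $ a $ b)"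
  unfolding sum_component vec_lambda_beta
  by (intro polyfun_sum polyfun_mult[OF polyfun_var polyfun_const[of I 0]]) auto

definition affine_comb :: "(nat \<Rightarrow> complex^3^3) \<Rightarrow> nat \<Rightarrow> (nat \<Rightarrow> complex) \<Rightarrow> complex^3^3" where
  "affine_comb v k t = mat 1 + (\<Sum>j\<in>{1..k}. smul (t j) (v j))"

lemma polyfun_affine_comb: "polyfun {1..k} 1 (\<lambda>t. affine_comb v k t $ a $ b)"
  unfolding affine_comb_def vector_add_component
  by (intro polyfun_add polyfun_const polyfun_comb_entry)

lemma lie_sum: "lie (\<Sum>j\<in>J. smul (c j) (v j)) \<omega> = (\<Sum>j\<in>J. Const (c j) *s lie (v j) \<omega>)"
  by (induction J rule: infinite_finite_induct) (simp_all add: lie_add lie_smul)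

lemma form_coord_sum: "form_coord (\<Sum>j\<in>J. f j) x = (\<Sum>j\<in>J. form_coord (f j) x)"
  by (cases x) (simp add: form_coord_def lookup_sum sum_component)

text \<open>If the linear functionals \<open>F 0, \<dots>, F r\<close> are dual to the derivatives of the orbit map in the
  directions \<open>v 0 = 1, v 1, \<dots>, v r\<close>, then on the cone over the image of the span of
  \<open>v 0, \<dots>, v n\<close> the functions \<open>F 0, \<dots>, F n\<close> take all values near some point by the open
  mapping theorem for functions with surjective derivative, so they satisfy no algebraic relation there.
  By a dimension count they do satisfy one on the image of the span of \<open>v 0, \<dots>, v (n - 1)\<close>.\<close>

lemma relation_on_smaller_span:
  fixes v :: "nat \<Rightarrow> complex^3^3"
  assumes \<omega>: "\<omega> \<in> twisted_forms d" and v0: "v 0 = mat 1" and n: "n = Suc k" "n \<le> 8" and V: "finite V"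
    and F: "\<And>a. F a = (\<lambda>\<omega>. \<Sum>x\<in>V. A a x * form_coord \<omega> x)"
    and dual: "\<And>a b. a \<le> n \<Longrightarrow> b \<le> n \<Longrightarrow> F a (lie (v b) \<omega>) = (if a = b then 1 else 0)"
  shows "\<exists>N u. hom_fun N u \<and> (\<forall>t. u (pullback (affine_comb v k t) \<omega>) = 0) \<and>
    (\<exists>t. det (affine_comb v n t) \<noteq> 0 \<and> u (pullback (affine_comb v n t) \<omega>) \<noteq> 0)"
proof -
  have hF: "hom_fun 1 (F a)" for a
    unfolding F by (intro hom_fun_sum hom_fun_cmult hom_fun_coord)
  obtain N where N: "((d + 2) * (N * n) + 1) ^ k < N ^ n"
    using box_count[of k n "d + 2" n] n by auto
  let ?B = "PiE {1..n} (\<lambda>_. {..<N})" and ?M = "N * n"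
  let ?box = "box_monomial n ?M (\<lambda>_. 1) F"
  have hb: "hom_fun ?M (?box \<alpha>)" if "\<alpha> \<in> ?B" for \<alpha>
    using that by (intro hom_fun_box_monomial[where N = N] hF) auto
  have "\<exists>c. (\<exists>\<alpha>\<in>?B. c \<alpha> \<noteq> 0) \<and> (\<forall>t. (\<Sum>\<alpha>\<in>?B. c \<alpha> * ?box \<alpha> (pullback (affine_comb v k t) \<omega>)) = 0)"
  proof (rule polyfun_relation[where I = "{1..k}" and D = "?M * (d + 2)"])
    show "(?M * (d + 2) + 1) ^ card {1..k} < card ?B"
      using N by (simp add: card_PiE mult_ac)
    show "polyfun {1..k} (?M * (d + 2)) (\<lambda>t. ?box \<alpha> (pullback (affine_comb v k t) \<omega>))" if "\<alpha> \<in> ?B" for \<alpha>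
      by (rule polyfun_hom_fun[OF polyfun_pullback[OF polyfun_affine_comb \<omega>] hb[OF that]])
  qed (auto simp: finite_PiE)
  then obtain c \<alpha>0 where c: "\<alpha>0 \<in> ?B" "c \<alpha>0 \<noteq> 0"
    "\<And>t. (\<Sum>\<alpha>\<in>?B. c \<alpha> * ?box \<alpha> (pullback (affine_comb v k t) \<omega>)) = 0" by blast
  define Q :: "(nat \<Rightarrow> complex) \<Rightarrow> complex" where
    "Q y = (\<Sum>\<alpha>\<in>?B. c \<alpha> * (y 0 ^ (?M - (\<Sum>i\<in>{1..n}. \<alpha> i * 1)) * (\<Prod>i\<in>{1..n}. y i ^ \<alpha> i)))" for y
  define u where "u \<eta> = Q (\<lambda>i. F i \<eta>)" for \<eta>
  have u_eq: "u = (\<lambda>\<eta>. \<Sum>\<alpha>\<in>?B. c \<alpha> * ?box \<alpha> \<eta>)"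
    by (rule ext) (simp add: u_def Q_def box_monomial_def)
  have hu: "hom_fun ?M u"
    unfolding u_eq by (intro hom_fun_sum hom_fun_cmult hb)
  have Qpoly: "polyfun {0..n} ?M Q"
    unfolding Q_def
  proof (intro polyfun_sum polyfun_cmult)
    fix \<alpha> assume "\<alpha> \<in> ?B"
    then have "(\<Sum>i\<in>{1..n}. \<alpha> i) \<le> (\<Sum>i\<in>{1..n}. N)"
      by (intro sum_mono less_imp_le) (auto simp: PiE_iff)
    then have le: "(?M - (\<Sum>i\<in>{1..n}. \<alpha> i * 1)) * 1 + (\<Sum>i\<in>{1..n}. \<alpha> i * 1) \<le> ?M"
      by (simp add: mult.commute)
    show "polyfun {0..n} ?M (\<lambda>y. y 0 ^ (?M - (\<Sum>i\<in>{1..n}. \<alpha> i * 1)) * (\<Prod>i\<in>{1..n}. y i ^ \<alpha> i))"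
      by (rule polyfun_mult[OF polyfun_power polyfun_prod[OF polyfun_power] le]) (auto intro: polyfun_var)
  qed
  have "\<exists>t. det (affine_comb v n t) \<noteq> 0 \<and> u (pullback (affine_comb v n t) \<omega>) \<noteq> 0"
  proof (rule ccontr)
    assume "\<not> ?thesis"
    then have u0: "\<And>t. det (affine_comb v n t) \<noteq> 0 \<Longrightarrow> u (pullback (affine_comb v n t) \<omega>) = 0" by blast
    define L where "L t = (\<Sum>j\<in>{0..n}. smul (t j) (v j))" for t :: "nat \<Rightarrow> complex"
    have L_poly: "polyfun {0..n} 1 (\<lambda>t. L t $ a $ b)" for a b
      unfolding L_def by (rule polyfun_comb_entry)
    have uL: "u (pullback (L t) \<omega>) = 0" if t: "t 0 \<noteq> 0" "det (L t) \<noteq> 0" for t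
    proof -
      let ?t = "\<lambda>j. t j / t 0"
      have "{0..n} = insert 0 {1..n}" by auto
      then have "L t = smul (t 0) (affine_comb v n ?t)"
        using t(1) by (simp add: L_def affine_comb_def v0 vec_eq_iff sum_component sum_distrib_left distrib_left)
      moreover from this have "det (affine_comb v n ?t) \<noteq> 0"
        using t(2) by (auto simp: det_smul)
      ultimately show ?thesis
        using u0 hom_fun_scale[OF hu] by (simp add: pullback_smul[OF \<omega>])
    qed
    obtain \<beta> :: "nat \<Rightarrow> 9" where "bij_betw \<beta> {0..<CARD(9)} UNIV"
      using ex_bij_betw_nat_finite[of "UNIV :: 9 set"] by auto
    then have \<beta>: "inj_on \<beta> {0..n}" "\<beta> ` {0..<9} = UNIV"
      using n by (auto simp: bij_betw_def intro: inj_on_subset)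
    define H where "H a t = F a (pullback (L t) \<omega>)" for a t
    have H_poly: "polyfun {0..n} (d + 2) (H a)" for a
      unfolding H_def F by (intro polyfun_sum polyfun_cmult polyfun_pullback L_poly \<omega>)
    define e0 :: "complex^9" where "e0 = axis (\<beta> 0) 1"
    have e0: "e0 $ \<beta> j = (if j = 0 then 1 else 0)" if "j \<le> n" for j
      using that \<beta>(1) by (auto simp: e0_def axis_def inj_on_def)
    define G :: "complex^9 \<Rightarrow> complex^9" where
      "G x = (\<chi> i. if i \<in> \<beta> ` {0..n} then H (inv_into {0..n} \<beta> i) (\<lambda>j. x $ \<beta> j) else x $ i)" for x
    have G_diff: "\<exists>G'. (G has_derivative G') (at x)" for x
    proof -
      have "\<forall>i. \<exists>g. ((\<lambda>x. if i \<in> \<beta> ` {0..n} then H (inv_into {0..n} \<beta> i) (\<lambda>j. x $ \<beta> j) else x $ i) has_derivative g) (at x)"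
      proof
        fix i
        show "\<exists>g. ((\<lambda>x. if i \<in> \<beta> ` {0..n} then H (inv_into {0..n} \<beta> i) (\<lambda>j. x $ \<beta> j) else x $ i) has_derivative g) (at x)"
        proof (cases "i \<in> \<beta> ` {0..n}")
          case True
          then show ?thesis using polyfun_differentiable[OF H_poly, of "inv_into {0..n} \<beta> i" \<beta> x] by simp
        next
          case False
          then show ?thesis
            using bounded_linear_imp_has_derivative[OF bounded_linear_vec_nth[of i]] by (simp only: if_False) blast
        qed
      qed
      from choice[OF this] obtain g where g: "\<forall>i. ((\<lambda>x. if i \<in> \<beta> ` {0..n} then H (inv_into {0..n} \<beta> i) (\<lambda>j. x $ \<beta> j) else x $ i) has_derivative g i) (at x)"
        by (elim exE)
      show ?thesis
        unfolding G_def by (rule exI) (rule has_derivative_vec_lambda[OF g[rule_format]])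
    qed
    obtain G' where G': "(G has_derivative G') (at e0)" using G_diff by blast
    have G'_id: "G' h = h" for h
    proof -
      interpret G': bounded_linear G' using G' by (rule has_derivative_bounded_linear)
      let ?c = "\<lambda>s::real. G (e0 + s *\<^sub>R h)"
      have "((\<lambda>s. e0 + s *\<^sub>R h) has_derivative (\<lambda>s. s *\<^sub>R h)) (at 0)"
        by (auto intro!: derivative_eq_intros)
      then have "((G \<circ> (\<lambda>s. e0 + s *\<^sub>R h)) has_derivative (G' \<circ> (\<lambda>s. s *\<^sub>R h))) (at 0)"
        using G' by (intro diff_chain_at) auto
      then have "(?c has_derivative (\<lambda>s. s *\<^sub>R G' h)) (at 0)"
        by (simp add: o_def G'.scaleR)
      then have c1: "((\<lambda>s. ?c s $ i) has_vector_derivative (G' h $ i)) (at 0)" for i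
        unfolding has_vector_derivative_def
        using bounded_linear.has_derivative[OF bounded_linear_vec_nth] by fastforce
      have c2: "((\<lambda>s. ?c s $ i) has_vector_derivative (h $ i)) (at 0)" for i
      proof (cases "i \<in> \<beta> ` {0..n}")
        case True
        then obtain a where a: "a \<le> n" "i = \<beta> a" by auto
        let ?X = "\<Sum>j\<in>{0..n}. smul (h $ \<beta> j) (v j)"
        have "L (\<lambda>j. (e0 + s *\<^sub>R h) $ \<beta> j) = mat 1 + smul (of_real s) ?X" for s
        proof -
          have "L (\<lambda>j. (e0 + s *\<^sub>R h) $ \<beta> j) = (\<Sum>j\<in>{0..n}. smul (if j = 0 then 1 else 0) (v j) +
              smul (of_real s) (smul (h $ \<beta> j) (v j)))"
            unfolding L_def by (intro sum.cong refl) (simp add: e0 vec_eq_iff distrib_right, simp add: scaleR_conv_of_real)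
          also have "\<dots> = (\<Sum>j\<in>{0..n}. if j = 0 then v j else 0) + smul (of_real s) ?X"
            unfolding sum.distrib
            by (intro arg_cong2[where f = "(+)"] sum.cong refl)
              (auto simp: vec_eq_iff sum_component sum_distrib_left)
          finally show ?thesis by (simp add: v0)
        qed
        then have "?c s $ i = F a (pullback (mat 1 + smul (of_real s) ?X) \<omega>)" for s
          using a \<beta>(1) by (simp add: G_def H_def)
        moreover have "((\<lambda>s. F a (pullback (mat 1 + smul s ?X) \<omega>)) has_field_derivative F a (lie ?X \<omega>)) (at (of_real 0))"
          unfolding F of_real_0 by (intro DERIV_sum DERIV_cmult form_coord_deriv)
        moreover have "F a (lie ?X \<omega>) = h $ i"
        proof -
          have "F a (lie ?X \<omega>) = (\<Sum>j\<in>{0..n}. h $ \<beta> j * F a (lie (v j) \<omega>))"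
          proof -
            have "F a (lie ?X \<omega>) = (\<Sum>x\<in>V. \<Sum>j\<in>{0..n}. h $ \<beta> j * (A a x * form_coord (lie (v j) \<omega>) x))"
              by (simp add: F lie_sum form_coord_sum form_coord_scale sum_distrib_left mult_ac)
            also have "\<dots> = (\<Sum>j\<in>{0..n}. \<Sum>x\<in>V. h $ \<beta> j * (A a x * form_coord (lie (v j) \<omega>) x))"
              by (rule sum.swap)
            finally show ?thesis by (simp add: F sum_distrib_left)
          qed
          also have "\<dots> = (\<Sum>j\<in>{0..n}. if j = a then h $ \<beta> j else 0)"
            by (intro sum.cong refl) (use dual a in auto)
          finally show ?thesis using a by simp
        qed
        ultimately show ?thesis
          using has_vector_derivative_real_field by fastforce
      next
        case False
        then have "?c s $ i = e0 $ i + s *\<^sub>R h $ i" for s by (simp add: G_def)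
        then show ?thesis by (auto intro!: derivative_eq_intros)
      qed
      show ?thesis
        using vector_derivative_unique_at[OF c1 c2] by (simp add: vec_eq_iff)
    qed
    define S where "S = {x :: complex^9. x $ \<beta> 0 \<noteq> 0 \<and> det (L (\<lambda>j. x $ \<beta> j)) \<noteq> 0}"
    have "continuous_on UNIV (\<lambda>x :: complex^9. det (L (\<lambda>j. x $ \<beta> j)))"
      using polyfun_differentiable[OF polyfun_det[OF L_poly]] has_derivative_continuous
      by (metis continuous_at_imp_continuous_on)
    moreover have "continuous_on UNIV (\<lambda>x :: complex^9. x $ \<beta> 0)"
      by (intro continuous_intros)
    ultimately have "open ({x :: complex^9. x $ \<beta> 0 \<noteq> 0} \<inter> {x. det (L (\<lambda>j. x $ \<beta> j)) \<noteq> 0})"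
      by (intro open_Int open_Collect_neq continuous_on_const)
    then have S_open: "open S" by (simp add: S_def Collect_conj_eq)
    have "L (\<lambda>j. e0 $ \<beta> j) = mat 1"
    proof -
      have "L (\<lambda>j. e0 $ \<beta> j) = (\<Sum>j\<in>{0..n}. if j = 0 then v j else 0)"
        unfolding L_def by (intro sum.cong refl) (simp add: e0 vec_eq_iff)
      then show ?thesis by (simp add: v0)
    qed
    then have e0S: "e0 \<in> S" using e0[of 0] by (simp add: S_def)
    have G_cont: "continuous_on S G"
      using G_diff has_derivative_continuous by (metis continuous_at_imp_continuous_on)
    have "G e0 \<in> interior (G ` S)"
      by (rule sussmann_open_mapping[OF S_open G_cont e0S G' bounded_linear_ident _ order_refl])
        (use G'_id S_open e0S in \<open>auto simp: fun_eq_iff interior_open\<close>)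
    moreover have "Q (\<lambda>i. y $ \<beta> i) = 0" if y: "y \<in> interior (G ` S)" for y
    proof -
      obtain x where x: "x \<in> S" "y = G x" using y interior_subset by blast
      have "Q (\<lambda>i. y $ \<beta> i) = Q (\<lambda>i. F i (pullback (L (\<lambda>j. x $ \<beta> j)) \<omega>))"
        by (rule polyfun_cong[OF Qpoly]) (use x \<beta>(1) in \<open>simp add: G_def H_def\<close>)
      also have "\<dots> = 0" using uL[of "\<lambda>j. x $ \<beta> j"] x(1) by (simp add: u_def S_def)
      finally show ?thesis .
    qed
    ultimately have Q0: "Q y = 0" for y
      by (rule polyfun_zero_on_open[OF Qpoly \<beta>(1) open_interior])
    have "(\<Sum>\<alpha>\<in>?B. c \<alpha> * (\<Prod>i\<in>{1..n}. y i ^ \<alpha> i)) = 0" for y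
    proof -
      have "(\<Prod>i\<in>{1..n}. (y(0 := 1)) i ^ \<alpha> i) = (\<Prod>i\<in>{1..n}. y i ^ \<alpha> i)" for \<alpha>
        by (rule prod.cong) auto
      then show ?thesis using Q0[of "y(0 := 1)"] by (simp add: Q_def)
    qed
    then have "c \<alpha>0 = 0"
      by (intro box_monomials_independent[OF _ _ c(1)]) auto
    then show False using c(2) by simp
  qed
  moreover have "\<forall>t. u (pullback (affine_comb v k t) \<omega>) = 0"
    using c(3) by (simp add: u_eq)
  ultimately show ?thesis using hu by blast
qed


definition orbit :: "3 form \<Rightarrow> 3 form set set" where
  "orbit \<omega> = {proj_point (pullback M \<omega>) | M. invertible M}"

lemma pullback_0 [simp]: "pullback M 0 = 0"
  by (simp add: vec_eq_iff pullback_nth)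

lemma orbit_subset:
  assumes "\<omega> \<in> twisted_forms d" "\<omega> \<noteq> 0"
  shows "orbit \<omega> \<subseteq> proj_forms d"
proof
  fix P assume "P \<in> orbit \<omega>"
  then obtain M N where M: "P = proj_point (pullback M \<omega>)" "M ** N = mat 1"
    unfolding orbit_def invertible_def by blast
  then have "pullback M \<omega> \<noteq> 0" using assms(2) pullback_inverse[OF M(2), of \<omega>] by auto
  then show "P \<in> proj_forms d"
    using M pullback_twisted[OF assms(1)] unfolding proj_forms_def by blast
qed

lemma affine_comb_extend: "affine_comb v k t = affine_comb v (Suc k) (t(Suc k := 0))"
proof -
  have "(\<Sum>j\<in>{1..k}. smul ((t(Suc k := 0)) j) (v j)) = (\<Sum>j\<in>{1..k}. smul (t j) (v j))"
    by (intro sum.cong refl) auto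
  moreover have "smul 0 (v (Suc k)) = 0" by (simp add: vec_eq_iff)
  ultimately show ?thesis by (simp add: affine_comb_def)
qed

text \<open>The closures of the images of the affine spaces \<open>1 + span (v 1, \<dots>, v k)\<close> are irreducible as closures of
  images of affine spaces, and they increase strictly by \<open>relation_on_smaller_span\<close>.\<close>

lemma krull_dim_orbit_ge:
  fixes v :: "nat \<Rightarrow> complex^3^3"
  assumes \<omega>: "\<omega> \<in> twisted_forms d" and v0: "v 0 = mat 1" and r: "r \<le> 8" and V: "finite V"
    and F: "\<And>a. F a = (\<lambda>\<omega>. \<Sum>x\<in>V. A a x * form_coord \<omega> x)"
    and dual: "\<And>a b. a \<le> r \<Longrightarrow> b \<le> r \<Longrightarrow> F a (lie (v b) \<omega>) = (if a = b then 1 else 0)"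
  shows "enat r \<le> krull_dim (subtopology (zariski d) (orbit \<omega>))"
proof -
  have "\<omega> \<noteq> 0"
  proof
    assume "\<omega> = 0"
    then have "lie (v 0) \<omega> = 0" by (simp add: vec_eq_iff lie_nth)
    then show False using dual[of 0 0] by (simp add: F form_coord_def case_prod_beta)
  qed
  then have orb: "orbit \<omega> \<subseteq> proj_forms d" using orbit_subset \<omega> by blast
  let ?pt = "\<lambda>k t. pullback (affine_comb v k t) \<omega>"
  have pt: "proj_point (?pt k t) \<in> orbit \<omega>" if "det (affine_comb v k t) \<noteq> 0" for k t
    using that by (auto simp: orbit_def invertible_det_nz)
  define E where "E k = {p. (\<exists>n. homogeneous n p) \<and>
      (\<forall>t. det (affine_comb v k t) \<noteq> 0 \<longrightarrow> eval_poly (form_coord (?pt k t)) p = 0)}" for k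
  have E_hom: "\<forall>p\<in>E k. \<exists>n. homogeneous n p" for k by (auto simp: E_def)
  define Z where "Z k = orbit \<omega> \<inter> proj_zeros d (E k)" for k
  have Z_closed: "closedin (subtopology (zariski d) (orbit \<omega>)) (Z k)" for k
    unfolding closedin_zariski_sub[OF orb] Z_def using E_hom by blast
  have pt_Z: "proj_point (?pt k t) \<in> Z k" if "det (affine_comb v k t) \<noteq> 0" for k t
  proof -
    have "proj_point (?pt k t) \<in> proj_zeros d (E k)"
      using pt[OF that] orb that by (subst mem_proj_zeros_iff[OF E_hom]) (auto simp: E_def)
    then show ?thesis using pt[OF that] by (simp add: Z_def)
  qed
  have Z_van: "vanishes_on u (Z k)" if u: "hom_fun N u"
    and 0: "\<And>t. det (affine_comb v k t) \<noteq> 0 \<Longrightarrow> u (?pt k t) = 0" for N u k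
  proof -
    obtain p where p: "homogeneous N p" "u = (\<lambda>\<omega>. eval_poly (form_coord \<omega>) p)"
      using u by (auto simp: hom_fun_def)
    then have "p \<in> E k" using 0 by (auto simp: E_def)
    then show ?thesis
      using proj_zeros_vanishes_on p(2) vanishes_on_subset unfolding Z_def by blast
  qed
  have Z_irr: "irreducible_space (subtopology (subtopology (zariski d) (orbit \<omega>)) (Z k))" for k
  proof -
    have top: "topspace (subtopology (subtopology (zariski d) (orbit \<omega>)) (Z k)) = Z k"
      using orb by (auto simp: topspace_subtopology topspace_zariski Z_def)
    have det0: "det (affine_comb v k (\<lambda>_. 0)) \<noteq> 0"
    proof -
      have "smul 0 X = 0" for X by (simp add: vec_eq_iff)
      then show ?thesis by (simp add: affine_comb_def)
    qed
    have cover: "Z k \<subseteq> C \<or> Z k \<subseteq> C'"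
      if C: "closedin (subtopology (zariski d) (orbit \<omega>)) C" "closedin (subtopology (zariski d) (orbit \<omega>)) C'"
        "Z k \<subseteq> C \<union> C'" for C C'
    proof (rule ccontr)
      assume "\<not> ?thesis"
      then obtain M u M' u' where u: "hom_fun M u" "vanishes_on u C" "\<not> vanishes_on u (Z k)"
        and u': "hom_fun M' u'" "vanishes_on u' C'" "\<not> vanishes_on u' (Z k)"
        using closed_psubset_separated[OF orb C(1), of "Z k"] closed_psubset_separated[OF orb C(2), of "Z k"]
          closedin_subset[OF Z_closed[of k]] by (auto simp: topspace_subtopology)
      have poly: "polyfun {1..k} (N * (d + 2)) (\<lambda>t. w (?pt k t))" if "hom_fun N w" for N w
        by (rule polyfun_hom_fun[OF polyfun_pullback[OF polyfun_affine_comb \<omega>] that])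
      obtain s where s: "u (?pt k s) \<noteq> 0" using Z_van[OF u(1)] u(3) by blast
      obtain s' where s': "u' (?pt k s') \<noteq> 0" using Z_van[OF u'(1)] u'(3) by blast
      obtain t where t: "u (?pt k t) * u' (?pt k t) \<noteq> 0"
        using polyfun_mult_nonzero[OF poly[OF u(1)] s poly[OF u'(1)] s'] by auto
      obtain t' where t': "u (?pt k t') * u' (?pt k t') \<noteq> 0" "det (affine_comb v k t') \<noteq> 0"
        using polyfun_mult_nonzero[OF polyfun_mult[OF poly[OF u(1)] poly[OF u'(1)] order_refl] t
            polyfun_det[OF polyfun_affine_comb] det0] by auto
      then have "proj_point (?pt k t') \<in> C \<union> C'" using pt_Z C(3) by blast
      then show False using t' u(2) u'(2) by (auto simp: vanishes_on_def)
    qed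
    have "Z k \<noteq> {}" using pt_Z[OF det0] by blast
    moreover have "A = Z k \<or> B = Z k" if A: "closedin (subtopology (subtopology (zariski d) (orbit \<omega>)) (Z k)) A"
      and B: "closedin (subtopology (subtopology (zariski d) (orbit \<omega>)) (Z k)) B" and AB: "Z k = A \<union> B" for A B
    proof -
      have "closedin (subtopology (zariski d) (orbit \<omega>)) A" "closedin (subtopology (zariski d) (orbit \<omega>)) B"
        using A B Z_closed closedin_trans_full by blast+
      then show ?thesis using cover[of A B] AB by blast
    qed
    ultimately show ?thesis unfolding irreducible_space_def top by blast
  qed
  have "Z k \<subset> Z (Suc k)" if k: "k < r" for k
  proof
    have "E (Suc k) \<subseteq> E k"
    proof
      fix p assume "p \<in> E (Suc k)"
      then have hom: "\<exists>n. homogeneous n p"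
        and zero: "\<And>t. det (affine_comb v (Suc k) t) \<noteq> 0 \<Longrightarrow> eval_poly (form_coord (?pt (Suc k) t)) p = 0"
        unfolding E_def by blast+
      have "eval_poly (form_coord (?pt k t)) p = 0" if "det (affine_comb v k t) \<noteq> 0" for t
        using zero[of "t(Suc k := 0)", folded affine_comb_extend, OF that] .
      then show "p \<in> E k" using hom unfolding E_def by blast
    qed
    then show "Z k \<subseteq> Z (Suc k)"
      unfolding Z_def proj_zeros_def by blast
    have "\<exists>N u. hom_fun N u \<and> (\<forall>t. u (?pt k t) = 0) \<and>
        (\<exists>t. det (affine_comb v (Suc k) t) \<noteq> 0 \<and> u (?pt (Suc k) t) \<noteq> 0)"
      using relation_on_smaller_span[of \<omega> d v "Suc k" k V F A] \<omega> v0 V F dual k r by simp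
    then obtain N u t where u: "hom_fun N u" "\<forall>t. u (?pt k t) = 0"
      and t: "det (affine_comb v (Suc k) t) \<noteq> 0" "u (?pt (Suc k) t) \<noteq> 0"
      by blast
    have "proj_point (?pt (Suc k) t) \<notin> Z k"
      using Z_van[OF u(1)] u(2) t(2) unfolding vanishes_on_def by blast
    then show "Z k \<noteq> Z (Suc k)" using pt_Z[OF t(1)] by blast
  qed
  then show ?thesis
    unfolding krull_dim_def
    by (intro Sup_upper CollectI exI[of _ r] conjI exI[of _ Z] allI impI Z_closed Z_irr refl)
qed

section \<open>Coefficients of forms in three variables\<close>

definition mon :: "nat \<Rightarrow> nat \<Rightarrow> nat \<Rightarrow> 3 \<Rightarrow>\<^sub>0 nat" where
  "mon i j k = Poly_Mapping.single 1 i + Poly_Mapping.single 2 j + Poly_Mapping.single 3 k"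

lemma lookup_mon [simp]:
  "Poly_Mapping.lookup (mon i j k) 1 = i"
  "Poly_Mapping.lookup (mon i j k) 2 = j"
  "Poly_Mapping.lookup (mon i j k) 3 = k"
  by (simp_all add: mon_def lookup_add lookup_single when_def)

lemma mon_eq_iff: "mon i j k = mon i' j' k' \<longleftrightarrow> i = i' \<and> j = j' \<and> k = k'"
  by (metis lookup_mon)

lemma exponent_eqI:
  fixes m m' :: "3 \<Rightarrow>\<^sub>0 nat"
  assumes "Poly_Mapping.lookup m 1 = Poly_Mapping.lookup m' 1"
    "Poly_Mapping.lookup m 2 = Poly_Mapping.lookup m' 2"
    "Poly_Mapping.lookup m 3 = Poly_Mapping.lookup m' 3"
  shows "m = m'"
proof (rule poly_mapping_eqI)
  fix v :: 3
  show "Poly_Mapping.lookup m v = Poly_Mapping.lookup m' v"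
    using exhaust_3[of v] assms by auto
qed

lemma mon_exists: "\<exists>i j k. m = mon i j k"
  by (intro exI exponent_eqI) (rule lookup_mon[symmetric])+

lemma mdeg_mon: "mdeg (mon i j k) = i + j + k"
proof -
  have "mdeg (Poly_Mapping.single v n) = n" for v :: 3 and n
    by (simp add: mdeg_def)
  then show ?thesis by (simp add: mon_def mdeg_add)
qed

lemma mon_shift:
  "mon (Suc i) j k - Poly_Mapping.single 1 (Suc 0) = mon i j k"
  "mon i (Suc j) k - Poly_Mapping.single 2 (Suc 0) = mon i j k"
  "mon i j (Suc k) - Poly_Mapping.single 3 (Suc 0) = mon i j k"
  "mon i j k + Poly_Mapping.single 1 (Suc 0) = mon (Suc i) j k"
  "mon i j k + Poly_Mapping.single 2 (Suc 0) = mon i (Suc j) k"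
  "mon i j k + Poly_Mapping.single 3 (Suc 0) = mon i j (Suc k)"
  by (rule exponent_eqI; simp add: lookup_add lookup_minus lookup_single when_def)+

abbreviation coeff_at :: "3 cpoly \<Rightarrow> nat \<Rightarrow> nat \<Rightarrow> nat \<Rightarrow> complex" where
  "coeff_at p i j k \<equiv> Poly_Mapping.lookup p (mon i j k)"

lemma coeff_Var_mult:
  "coeff_at (Var 1 * p) i j k = (if i = 0 then 0 else coeff_at p (i - 1) j k)"
  "coeff_at (Var 2 * p) i j k = (if j = 0 then 0 else coeff_at p i (j - 1) k)"
  "coeff_at (Var 3 * p) i j k = (if k = 0 then 0 else coeff_at p i j (k - 1))"
  by (cases i; cases j; cases k; simp add: lookup_Var_mult mon_shift)+

lemma coeff_pd:
  "coeff_at (pd 1 p) i j k = of_nat (i + 1) * coeff_at p (i + 1) j k"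
  "coeff_at (pd 2 p) i j k = of_nat (j + 1) * coeff_at p i (j + 1) k"
  "coeff_at (pd 3 p) i j k = of_nat (k + 1) * coeff_at p i j (k + 1)"
  by (simp_all add: lookup_pd mon_shift)

lemma lookup_single_mon:
  "coeff_at (Poly_Mapping.single (mon a b c) u) i j k = (if i = a \<and> j = b \<and> k = c then u else 0)"
  by (auto simp: lookup_single when_def mon_eq_iff)

abbreviation cf :: "3 form \<Rightarrow> 3 \<Rightarrow> nat \<Rightarrow> nat \<Rightarrow> nat \<Rightarrow> complex" where
  "cf \<omega> l i j k \<equiv> coeff_at (\<omega> $ l) i j k"

lemma form_eqI:
  assumes "\<And>l i j k. cf \<omega> l i j k = cf \<eta> l i j k"
  shows "\<omega> = \<eta>"
  unfolding vec_eq_iff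
proof (intro allI poly_mapping_eqI)
  fix l m
  show "Poly_Mapping.lookup (\<omega> $ l) m = Poly_Mapping.lookup (\<eta> $ l) m"
    using mon_exists[of m] assms by auto
qed

text \<open>Term by term, \<open>X $ a $ n\<close> is the coefficient of the vector field that multiplies the derivative in direction
  \<open>a\<close> by the variable \<open>n\<close>.\<close>

lemma cf_lie:
  "cf (lie X \<omega>) l i j k =
    X $ 1 $ l * cf \<omega> 1 i j k + X $ 2 $ l * cf \<omega> 2 i j k + X $ 3 $ l * cf \<omega> 3 i j k
    + (X $ 1 $ 1 * of_nat i + X $ 2 $ 2 * of_nat j + X $ 3 $ 3 * of_nat k) * cf \<omega> l i j k
    + (if j = 0 then 0 else X $ 1 $ 2 * of_nat (i + 1) * cf \<omega> l (i + 1) (j - 1) k)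
    + (if k = 0 then 0 else X $ 1 $ 3 * of_nat (i + 1) * cf \<omega> l (i + 1) j (k - 1))
    + (if i = 0 then 0 else X $ 2 $ 1 * of_nat (j + 1) * cf \<omega> l (i - 1) (j + 1) k)
    + (if k = 0 then 0 else X $ 2 $ 3 * of_nat (j + 1) * cf \<omega> l i (j + 1) (k - 1))
    + (if i = 0 then 0 else X $ 3 $ 1 * of_nat (k + 1) * cf \<omega> l (i - 1) j (k + 1))
    + (if j = 0 then 0 else X $ 3 $ 2 * of_nat (k + 1) * cf \<omega> l i (j - 1) (k + 1))"
proof -
  have "der X p = (\<Sum>a\<in>UNIV. \<Sum>n\<in>UNIV. Const (X $ a $ n) * (Var n * pd a p))" for p
    by (simp add: der_def row_form_def sum_distrib_right mult.assoc)
  then have "cf (lie X \<omega>) l i j k = (\<Sum>a\<in>UNIV. \<Sum>n\<in>UNIV. X $ a $ n * coeff_at (Var n * pd a (\<omega> $ l)) i j k)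
      + (\<Sum>a\<in>UNIV. X $ a $ l * cf \<omega> a i j k)"
    by (simp add: lie_nth lookup_add lookup_sum Const_mult_lookup)
  then show ?thesis
    by (cases i; cases j; cases k; simp add: sum_3 coeff_Var_mult coeff_pd algebra_simps)
qed


section \<open>Degree three: tangency and divisibility in terms of coefficients\<close>

definition foliation_form :: "3 form \<Rightarrow> bool" where
  "foliation_form \<omega> \<longleftrightarrow> \<omega> \<in> twisted_forms 3 \<and> no_common_factor \<omega>"

lemma homogeneous_coeff: "homogeneous n p \<Longrightarrow> i + j + k \<noteq> n \<Longrightarrow> coeff_at p i j k = 0"
  unfolding homogeneous_def using mdeg_mon[of i j k] in_keys_iff[of "mon i j k" p] by fastforce

lemma cf_degree: "\<omega> \<in> twisted_forms 3 \<Longrightarrow> i + j + k \<noteq> 4 \<Longrightarrow> cf \<omega> l i j k = 0"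
  by (rule homogeneous_coeff[of 4]) (simp_all add: twisted_forms_def)

lemma cf_tangency:
  assumes "\<omega> \<in> twisted_forms 3"
  shows "(if i = 0 then 0 else cf \<omega> 1 (i - 1) j k) + (if j = 0 then 0 else cf \<omega> 2 i (j - 1) k)
     + (if k = 0 then 0 else cf \<omega> 3 i j (k - 1)) = 0"
proof -
  have "coeff_at (\<Sum>i\<in>UNIV. Var i * \<omega> $ i) i j k = 0"
    using assms by (simp add: twisted_forms_def)
  then show ?thesis
    by (simp only: sum_3 lookup_add coeff_Var_mult)
qed

lemma not_unit: "eval_poly x p = 0 \<Longrightarrow> \<not> p dvd 1"
proof
  assume 0: "eval_poly x p = 0" and "p dvd 1"
  then obtain q where "1 = p * q" by (auto simp: dvd_def)
  then have "eval_poly x (p * q) = 1" using eval_1[of x] by simp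
  then show False using 0 by (simp add: eval_mult)
qed

lemma Var_dvdI:
  assumes "\<And>m. Poly_Mapping.lookup p m \<noteq> 0 \<Longrightarrow> Poly_Mapping.lookup m v \<noteq> 0"
  shows "Var v dvd p"
proof -
  let ?e = "Poly_Mapping.single v (1::nat)"
  have "Var v dvd Poly_Mapping.single m c" if "Poly_Mapping.lookup m v \<noteq> 0" for m and c :: complex
  proof -
    have "?e + (m - ?e) = m"
      using that by (intro poly_mapping_eqI) (auto simp: lookup_add lookup_minus lookup_single when_def)
    then have "Poly_Mapping.single m c = Var v * Poly_Mapping.single (m - ?e) c"
      by (simp add: Var_def mult_single)
    then show ?thesis by simp
  qed
  then show ?thesis
    using assms by (subst poly_mapping_eq_sum_single) (intro dvd_sum, simp add: in_keys_iff)
qed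

lemma no_common_Var:
  assumes "no_common_factor \<omega>"
  shows "\<exists>l m. Poly_Mapping.lookup (\<omega> $ l) m \<noteq> 0 \<and> Poly_Mapping.lookup m v = 0"
proof (rule ccontr)
  assume "\<not> ?thesis"
  then have "Var v dvd \<omega> $ l" for l by (intro Var_dvdI) auto
  then have "Var v dvd (1 :: 3 cpoly)" using assms by (auto simp: no_common_factor_def)
  then show False using not_unit[of "\<lambda>_. 0" "Var v"] by simp
qed

lemma not_divisible:
  assumes "foliation_form \<omega>"
  shows "\<exists>l j k. cf \<omega> l 0 j k \<noteq> 0" "\<exists>l i k. cf \<omega> l i 0 k \<noteq> 0" "\<exists>l i j. cf \<omega> l i j 0 \<noteq> 0"
proof -
  have *: "\<exists>l i j k. cf \<omega> l i j k \<noteq> 0 \<and> Poly_Mapping.lookup (mon i j k) v = 0" for v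
  proof -
    obtain l m where m: "Poly_Mapping.lookup (\<omega> $ l) m \<noteq> 0" "Poly_Mapping.lookup m v = 0"
      using no_common_Var[of \<omega> v] assms unfolding foliation_form_def by blast
    obtain i j k where "m = mon i j k" using mon_exists by blast
    then show ?thesis using m by blast
  qed
  show "\<exists>l j k. cf \<omega> l 0 j k \<noteq> 0" using *[of 1] unfolding lookup_mon by blast
  show "\<exists>l i k. cf \<omega> l i 0 k \<noteq> 0" using *[of 2] unfolding lookup_mon by blast
  show "\<exists>l i j. cf \<omega> l i j 0 \<noteq> 0" using *[of 3] unfolding lookup_mon by blast
qed

lemma foliation_form_nonzero: "foliation_form \<omega> \<Longrightarrow> \<omega> \<noteq> 0"
  using not_divisible(1) by fastforce

lemma homogeneous_4_eqI:
  assumes "homogeneous 4 p" "homogeneous 4 q"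
    "coeff_at p 4 0 0 = coeff_at q 4 0 0" "coeff_at p 3 1 0 = coeff_at q 3 1 0" "coeff_at p 3 0 1 = coeff_at q 3 0 1"
    "coeff_at p 2 2 0 = coeff_at q 2 2 0" "coeff_at p 2 1 1 = coeff_at q 2 1 1" "coeff_at p 2 0 2 = coeff_at q 2 0 2"
    "coeff_at p 1 3 0 = coeff_at q 1 3 0" "coeff_at p 1 2 1 = coeff_at q 1 2 1" "coeff_at p 1 1 2 = coeff_at q 1 1 2"
    "coeff_at p 1 0 3 = coeff_at q 1 0 3" "coeff_at p 0 4 0 = coeff_at q 0 4 0" "coeff_at p 0 3 1 = coeff_at q 0 3 1"
    "coeff_at p 0 2 2 = coeff_at q 0 2 2" "coeff_at p 0 1 3 = coeff_at q 0 1 3" "coeff_at p 0 0 4 = coeff_at q 0 0 4"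
  shows "p = q"
proof (rule poly_mapping_eqI)
  fix m
  obtain i j k where m: "m = mon i j k" using mon_exists by blast
  show "Poly_Mapping.lookup p m = Poly_Mapping.lookup q m"
  proof (cases "i + j + k = 4")
    case True
    then have "i = 4 \<and> j = 0 \<and> k = 0 \<or> i = 3 \<and> j = 1 \<and> k = 0 \<or> i = 3 \<and> j = 0 \<and> k = 1 \<or> i = 2 \<and> j = 2 \<and> k = 0 \<or> i = 2 \<and> j = 1 \<and> k = 1 \<or> i = 2 \<and> j = 0 \<and> k = 2 \<or> i = 1 \<and> j = 3 \<and> k = 0 \<or> i = 1 \<and> j = 2 \<and> k = 1 \<or> i = 1 \<and> j = 1 \<and> k = 2 \<or> i = 1 \<and> j = 0 \<and> k = 3 \<or> i = 0 \<and> j = 4 \<and> k = 0 \<or> i = 0 \<and> j = 3 \<and> k = 1 \<or> i = 0 \<and> j = 2 \<and> k = 2 \<or> i = 0 \<and> j = 1 \<and> k = 3 \<or> i = 0 \<and> j = 0 \<and> k = 4"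
      by presburger
    then show ?thesis
      unfolding m by (elim disjE conjE) (simp_all only: assms(3-))
  next
    case False
    then show ?thesis
      using assms(1,2) m homogeneous_coeff by metis
  qed
qed

definition m3 :: "complex \<Rightarrow> complex \<Rightarrow> complex \<Rightarrow> complex \<Rightarrow> complex \<Rightarrow> complex \<Rightarrow> complex \<Rightarrow> complex \<Rightarrow> complex \<Rightarrow> complex^3^3" where
  "m3 a b c d e f g h i = vector [vector [a, b, c], vector [d, e, f], vector [g, h, i]]"

lemma m3_nth [simp]:
  "m3 a b c d e f g h i $ 1 $ 1 = a" "m3 a b c d e f g h i $ 1 $ 2 = b" "m3 a b c d e f g h i $ 1 $ 3 = c"
  "m3 a b c d e f g h i $ 2 $ 1 = d" "m3 a b c d e f g h i $ 2 $ 2 = e" "m3 a b c d e f g h i $ 2 $ 3 = f"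
  "m3 a b c d e f g h i $ 3 $ 1 = g" "m3 a b c d e f g h i $ 3 $ 2 = h" "m3 a b c d e f g h i $ 3 $ 3 = i"
  by (simp_all add: m3_def vector_3)

abbreviation diag3 :: "complex \<Rightarrow> complex \<Rightarrow> complex \<Rightarrow> complex^3^3" where
  "diag3 a b c \<equiv> m3 a 0 0 0 b 0 0 0 c"

text \<open>A diagonal field acts on the form with a single coefficient \<open>cf l i j k\<close> by this eigenvalue; the differential
  counts as one more variable.\<close>

definition weight :: "complex \<Rightarrow> complex \<Rightarrow> complex \<Rightarrow> 3 \<Rightarrow> nat \<Rightarrow> nat \<Rightarrow> nat \<Rightarrow> complex" where
  "weight a b c l i j k = (if l = 1 then a else if l = 2 then b else c) + a * of_nat i + b * of_nat j + c * of_nat k"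

lemma cf_lie_diag: "cf (lie (diag3 a b c) \<omega>) l i j k = weight a b c l i j k * cf \<omega> l i j k"
  using exhaust_3[of l] by (auto simp: cf_lie weight_def algebra_simps)

lemma lie_diag_eq_0: "lie (diag3 a b c) \<omega> = 0 \<longleftrightarrow> (\<forall>l i j k. weight a b c l i j k = 0 \<or> cf \<omega> l i j k = 0)"
proof
  assume "lie (diag3 a b c) \<omega> = 0"
  then have "cf (lie (diag3 a b c) \<omega>) l i j k = 0" for l i j k by simp
  then show "\<forall>l i j k. weight a b c l i j k = 0 \<or> cf \<omega> l i j k = 0" by (simp add: cf_lie_diag)
qed (auto intro!: form_eqI simp: cf_lie_diag)

lemma lie_scalar:
  assumes "foliation_form \<omega>" "lie (diag3 a a a) \<omega> = 0"
  shows "a = 0"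
proof -
  obtain l j k where *: "cf \<omega> l 0 j k \<noteq> 0" using not_divisible(1)[OF assms(1)] by blast
  then have "0 + j + k = 4" using cf_degree[of \<omega> 0 j k l] assms(1) by (auto simp: foliation_form_def)
  then have "k = 4 - j" "j \<le> 4" by auto
  then have "weight a a a l 0 j k = 5 * a"
    by (simp add: weight_def of_nat_diff algebra_simps)
  then show ?thesis using assms(2)[unfolded lie_diag_eq_0, rule_format, of l 0 j k] * by simp
qed

text \<open>Coefficients of nonzero weight under the diagonal part vanish one after the other, because the nilpotent part
  moves coefficients of the same weight in one direction only. So the stabiliser contains the semisimple and the
  nilpotent parts of its elements.\<close>

lemma lie_jordan_parts:
  assumes \<omega>: "\<omega> \<in> twisted_forms 3"
    and D: "D = diag3 a b c" and N: "N = m3 0 0 0 s 0 0 r t 0"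
    and comm: "s \<noteq> 0 \<Longrightarrow> a = b" "t \<noteq> 0 \<Longrightarrow> b = c" "r \<noteq> 0 \<Longrightarrow> a = c"
    and lie: "lie (D + N) \<omega> = 0"
  shows "lie D \<omega> = 0" "lie N \<omega> = 0"
proof -
  let ?h = "\<lambda>l :: 3. if l = 1 then 0 else if l = 2 then 1 else 2 :: nat"
  have eq: "weight a b c l i j k * cf \<omega> l i j k
      + (if l = 1 then s * cf \<omega> 2 i j k + r * cf \<omega> 3 i j k else if l = 2 then t * cf \<omega> 3 i j k else 0)
      + (if i = 0 then 0 else of_nat (j + 1) * (s * cf \<omega> l (i - 1) (j + 1) k))
      + (if i = 0 then 0 else of_nat (k + 1) * (r * cf \<omega> l (i - 1) j (k + 1)))
      + (if j = 0 then 0 else of_nat (k + 1) * (t * cf \<omega> l i (j - 1) (k + 1))) = 0" for l i j k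
  proof -
    have "cf (lie D \<omega>) l i j k + cf (lie N \<omega>) l i j k = 0"
      using lie by (simp add: lie_add flip: lookup_add vector_add_component)
    then show ?thesis
      using exhaust_3[of l] unfolding D N cf_lie_diag by (auto simp: cf_lie algebra_simps cong: if_cong)
  qed
  have "weight a b c l i j k = 0 \<or> cf \<omega> l i j k = 0" for l i j k
  \<comment> \<open>The potential \<open>?h l + j + 2 * k\<close>, which \<open>N\<close> lowers, is at most \<open>10\<close> on forms of degree three.\<close>
  proof (induction "20 - (?h l + j + 2 * k)" arbitrary: l i j k rule: less_induct)
    case less
    show ?case
    proof (cases "i + j + k = 4")
      case True
      show ?thesis
      proof (rule disjCI)
        assume "cf \<omega> l i j k \<noteq> 0"
        show "weight a b c l i j k = 0"
        proof (rule ccontr)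
          assume w: "weight a b c l i j k \<noteq> 0"
          have up: "cf \<omega> l' i' j' k' = 0"
            if "?h l + j + 2 * k < ?h l' + j' + 2 * k'" "weight a b c l' i' j' k' = weight a b c l i j k" for l' i' j' k'
          proof -
            have "?h l + j + 2 * k < 20" using True by auto
            then have "20 - (?h l' + j' + 2 * k') < 20 - (?h l + j + 2 * k)" using that(1) by linarith
            then show ?thesis using less[of l' j' k' i'] that(2) w by auto
          qed
          have "l = 1 \<Longrightarrow> s * cf \<omega> 2 i j k = 0"
            using up[of 2 j k i] comm(1) by (cases "s = 0") (auto simp: weight_def)
          moreover have "l = 1 \<Longrightarrow> r * cf \<omega> 3 i j k = 0"
            using up[of 3 j k i] comm(3) by (cases "r = 0") (auto simp: weight_def)
          moreover have "l = 2 \<Longrightarrow> t * cf \<omega> 3 i j k = 0"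
            using up[of 3 j k i] comm(2) by (cases "t = 0") (auto simp: weight_def)
          moreover have "i \<noteq> 0 \<Longrightarrow> s * cf \<omega> l (i - 1) (j + 1) k = 0"
            using up[of l "j + 1" k "i - 1"] comm(1) by (cases "s = 0") (auto simp: weight_def of_nat_diff algebra_simps)
          moreover have "i \<noteq> 0 \<Longrightarrow> r * cf \<omega> l (i - 1) j (k + 1) = 0"
            using up[of l j "k + 1" "i - 1"] comm(3) by (cases "r = 0") (auto simp: weight_def of_nat_diff algebra_simps)
          moreover have "j \<noteq> 0 \<Longrightarrow> t * cf \<omega> l i (j - 1) (k + 1) = 0"
            using up[of l "j - 1" "k + 1" i] comm(2) by (cases "t = 0") (auto simp: weight_def of_nat_diff algebra_simps)
          ultimately have "weight a b c l i j k * cf \<omega> l i j k = 0"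
            using eq[of l i j k] by (auto split: if_splits)
          then show False using w \<open>cf \<omega> l i j k \<noteq> 0\<close> by simp
        qed
      qed
    qed (use cf_degree[OF \<omega>] in blast)
  qed
  then show "lie D \<omega> = 0" unfolding D by (simp add: lie_diag_eq_0)
  then show "lie N \<omega> = 0" using lie by (simp add: lie_add)
qed

section \<open>Forms with a nilpotent symmetry of rank one\<close>

text \<open>The form \<open>p (z dx - x dz) + q (x dy - y dx)\<close>.\<close>

definition pq_form :: "3 cpoly \<Rightarrow> 3 cpoly \<Rightarrow> 3 form" where
  "pq_form p q = vector [Var 3 * p - Var 2 * q, Var 1 * q, - (Var 1 * p)]"

definition cubic :: "complex \<Rightarrow> complex \<Rightarrow> complex \<Rightarrow> complex \<Rightarrow> 3 cpoly" where
  "cubic p0 p1 p2 p3 = Poly_Mapping.single (mon 3 0 0) p0 + Poly_Mapping.single (mon 2 1 0) p1 +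
     Poly_Mapping.single (mon 1 2 0) p2 + Poly_Mapping.single (mon 0 3 0) p3"

abbreviation E31 :: "complex^3^3" where "E31 \<equiv> m3 0 0 0 0 0 0 1 0 0"

lemma pq_form_nth [simp]:
  "pq_form p q $ 1 = Var 3 * p - Var 2 * q" "pq_form p q $ 2 = Var 1 * q" "pq_form p q $ 3 = - (Var 1 * p)"
  by (simp_all add: pq_form_def vector_3)

lemma coeff_cubic:
  "coeff_at (cubic p0 p1 p2 p3) i j k =
    (if k \<noteq> 0 then 0 else if i = 3 \<and> j = 0 then p0 else if i = 2 \<and> j = 1 then p1
     else if i = 1 \<and> j = 2 then p2 else if i = 0 \<and> j = 3 then p3 else 0)"
  by (auto simp: cubic_def lookup_add lookup_single_mon)

lemma homogeneous_single: "mdeg m = n \<Longrightarrow> homogeneous n (Poly_Mapping.single m c)"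
  by (auto simp: homogeneous_def split: if_splits)

lemma homogeneous_cubic: "homogeneous 3 (cubic p0 p1 p2 p3)"
  unfolding cubic_def by (intro homogeneous_add homogeneous_single) (simp_all add: mdeg_mon)

lemma twisted_pq_form:
  assumes "homogeneous 3 p" "homogeneous 3 q"
  shows "pq_form p q \<in> twisted_forms 3"
proof -
  have "homogeneous 4 (Var v * r)" if "homogeneous 3 r" for v and r :: "3 cpoly"
    using homogeneous_mult[OF homogeneous_Var that, of v] by simp
  then show ?thesis
    using assms by (simp add: twisted_forms_def forall_3 sum_3 homogeneous_diff homogeneous_minus algebra_simps)
qed

text \<open>Invariance under \<open>z \<mapsto> z + t x\<close> leaves only the coefficients of degree at most one in \<open>z\<close> and \<open>dz\<close>, and relates
  those of \<open>z dx\<close> to those of \<open>x dz\<close>; tangency to the radial field relates the others.\<close>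

lemma E31_symmetric_form:
  assumes \<omega>: "\<omega> \<in> twisted_forms 3" and lie: "lie E31 \<omega> = 0"
  shows "\<omega> = pq_form (cubic (cf \<omega> 1 3 0 1) (cf \<omega> 1 2 1 1) (cf \<omega> 1 1 2 1) (cf \<omega> 1 0 3 1))
    (cubic (cf \<omega> 2 4 0 0) (cf \<omega> 2 3 1 0) (cf \<omega> 2 2 2 0) (cf \<omega> 2 1 3 0))"
proof -
  have L: "(if l = 1 then cf \<omega> 3 i j k else 0) + (if i = 0 then 0 else of_nat (k + 1) * cf \<omega> l (i - 1) j (k + 1)) = 0" for l i j k
  proof -
    have "cf (lie E31 \<omega>) l i j k = 0" using lie by simp
    then show ?thesis
      using exhaust_3[of l] by (auto simp: cf_lie cong: if_cong)
  qed
  have z2: "cf \<omega> 2 i j k = 0" if "k \<noteq> 0" for i j k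
    using L[of 2 "i + 1" j "k - 1"] that by (simp del: of_nat_Suc)
  have z3: "cf \<omega> 3 i j k = 0" if "k \<noteq> 0" for i j k
    using L[of 3 "i + 1" j "k - 1"] that by (simp del: of_nat_Suc)
  have r3: "cf \<omega> 3 i j k = - of_nat (k + 1) * cf \<omega> 1 (i - 1) j (k + 1)" if "i \<noteq> 0" for i j k
    using L[of 1 i j k] that by (simp add: eq_neg_iff_add_eq_0 del: of_nat_Suc)
  have r30: "cf \<omega> 3 i j 0 = - cf \<omega> 1 (i - 1) j 1" if "i \<noteq> 0" for i j
    using r3[of i j 0] that by simp
  have z30: "cf \<omega> 3 0 j k = 0" for j k
    using L[of 1 0 j k] by simp
  have z1: "cf \<omega> 1 i j k = 0" if "2 \<le> k" for i j k
    using r3[of "i + 1" j "k - 1"] z3[of "k - 1" "i + 1" j] that by (simp del: of_nat_Suc)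
  have T: "(if i = 0 then 0 else cf \<omega> 1 (i - 1) j 0) + (if j = 0 then 0 else cf \<omega> 2 i (j - 1) 0) = 0" for i j
    using cf_tangency[OF \<omega>, of i j 0] by simp
  have a1: "cf \<omega> 1 i j 0 = - cf \<omega> 2 (i + 1) (j - 1) 0" if "j \<noteq> 0" for i j
    using T[of "i + 1" j] that by (simp add: eq_neg_iff_add_eq_0)
  have a10: "cf \<omega> 1 i 0 0 = 0" for i
    using T[of "i + 1" 0] by simp
  have z20: "cf \<omega> 2 0 j 0 = 0" for j
    using T[of 0 "j + 1"] by simp
  note facts = z2 z3 r30 z30 z1 a1 a10 z20 lookup_minus coeff_Var_mult coeff_cubic
  let ?\<eta> = "pq_form (cubic (cf \<omega> 1 3 0 1) (cf \<omega> 1 2 1 1) (cf \<omega> 1 1 2 1) (cf \<omega> 1 0 3 1))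
    (cubic (cf \<omega> 2 4 0 0) (cf \<omega> 2 3 1 0) (cf \<omega> 2 2 2 0) (cf \<omega> 2 1 3 0))"
  have hom: "homogeneous 4 (\<omega> $ l)" "homogeneous 4 (?\<eta> $ l)" for l
    using \<omega> twisted_pq_form[OF homogeneous_cubic homogeneous_cubic] by (auto simp: twisted_forms_def)
  show ?thesis
    unfolding vec_eq_iff forall_3
    by (intro conjI homogeneous_4_eqI hom) (simp_all add: facts flip: numeral_2_eq_2)
qed

lemma cubic_0: "cubic 0 0 0 0 = 0"
  by (simp add: cubic_def)

text \<open>If \<open>p\<close> or \<open>q\<close> is zero, the other one is a common factor. If neither contains the cube of a variable, the other
  variable is a common factor.\<close>

lemma pq_form_nondegenerate:
  assumes f: "foliation_form (pq_form (cubic p0 p1 p2 p3) (cubic q0 q1 q2 q3))"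
  shows "p0 \<noteq> 0 \<or> p1 \<noteq> 0 \<or> p2 \<noteq> 0 \<or> p3 \<noteq> 0" "q0 \<noteq> 0 \<or> q1 \<noteq> 0 \<or> q2 \<noteq> 0 \<or> q3 \<noteq> 0"
    "p3 \<noteq> 0 \<or> q3 \<noteq> 0" "p0 \<noteq> 0 \<or> q0 \<noteq> 0"
proof -
  let ?p = "cubic p0 p1 p2 p3" and ?q = "cubic q0 q1 q2 q3"
  have not_unit_cubic: "\<not> cubic a b c d dvd 1" for a b c d
    using homogeneous_eval_0[OF homogeneous_cubic] by (intro not_unit[of "\<lambda>_. 0"]) simp
  have no_common: "\<not> (\<forall>l. r dvd pq_form ?p ?q $ l)" if "\<not> r dvd 1" for r
    using f that by (auto simp: foliation_form_def no_common_factor_def)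
  show "p0 \<noteq> 0 \<or> p1 \<noteq> 0 \<or> p2 \<noteq> 0 \<or> p3 \<noteq> 0"
  proof (rule ccontr)
    assume "\<not> ?thesis"
    then have "?p = 0" by (simp add: cubic_0)
    then have "\<forall>l. ?q dvd pq_form ?p ?q $ l" by (simp add: forall_3)
    then show False using no_common[OF not_unit_cubic] by blast
  qed
  show "q0 \<noteq> 0 \<or> q1 \<noteq> 0 \<or> q2 \<noteq> 0 \<or> q3 \<noteq> 0"
  proof (rule ccontr)
    assume "\<not> ?thesis"
    then have "?q = 0" by (simp add: cubic_0)
    then have "\<forall>l. ?p dvd pq_form ?p ?q $ l" by (simp add: forall_3)
    then show False using no_common[OF not_unit_cubic] by blast
  qed
  obtain l j k where "cf (pq_form ?p ?q) l 0 j k \<noteq> 0" using not_divisible(1)[OF f] by blast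
  then show "p3 \<noteq> 0 \<or> q3 \<noteq> 0"
    using exhaust_3[of l] by (auto simp: lookup_minus coeff_Var_mult coeff_cubic split: if_splits)
  obtain l i k where "cf (pq_form ?p ?q) l i 0 k \<noteq> 0" using not_divisible(2)[OF f] by blast
  then show "p0 \<noteq> 0 \<or> q0 \<noteq> 0"
    using exhaust_3[of l] by (auto simp: lookup_minus coeff_Var_mult coeff_cubic split: if_splits)
qed

text \<open>With a further diagonal symmetry the two binary cubics are monomials, and being coprime they are
  the cubes of the two variables.\<close>

lemma E31_diagonal_case:
  assumes f: "foliation_form \<omega>" and E: "lie E31 \<omega> = 0" and D: "lie (diag3 a b c) \<omega> = 0"
    and nz: "diag3 a b c \<noteq> 0"
  shows "\<exists>p q. p \<noteq> 0 \<and> q \<noteq> 0 \<and> (\<omega> = pq_form (cubic 0 0 0 p) (cubic q 0 0 0) \<or>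
     \<omega> = pq_form (cubic p 0 0 0) (cubic 0 0 0 q))"
proof -
  obtain p0 p1 p2 p3 q0 q1 q2 q3 where \<omega>: "\<omega> = pq_form (cubic p0 p1 p2 p3) (cubic q0 q1 q2 q3)"
    using E31_symmetric_form[OF _ E] f unfolding foliation_form_def by blast
  note nd = pq_form_nondegenerate[OF f[unfolded \<omega>]]
  have W: "weight a b c l i j k = 0 \<or> cf \<omega> l i j k = 0" for l i j k
    using D by (simp add: lie_diag_eq_0)
  have p: "4 * a + c = 0 \<or> p0 = 0" "3 * a + b + c = 0 \<or> p1 = 0" "2 * a + 2 * b + c = 0 \<or> p2 = 0" "a + 3 * b + c = 0 \<or> p3 = 0"
    using W[of 1 3 0 1] W[of 1 2 1 1] W[of 1 1 2 1] W[of 1 0 3 1]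
    by (simp_all add: \<omega> weight_def lookup_minus coeff_Var_mult coeff_cubic algebra_simps)
  have q: "4 * a + b = 0 \<or> q0 = 0" "3 * a + 2 * b = 0 \<or> q1 = 0" "2 * a + 3 * b = 0 \<or> q2 = 0" "a + 4 * b = 0 \<or> q3 = 0"
    using W[of 2 4 0 0] W[of 2 3 1 0] W[of 2 2 2 0] W[of 2 1 3 0]
    by (simp_all add: \<omega> weight_def coeff_Var_mult coeff_cubic algebra_simps)
  have ab: "a \<noteq> b"
  proof
    assume "a = b"
    then have "5 * a = 0" "4 * a + c = 0" using p q nd(1,2) by (auto simp: algebra_simps)
    then show False using \<open>a = b\<close> nz by (simp add: vec_eq_iff forall_3)
  qed
  have only: "u = v" if "a * of_nat u + b * of_nat (n - u) + e = 0" "a * of_nat v + b * of_nat (n - v) + e = 0"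
    "u \<le> n" "v \<le> n" for u v n e
  proof -
    have "(a - b) * (of_nat u - of_nat v) =
        (a * of_nat u + b * of_nat (n - u) + e) - (a * of_nat v + b * of_nat (n - v) + e)"
      using that(3,4) by (simp add: of_nat_diff algebra_simps)
    also have "\<dots> = 0" using that(1,2) by simp
    finally have "(a - b) * (of_nat u - of_nat v) = 0" .
    then show ?thesis using ab by simp
  qed
  have P: "p0 \<noteq> 0 \<Longrightarrow> p1 = 0 \<and> p2 = 0 \<and> p3 = 0" "p3 \<noteq> 0 \<Longrightarrow> p0 = 0 \<and> p1 = 0 \<and> p2 = 0"
    using p only[of 4 4 c 3] only[of 4 4 c 2] only[of 4 4 c 1] only[of 1 4 c 2] only[of 1 4 c 3]
    by (auto simp: algebra_simps)
  have Q: "q0 \<noteq> 0 \<Longrightarrow> q1 = 0 \<and> q2 = 0 \<and> q3 = 0" "q3 \<noteq> 0 \<Longrightarrow> q0 = 0 \<and> q1 = 0 \<and> q2 = 0"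
    using q only[of 4 5 0 3] only[of 4 5 0 2] only[of 4 5 0 1] only[of 1 5 0 2] only[of 1 5 0 3]
    by (auto simp: algebra_simps)
  show ?thesis using nd(3,4) P Q \<omega> by metis
qed

text \<open>Otherwise the first variable divides both cubics, or \<open>p = 0\<close>.\<close>

lemma E31_nilpotent_case:
  assumes f: "foliation_form \<omega>" and E: "lie E31 \<omega> = 0" and N: "lie (m3 0 0 0 s 0 0 0 t 0) \<omega> = 0"
  shows "s = 0" "t = 0"
proof -
  obtain p0 p1 p2 p3 q0 q1 q2 q3 where \<omega>: "\<omega> = pq_form (cubic p0 p1 p2 p3) (cubic q0 q1 q2 q3)"
    using E31_symmetric_form[OF _ E] f unfolding foliation_form_def by blast
  note nd = pq_form_nondegenerate[OF f[unfolded \<omega>]]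
  have L: "cf (lie (m3 0 0 0 s 0 0 0 t 0) \<omega>) l i j k = 0" for l i j k
    using N by simp
  note cs = cf_lie \<omega> lookup_minus coeff_Var_mult coeff_cubic
  have p: "s * p1 = 0" "s * p2 = 0" "s * p3 = 0"
    using L[of 1 3 0 1] L[of 1 2 1 1] L[of 1 1 2 1] by (auto simp: cs)
  have q: "3 * (s * q3) = t * p2" "t * p0 = s * q1" "t * p1 = 2 * (s * q2)" "t * p3 = 0"
    using L[of 2 2 2 0] L[of 2 4 0 0] L[of 2 3 1 0] L[of 2 1 3 0] by (auto simp: cs algebra_simps)
  show "s = 0"
  proof (rule ccontr)
    assume "s \<noteq> 0"
    then show False using p q nd(3) by auto
  qed
  then show "t = 0" using q nd(1) by auto
qed


section \<open>A regular nilpotent symmetry together with a diagonal one\<close>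

abbreviation J3 :: "complex^3^3" where "J3 \<equiv> m3 0 0 0 1 0 0 0 1 0"

text \<open>The coefficients of the form have constant weight \<open>e\<close> under \<open>diag3 1 0 (-1)\<close>. If \<open>e \<ge> 2\<close> then the
  form is divisible by the first variable, and if \<open>e \<le> -2\<close> by the third. The symmetry \<open>J3\<close> leaves no form
  of weight \<open>0\<close> or \<open>-1\<close>, and in weight \<open>1\<close> only multiples of the invariant quadratic form.\<close>

lemma no_J3_diagonal:
  assumes f: "foliation_form \<omega>" and J: "lie J3 \<omega> = 0" and D: "lie (diag3 (d + c) d (d - c)) \<omega> = 0"
  shows "c = 0"
proof (rule ccontr)
  assume c: "c \<noteq> 0"
  have \<omega>: "\<omega> \<in> twisted_forms 3" using f by (simp add: foliation_form_def)
  let ?e = "\<lambda>l :: 3. if l = 1 then 1 else if l = 2 then 0 else - 1 :: int"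
  have wt: "of_int (int i - int k + ?e l) = - (5 * d / c)" if "cf \<omega> l i j k \<noteq> 0" for l i j k
  proof -
    have "i + j + k = 4" using that cf_degree[OF \<omega>] by blast
    then have "of_nat i + of_nat j + of_nat k = (4 :: complex)" by (metis of_nat_add of_nat_numeral)
    then have j: "of_nat j = 4 - of_nat i - (of_nat k :: complex)" by (simp add: algebra_simps)
    have "weight (d + c) d (d - c) l i j k = 0"
      using D that by (auto simp: lie_diag_eq_0)
    then have "c * of_int (int i - int k + ?e l) = - (5 * d)"
      using exhaust_3[of l] by (auto simp: weight_def j algebra_simps)
    then show ?thesis using c by (simp add: field_simps)
  qed
  obtain l1 j1 k1 where x: "cf \<omega> l1 0 j1 k1 \<noteq> 0" using not_divisible(1)[OF f] by blast
  obtain l2 i2 j2 where z: "cf \<omega> l2 i2 j2 0 \<noteq> 0" using not_divisible(3)[OF f] by blast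
  define e where "e = int 0 - int k1 + ?e l1"
  have e: "int i - int k + ?e l = e" if "cf \<omega> l i j k \<noteq> 0" for l i j k
  proof -
    have "(of_int (int i - int k + ?e l) :: complex) = of_int e"
      using wt[OF that] wt[OF x] unfolding e_def by simp
    then show ?thesis unfolding of_int_eq_iff .
  qed
  have "e \<le> 1" by (auto simp: e_def)
  moreover have "- 1 \<le> e" using e[OF z] by (auto split: if_splits)
  ultimately have e3: "e = 1 \<or> e = 0 \<or> e = - 1" by auto
  have zero: "cf \<omega> l i j k = 0" if "int i - int k + ?e l \<noteq> e \<or> i + j + k \<noteq> 4" for l i j k
    using e cf_degree[OF \<omega>] that by blast
  have L: "(if l = 1 then cf \<omega> 2 i j k else if l = 2 then cf \<omega> 3 i j k else 0)
      + (if i = 0 then 0 else of_nat (j + 1) * cf \<omega> l (i - 1) (j + 1) k)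
      + (if j = 0 then 0 else of_nat (k + 1) * cf \<omega> l i (j - 1) (k + 1)) = 0" for l i j k
  proof -
    have "cf (lie J3 \<omega>) l i j k = 0" using J by simp
    then show ?thesis using exhaust_3[of l] by (auto simp: cf_lie cong: if_cong)
  qed
  note T = cf_tangency[OF \<omega>]
  consider "e = 1" | "e = 0" | "e = - 1" using e3 by blast
  then show False
  proof cases
    case 1
    have z1: "cf \<omega> 1 i j k = 0" if "i \<noteq> k" for i j k using zero[of i k 1 j] that 1 by simp
    have z2: "cf \<omega> 2 i j k = 0" if "i \<noteq> Suc k" for i j k using zero[of i k 2 j] that 1 by simp
    have z3: "cf \<omega> 3 i j k = 0" if "i \<noteq> Suc (Suc k)" for i j k using zero[of i k 3 j] that 1 by simp
    define g where "g = cf \<omega> 3 2 2 0"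
    have c301: "cf \<omega> 3 3 0 1 = - 2 * g"
      using L[of 3 3 1 0] by (simp add: g_def eq_neg_iff_add_eq_0 algebra_simps flip: numeral_2_eq_2)
    have b211: "cf \<omega> 2 2 1 1 = 2 * g"
    proof -
      have "cf \<omega> 2 2 1 1 + cf \<omega> 3 3 0 1 = 0" using L[of 2 3 0 1] by (simp add: add.commute)
      then show ?thesis using c301 by algebra
    qed
    have a202: "cf \<omega> 1 2 0 2 = 2 * g"
      using T[of 3 0 2] c301 by (simp add: algebra_simps)
    have a121: "cf \<omega> 1 1 2 1 = - 3 * g"
      using T[of 2 2 1] b211 by (simp add: g_def algebra_simps eq_neg_iff_add_eq_0)
    have "3 * cf \<omega> 2 1 3 0 + 3 * g = 0"
      using L[of 2 2 2 0] b211 by (simp add: g_def algebra_simps flip: numeral_3_eq_3)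
    then have b130: "cf \<omega> 2 1 3 0 = - g" by algebra
    have a040: "cf \<omega> 1 0 4 0 = g"
      using T[of 1 4 0] b130 by simp
    \<comment> \<open>\<open>?Q\<close> is the quadratic form \<open>y\<^sup>2 - 2 x z\<close> annihilated by \<open>J3\<close>.\<close>
    let ?s = "\<lambda>i j k (c :: complex). Poly_Mapping.single (mon i j k) c"
    let ?Q = "?s 0 2 0 1 + ?s 1 0 1 (- 2)"
    have mm: "?s i j k u * ?s i' j' k' v = ?s (i + i') (j + j') (k + k') (u * v)" for i j k i' j' k' u v
    proof -
      have "mon i j k + mon i' j' k' = mon (i + i') (j + j') (k + k')"
        by (rule exponent_eqI) (simp_all add: lookup_add)
      then show ?thesis by (simp add: mult_single)
    qed
    have hQ: "homogeneous 2 ?Q" by (intro homogeneous_add homogeneous_single) (simp_all add: mdeg_mon)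
    have hr: "homogeneous 4 (?Q * r)" if "homogeneous 2 r" for r
      using homogeneous_mult[OF hQ that] by simp
    have h\<omega>: "homogeneous 4 (\<omega> $ l)" for l using \<omega> by (simp add: twisted_forms_def)
    have h2: "homogeneous 2 (?s i j k u)" if "i + j + k = 2" for i j k u
      using that by (intro homogeneous_single) (simp add: mdeg_mon)
    note cs = z1 z2 z3 a040 a121 a202 b130 b211 c301 lookup_add lookup_single_mon mm distrib_left distrib_right g_def[symmetric]
    have w1: "\<omega> $ 1 = ?Q * (?s 0 2 0 g + ?s 1 0 1 (- g))"
      by (intro homogeneous_4_eqI h\<omega> hr homogeneous_add h2) (simp_all add: cs del: One_nat_def)
    have w2: "\<omega> $ 2 = ?Q * ?s 1 1 0 (- g)"
      by (intro homogeneous_4_eqI h\<omega> hr homogeneous_add h2) (simp_all add: cs del: One_nat_def)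
    have w3: "\<omega> $ 3 = ?Q * ?s 2 0 0 g"
      by (intro homogeneous_4_eqI h\<omega> hr homogeneous_add h2) (simp_all add: cs del: One_nat_def)
    have "\<forall>l. ?Q dvd \<omega> $ l" unfolding forall_3 w1 w2 w3 by (intro conjI dvd_triv_left)
    then have "?Q dvd 1" using f unfolding foliation_form_def no_common_factor_def by blast
    then show False using not_unit[OF homogeneous_eval_0[OF hQ]] by simp
  next
    case 2
    have c211: "cf \<omega> 3 2 1 1 = 0" using L[of 3 3 0 1] by (simp flip: numeral_2_eq_2)
    have c130: "cf \<omega> 3 1 3 0 = 0" using L[of 3 2 2 0] c211 by (simp flip: numeral_2_eq_2)
    have b040: "cf \<omega> 2 0 4 0 = 0" using T[of 0 5 0] by (simp flip: numeral_2_eq_2)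
    have a031: "cf \<omega> 1 0 3 1 = 0" using L[of 1 0 4 0] b040 by (simp flip: numeral_2_eq_2)
    have b121: "cf \<omega> 2 1 2 1 = 0" using T[of 1 3 1] a031 c130 by (simp flip: numeral_2_eq_2)
    have b202: "cf \<omega> 2 2 0 2 = 0" using L[of 2 2 1 1] b121 c211 by (simp flip: numeral_2_eq_2)
    have a112: "cf \<omega> 1 1 1 2 = 0" using T[of 2 1 2] c211 b202 by (simp flip: numeral_2_eq_2)
    have eq: "int 0 - int k1 + ?e l1 = 0" using e[OF x] 2 by (simp only:)
    have "j1 + k1 = 4" using x cf_degree[OF \<omega>, of 0 j1 k1 l1] by auto
    then have "(l1, j1, k1) \<in> {(1, 3, 1), (2, 4, 0)}" using eq exhaust_3[of l1] by auto
    then show False using x a031 b040 by auto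
  next
    case 3
    have c121: "cf \<omega> 3 1 2 1 = - 4 * cf \<omega> 3 0 4 0" using L[of 3 1 3 0] by (simp add: eq_neg_iff_add_eq_0 algebra_simps flip: numeral_2_eq_2)
    have c202: "cf \<omega> 3 2 0 2 = 4 * cf \<omega> 3 0 4 0" using L[of 3 2 1 1] c121 by (simp add: algebra_simps flip: numeral_2_eq_2)
    have b031: "cf \<omega> 2 0 3 1 = - cf \<omega> 3 0 4 0" using T[of 0 4 1] by (simp add: eq_neg_iff_add_eq_0 flip: numeral_2_eq_2)
    have b112: "cf \<omega> 2 1 1 2 = - 4 * cf \<omega> 3 0 4 0" using L[of 2 2 0 2] c202 by (simp add: eq_neg_iff_add_eq_0 add.commute flip: numeral_2_eq_2)
    have c040: "cf \<omega> 3 0 4 0 = 0" using L[of 2 1 2 1] b031 b112 c121 by (simp add: algebra_simps flip: numeral_2_eq_2)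
    have a022: "cf \<omega> 1 0 2 2 = 0" using L[of 1 0 3 1] b031 c040 by (simp flip: numeral_2_eq_2)
    have eq: "int 0 - int k1 + ?e l1 = - 1" using e[OF x] 3 by (simp only:)
    have "j1 + k1 = 4" using x cf_degree[OF \<omega>, of 0 j1 k1 l1] by auto
    then have "(l1, j1, k1) \<in> {(1, 2, 2), (2, 3, 1), (3, 4, 0)}" using eq exhaust_3[of l1] by auto
    then show False using x a022 b031 c040 by auto
  qed
qed

section \<open>Normal forms of symmetries\<close>

lemma m3_cases: "\<exists>a b c d e f g h i. X = m3 a b c d e f g h i"
proof -
  have "X = m3 (X $ 1 $ 1) (X $ 1 $ 2) (X $ 1 $ 3) (X $ 2 $ 1) (X $ 2 $ 2) (X $ 2 $ 3) (X $ 3 $ 1) (X $ 3 $ 2) (X $ 3 $ 3)"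
    by (simp add: vec_eq_iff forall_3)
  then show ?thesis by blast
qed

lemma m3_eq_iff: "m3 a b c d e f g h i = m3 a' b' c' d' e' f' g' h' i' \<longleftrightarrow>
    a = a' \<and> b = b' \<and> c = c' \<and> d = d' \<and> e = e' \<and> f = f' \<and> g = g' \<and> h = h' \<and> i = i'"
  by (auto simp: vec_eq_iff forall_3)

lemma m3_mult: "m3 a b c d e f g h i ** m3 a' b' c' d' e' f' g' h' i' =
   m3 (a * a' + b * d' + c * g') (a * b' + b * e' + c * h') (a * c' + b * f' + c * i')
      (d * a' + e * d' + f * g') (d * b' + e * e' + f * h') (d * c' + e * f' + f * i')
      (g * a' + h * d' + i * g') (g * b' + h * e' + i * h') (g * c' + h * f' + i * i')"
  by (simp add: vec_eq_iff forall_3 matrix_matrix_mult_def sum_3)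

lemma m3_add: "m3 a b c d e f g h i + m3 a' b' c' d' e' f' g' h' i' =
   m3 (a + a') (b + b') (c + c') (d + d') (e + e') (f + f') (g + g') (h + h') (i + i')"
  by (simp add: vec_eq_iff forall_3)

lemma m3_diff: "m3 a b c d e f g h i - m3 a' b' c' d' e' f' g' h' i' =
   m3 (a - a') (b - b') (c - c') (d - d') (e - e') (f - f') (g - g') (h - h') (i - i')"
  by (simp add: vec_eq_iff forall_3)

lemma smul_m3: "smul u (m3 a b c d e f g h i) = m3 (u * a) (u * b) (u * c) (u * d) (u * e) (u * f) (u * g) (u * h) (u * i)"
  by (simp add: vec_eq_iff forall_3)

lemma mat_m3: "mat u = diag3 u u u"
  by (simp add: vec_eq_iff forall_3 mat_def)

lemma zero_m3: "0 = diag3 0 0 0"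
  by (simp add: vec_eq_iff forall_3)

lemmas m3_simps = m3_mult m3_add m3_diff smul_m3 m3_eq_iff

lemma det_m3: "det (m3 a b c d e f g h i) = a * e * i + b * f * g + c * d * h - a * f * h - b * d * i - c * e * g"
  by (simp add: det_3)

lemma right_inverse_exists: "det P \<noteq> 0 \<Longrightarrow> \<exists>Q. P ** Q = mat 1" for P :: "complex^3^3"
  by (auto simp: invertible_det_nz[symmetric] invertible_def)

lemma foliation_form_pullback: "foliation_form \<omega> \<Longrightarrow> P ** Q = mat 1 \<Longrightarrow> foliation_form (pullback P \<omega>)"
  by (simp add: foliation_form_def pullback_twisted pullback_no_common_factor)

lemma lie_pullback_eq_0: "lie Y \<omega> = 0 \<Longrightarrow> P ** X = Y ** P \<Longrightarrow> lie X (pullback P \<omega>) = 0"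
  by (simp add: lie_pullback)

lemma lie_commutator:
  assumes "lie A \<omega> = 0" "lie B \<omega> = 0"
  shows "lie (A ** B - B ** A) \<omega> = 0"
proof -
  have "lie X 0 = 0" for X by (simp add: vec_eq_iff lie_nth)
  then show ?thesis using lie_bracket[of B A \<omega>] assms by simp
qed

lemma lie_smul_eq_0: "lie X \<omega> = 0 \<Longrightarrow> lie (smul c X) \<omega> = 0"
  by (simp add: lie_smul)

text \<open>This says that the stabiliser has dimension at least two.\<close>

definition big_stabiliser :: "3 form \<Rightarrow> bool" where
  "big_stabiliser \<omega> \<longleftrightarrow> (\<forall>N. \<exists>X. lie X \<omega> = 0 \<and> (\<forall>c. X \<noteq> smul c N))"

definition normalizable :: "3 form \<Rightarrow> bool" where
  "normalizable \<omega> \<longleftrightarrow> (\<exists>P p q. invertible P \<and> p \<noteq> 0 \<and> q \<noteq> 0 \<and>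
     (pullback P \<omega> = pq_form (cubic 0 0 0 p) (cubic q 0 0 0) \<or>
      pullback P \<omega> = pq_form (cubic p 0 0 0) (cubic 0 0 0 q)))"

lemma matrix_mult_smul: "A ** smul c B = smul c (A ** B)" "smul c A ** B = smul c (A ** B)"
  by (simp_all add: vec_eq_iff forall_3 matrix_matrix_mult_def sum_3 algebra_simps)

lemma conjugation_compose:
  "P ** A = B ** P \<Longrightarrow> U ** C = A ** U \<Longrightarrow> (P ** U) ** C = B ** (P ** U)"
  for P A B C U :: "complex^3^3"
  by (metis matrix_mul_assoc)

lemma big_stabiliser_pullback:
  assumes "big_stabiliser \<omega>" and PQ: "P ** Q = mat 1"
  shows "big_stabiliser (pullback P \<omega>)"
  unfolding big_stabiliser_def
proof
  fix N
  have QP: "Q ** P = mat 1" using PQ matrix_left_right_inverse by blast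
  obtain X where X: "lie X \<omega> = 0" "\<And>c. X \<noteq> smul c (P ** N ** Q)"
    using assms(1) unfolding big_stabiliser_def by blast
  have "P ** (Q ** X ** P) = X ** P"
    using PQ by (simp add: matrix_mul_assoc)
  then have "lie (Q ** X ** P) (pullback P \<omega>) = 0" using lie_pullback_eq_0[OF X(1)] by blast
  moreover have "Q ** X ** P \<noteq> smul c N" for c
  proof
    assume *: "Q ** X ** P = smul c N"
    have "X = (P ** Q) ** X ** (P ** Q)" using PQ by simp
    also have "\<dots> = P ** (Q ** X ** P) ** Q" by (simp add: matrix_mul_assoc)
    also have "\<dots> = smul c (P ** N ** Q)" by (simp only: * matrix_mult_smul)
    finally show False using X(2) by blast
  qed
  ultimately show "\<exists>X. lie X (pullback P \<omega>) = 0 \<and> (\<forall>c. X \<noteq> smul c N)" by blast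
qed

lemma normalizable_pullback:
  assumes "normalizable (pullback P \<omega>)" "P ** Q = mat 1"
  shows "normalizable \<omega>"
proof -
  have "invertible P" using assms(2) matrix_left_right_inverse unfolding invertible_def by blast
  then show ?thesis
    using assms(1) unfolding normalizable_def pullback_pullback by (meson invertible_mult)
qed

text \<open>If a nilpotent \<open>N\<close> does not span the stabiliser, the last element outside its span in the sequence
  \<open>X, [N, X], [N, [N, X]], \<dots>\<close> normalises the span.\<close>

lemma normaliser_exists:
  assumes N: "lie N \<omega> = 0" and X: "lie X \<omega> = 0" "\<And>c. X \<noteq> smul c N"
    and nil: "((\<lambda>Y. N ** Y - Y ** N) ^^ n) X = 0"
  shows "\<exists>Y c. lie Y \<omega> = 0 \<and> (\<forall>c. Y \<noteq> smul c N) \<and> N ** Y - Y ** N = smul c N"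
proof -
  let ?a = "\<lambda>k. ((\<lambda>Y. N ** Y - Y ** N) ^^ k) X"
  let ?P = "\<lambda>k. \<exists>c. ?a k = smul c N"
  have lie: "lie (?a k) \<omega> = 0" for k
    by (induction k) (simp_all add: X(1) lie_commutator[OF N])
  have "0 = smul 0 N" by (simp add: vec_eq_iff)
  then have "?P n" using nil by metis
  then obtain k where k: "?P k" "\<forall>j<k. \<not> ?P j"
    using exists_least_iff[of ?P] by blast
  have "k \<noteq> 0"
  proof
    assume "k = 0"
    then show False using k(1) X(2) by auto
  qed
  then obtain j where j: "k = Suc j" using not0_implies_Suc by blast
  then obtain c where "N ** ?a j - ?a j ** N = smul c N" using k(1) by auto
  moreover have "\<forall>c. ?a j \<noteq> smul c N" using k(2) j by blast
  ultimately show ?thesis using lie by blast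
qed

text \<open>Conjugation with a unipotent matrix clears the entries between different eigenvalues, so that the diagonal and
  the strictly lower triangular part commute.\<close>

lemma lower_triangular_split:
  assumes Y: "Y = m3 a 0 0 y1 b 0 y2 y3 c"
  shows "\<exists>u v w s t r. Y ** m3 1 0 0 u 1 0 w v 1 = m3 1 0 0 u 1 0 w v 1 ** (diag3 a b c + m3 0 0 0 s 0 0 r t 0) \<and>
    (s \<noteq> 0 \<longrightarrow> a = b) \<and> (t \<noteq> 0 \<longrightarrow> b = c) \<and> (r \<noteq> 0 \<longrightarrow> a = c)"
proof -
  obtain u s where us: "s = y1 + (b - a) * u" "s \<noteq> 0 \<longrightarrow> a = b"
  proof (cases "a = b")
    case False
    then show ?thesis by (intro that[of 0 "y1 / (a - b)"]) (simp_all add: field_simps)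
  qed (use that[of y1 0] in simp)
  obtain v t where vt: "t = y3 + (c - b) * v" "t \<noteq> 0 \<longrightarrow> b = c"
  proof (cases "b = c")
    case False
    then show ?thesis by (intro that[of 0 "y3 / (b - c)"]) (simp_all add: field_simps)
  qed (use that[of y3 0] in simp)
  obtain w r where wr: "r = y2 + y3 * u - v * s + (c - a) * w" "r \<noteq> 0 \<longrightarrow> a = c"
  proof (cases "a = c")
    case False
    then show ?thesis by (intro that[of 0 "(y2 + y3 * u - v * s) / (a - c)"]) (simp_all add: field_simps)
  qed (use that[of "y2 + y3 * u - v * s" 0] in simp)
  have "Y ** m3 1 0 0 u 1 0 w v 1 = m3 1 0 0 u 1 0 w v 1 ** (diag3 a b c + m3 0 0 0 s 0 0 r t 0)"
    unfolding Y m3_simps wr(1) us(1) vt(1) by (simp add: ring_distribs)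
  then show ?thesis using us(2) vt(2) wr(2) by blast
qed

lemma lower_unipotent_inverse: "\<exists>Q. m3 1 0 0 u 1 0 w v 1 ** Q = mat 1"
  by (rule right_inverse_exists) (simp add: det_m3)

text \<open>The normaliser of \<open>E31\<close> consists of lower triangular matrices. Up to conjugation that fixes \<open>E31\<close>, a symmetry
  in it has a nonzero diagonal part, which leaves the two models, or a nilpotent part, which is impossible.\<close>

lemma E31_case:
  assumes f: "foliation_form \<omega>" and E: "lie E31 \<omega> = 0" and big: "big_stabiliser \<omega>"
  shows "normalizable \<omega>"
proof -
  obtain X where X: "lie X \<omega> = 0" "\<And>c. X \<noteq> smul c E31"
    using big unfolding big_stabiliser_def by blast
  have "((\<lambda>Y. E31 ** Y - Y ** E31) ^^ 3) X = 0"
    using m3_cases[of X] by (auto simp: numeral_3_eq_3 m3_simps zero_m3)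
  then obtain Y e where Y: "lie Y \<omega> = 0" "\<forall>e. Y \<noteq> smul e E31" "E31 ** Y - Y ** E31 = smul e E31"
    using normaliser_exists[OF E X] by blast
  obtain a y12 y13 y1 b y23 y2 y3 c where "Y = m3 a y12 y13 y1 b y23 y2 y3 c" using m3_cases by blast
  then have Ym: "Y = m3 a 0 0 y1 b 0 y2 y3 c" using Y(3) by (simp add: m3_simps)
  obtain u v w s t r where *: "Y ** m3 1 0 0 u 1 0 w v 1 = m3 1 0 0 u 1 0 w v 1 ** (diag3 a b c + m3 0 0 0 s 0 0 r t 0)"
    "s \<noteq> 0 \<longrightarrow> a = b" "t \<noteq> 0 \<longrightarrow> b = c" "r \<noteq> 0 \<longrightarrow> a = c"
    using lower_triangular_split[OF Ym] by blast
  let ?U = "m3 1 0 0 u 1 0 w v 1"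
  obtain Q where Q: "?U ** Q = mat 1" using lower_unipotent_inverse by blast
  let ?\<eta> = "pullback ?U \<omega>"
  have f': "foliation_form ?\<eta>" using f Q by (rule foliation_form_pullback)
  have E': "lie E31 ?\<eta> = 0" by (rule lie_pullback_eq_0[OF E]) (simp add: m3_simps)
  have DN: "lie (diag3 a b c + m3 0 0 0 s 0 0 r t 0) ?\<eta> = 0"
    by (rule lie_pullback_eq_0[OF Y(1)]) (simp add: *(1))
  have parts: "lie (diag3 a b c) ?\<eta> = 0" "lie (m3 0 0 0 s 0 0 r t 0) ?\<eta> = 0"
    using lie_jordan_parts[OF _ refl refl _ _ _ DN] f' *(2-4) by (auto simp: foliation_form_def)
  show ?thesis
  proof (cases "diag3 a b c = 0")
    case False
    have "normalizable ?\<eta>"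
      using E31_diagonal_case[OF f' E' parts(1) False] unfolding normalizable_def
      by (intro exI[of _ "mat 1"]) (auto simp: pullback_mat invertible_det_nz)
    then show ?thesis using Q by (rule normalizable_pullback)
  next
    case True
    have "lie (m3 0 0 0 s 0 0 r t 0 - smul r E31) ?\<eta> = 0"
      using parts(2) lie_smul_eq_0[OF E'] by (simp add: lie_diff)
    then have "lie (m3 0 0 0 s 0 0 0 t 0) ?\<eta> = 0" by (simp add: m3_simps)
    from E31_nilpotent_case[OF f' E' this] have "s = 0" "t = 0" .
    then have "Y = smul r E31" using *(1) True by (auto simp: Ym m3_simps zero_m3)
    then show ?thesis using Y(2) by blast
  qed
qed

text \<open>Modulo \<open>J3\<close>, the normaliser of \<open>J3\<close> is spanned by the scalars, a diagonal matrix and \<open>J3 ** J3 = E31\<close>. The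
  component along the diagonal matrix vanishes by \<open>no_J3_diagonal\<close>, and then so does the scalar one.\<close>

lemma J3_case:
  assumes f: "foliation_form \<omega>" and J: "lie J3 \<omega> = 0" and big: "big_stabiliser \<omega>"
  shows "normalizable \<omega>"
proof -
  obtain X where X: "lie X \<omega> = 0" "\<And>c. X \<noteq> smul c J3"
    using big unfolding big_stabiliser_def by blast
  have "((\<lambda>Y. J3 ** Y - Y ** J3) ^^ 5) X = 0"
    using m3_cases[of X] by (auto simp: eval_nat_numeral m3_simps zero_m3)
  then obtain Y c where Y: "lie Y \<omega> = 0" "\<forall>e. Y \<noteq> smul e J3" "J3 ** Y - Y ** J3 = smul c J3"
    using normaliser_exists[OF J X] by blast
  obtain y11 y12 y13 \<mu> d y23 \<nu> y32 y33 where Ym: "Y = m3 y11 y12 y13 \<mu> d y23 \<nu> y32 y33" using m3_cases by blast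
  then have ent: "y12 = 0" "y13 = 0" "y23 = 0" "y11 - d = c" "d - y33 = c" "\<mu> - y32 = 0"
    using Y(3) by (simp_all add: m3_simps)
  then have "y11 = d + c" "y33 = d - c" "y32 = \<mu>" by (simp_all add: algebra_simps)
  then have Ym: "Y = m3 (d + c) 0 0 \<mu> d 0 \<nu> \<mu> (d - c)" using Ym ent by simp
  let ?D = "diag3 (d + c) d (d - c)" and ?N = "m3 0 0 0 0 0 0 \<nu> 0 0"
  have "lie (Y - smul \<mu> J3) \<omega> = 0"
    using Y(1) lie_smul_eq_0[OF J] by (simp add: lie_diff)
  then have DN: "lie (?D + ?N) \<omega> = 0" by (simp add: Ym m3_simps)
  show ?thesis
  proof (cases "c = 0")
    case True
    have parts: "lie ?D \<omega> = 0" "lie ?N \<omega> = 0"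
      using lie_jordan_parts[OF _ refl refl _ _ _ DN] f True by (auto simp: foliation_form_def)
    then have "d = 0" using lie_scalar[OF f, of d] True by simp
    then have "\<nu> \<noteq> 0" using Y(2) True by (auto simp: Ym m3_simps)
    then have "smul (1 / \<nu>) ?N = E31" unfolding smul_m3 by simp
    then have "lie E31 \<omega> = 0"
      using lie_smul_eq_0[OF parts(2), of "1 / \<nu>"] by (simp only:)
    then show ?thesis using E31_case f big by blast
  next
    case False
    let ?P = "m3 1 0 0 0 1 0 (\<nu> / (2 * c)) 0 1"
    obtain Q where Q: "?P ** Q = mat 1" using lower_unipotent_inverse[of 0 "\<nu> / (2 * c)" 0] by blast
    have "lie ?D (pullback ?P \<omega>) = 0"
      by (rule lie_pullback_eq_0[OF DN]) (use False in \<open>simp add: m3_simps field_simps\<close>)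
    moreover have "lie J3 (pullback ?P \<omega>) = 0"
      by (rule lie_pullback_eq_0[OF J]) (simp add: m3_simps)
    ultimately have "c = 0" using no_J3_diagonal[OF foliation_form_pullback[OF f Q]] by blast
    then show ?thesis using False by blast
  qed
qed

lemma transfer_case:
  assumes "foliation_form \<omega>" "big_stabiliser \<omega>" "lie Y \<omega> = 0" "det P \<noteq> 0" "P ** X = Y ** P"
    and "\<And>\<eta>. foliation_form \<eta> \<Longrightarrow> big_stabiliser \<eta> \<Longrightarrow> lie X \<eta> = 0 \<Longrightarrow> normalizable \<eta>"
  shows "normalizable \<omega>"
proof -
  obtain Q where Q: "P ** Q = mat 1" using right_inverse_exists[OF assms(4)] by blast
  have "normalizable (pullback P \<omega>)"
    by (rule assms(6)[OF foliation_form_pullback[OF assms(1) Q] big_stabiliser_pullback[OF assms(2) Q]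
          lie_pullback_eq_0[OF assms(3,5)]])
  then show ?thesis using Q by (rule normalizable_pullback)
qed

text \<open>According to its rank the nilpotent matrix is conjugate to \<open>J3\<close> or to \<open>E31\<close>.\<close>

lemma strictly_lower_case:
  assumes f: "foliation_form \<omega>" and N: "lie (m3 0 0 0 s 0 0 r t 0) \<omega> = 0" and big: "big_stabiliser \<omega>"
    and nz: "s \<noteq> 0 \<or> r \<noteq> 0 \<or> t \<noteq> 0"
  shows "normalizable \<omega>"
proof -
  note tr = transfer_case[OF f big N]
  consider "s \<noteq> 0" "t \<noteq> 0" | "s = 0" "t \<noteq> 0" | "t = 0" "s \<noteq> 0" | "s = 0" "t = 0" "r \<noteq> 0" using nz by blast
  then show ?thesis
  proof cases
    case 1
    show ?thesis
      by (rule tr[of "m3 1 0 0 0 s 0 0 r (s * t)" J3]) (use 1 J3_case in \<open>auto simp: det_m3 m3_simps\<close>)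
  next
    case 2
    show ?thesis
      by (rule tr[of "m3 0 t 0 (1 / t) (- r) 0 0 0 1" E31]) (use 2 E31_case in \<open>auto simp: det_m3 m3_simps\<close>)
  next
    case 3
    show ?thesis
      by (rule tr[of "m3 1 0 0 0 0 s 0 1 r" E31]) (use 3 E31_case in \<open>auto simp: det_m3 m3_simps\<close>)
  next
    case 4
    show ?thesis
      by (rule tr[of "m3 1 0 0 0 1 0 0 0 r" E31]) (use 4 E31_case in \<open>auto simp: det_m3 m3_simps\<close>)
  qed
qed

lemma eigenvector_exists:
  fixes X :: "complex^3^3"
  shows "\<exists>\<kappa> v. v \<noteq> 0 \<and> X *v v = \<kappa> *s v"
proof -
  obtain a b c d e f g h i where X: "X = m3 a b c d e f g h i" using m3_cases by blast
  let ?p = "[: a * e * i + b * f * g + c * d * h - a * f * h - b * d * i - c * e * g,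
     - (a * e - b * d + a * i - c * g + e * i - f * h), a + e + i, -1 :]"
  have "\<not> constant (poly ?p)" by (simp add: constant_degree)
  then obtain \<kappa> where "poly ?p \<kappa> = 0" using fundamental_theorem_of_algebra by blast
  moreover have "det (X - mat \<kappa>) = poly ?p \<kappa>"
    by (simp add: X mat_m3 m3_diff det_m3 algebra_simps)
  ultimately have "\<not> invertible (X - mat \<kappa>)" by (simp add: invertible_det_nz)
  then obtain v where v: "v \<noteq> 0" "(X - mat \<kappa>) *v v = 0"
    using matrix_left_invertible_ker[of "X - mat \<kappa>"] invertible_left_inverse[of "X - mat \<kappa>"] by blast
  have "(X - mat \<kappa>) *v v = X *v v - mat \<kappa> *v v" by (rule matrix_vector_mult_diff_rdistrib)
  moreover have "mat \<kappa> *v v = \<kappa> *s v"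
    by (simp add: vec_eq_iff matrix_vector_mult_def mat_def mult_delta_left)
  ultimately show ?thesis using v by (intro exI[of _ \<kappa>] exI[of _ v]) simp
qed

lemma triangular_2x2:
  "\<exists>u. q * u ^ 2 + (p - s) * u - r = (0 :: complex)" if "q \<noteq> 0"
proof -
  have "\<not> constant (poly [: - r, p - s, q :])" using that by (simp add: constant_degree)
  then obtain u where "poly [: - r, p - s, q :] u = 0" using fundamental_theorem_of_algebra by blast
  then show ?thesis by (intro exI[of _ u]) (simp add: algebra_simps power2_eq_square)
qed

text \<open>The conjugating matrix only mixes the first two coordinates.\<close>

lemma triangularise_block:
  "\<exists>P p' r' s' g' h'. det P \<noteq> 0 \<and> P ** m3 p' 0 0 r' s' 0 g' h' i = m3 p q 0 r s 0 g h i ** P \<and>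
     (\<forall>d e. P ** diag3 d d e = diag3 d d e ** P) \<and> (g = 0 \<and> h = 0 \<longrightarrow> g' = 0 \<and> h' = 0)"
proof (cases "q = 0")
  case True
  then show ?thesis
    by (intro exI[of _ "diag3 1 1 1"] exI[of _ p] exI[of _ r] exI[of _ s] exI[of _ g] exI[of _ h]) (simp add: det_m3 m3_simps)
next
  case False
  then obtain u where "q * u ^ 2 + (p - s) * u - r = 0" using triangular_2x2 by blast
  then have u: "r = q * u ^ 2 + (p - s) * u" by simp
  show ?thesis
    by (intro exI[of _ "m3 0 1 0 1 u 0 0 0 1"] exI[of _ "s - u * q"] exI[of _ q] exI[of _ "p + q * u"] exI[of _ h] exI[of _ "g + h * u"])
      (simp add: u det_m3 m3_simps algebra_simps power2_eq_square)
qed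

lemma triangularise:
  fixes X :: "complex^3^3"
  shows "\<exists>P a b c d e f. det P \<noteq> 0 \<and> P ** m3 a 0 0 b c 0 d e f = X ** P"
proof -
  obtain \<kappa> v where v: "v \<noteq> 0" "X *v v = \<kappa> *s v" using eigenvector_exists by blast
  have "v $ 1 \<noteq> 0 \<or> v $ 2 \<noteq> 0 \<or> v $ 3 \<noteq> 0" using v(1) by (auto simp: vec_eq_iff forall_3)
  then obtain P :: "complex^3^3" where P: "det P \<noteq> 0" "P $ 1 $ 3 = v $ 1" "P $ 2 $ 3 = v $ 2" "P $ 3 $ 3 = v $ 3"
    using that[of "m3 0 0 (v $ 1) 1 0 (v $ 2) 0 1 (v $ 3)"] that[of "m3 1 0 (v $ 1) 0 0 (v $ 2) 0 1 (v $ 3)"]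
      that[of "m3 1 0 (v $ 1) 0 1 (v $ 2) 0 0 (v $ 3)"] by (auto simp: det_m3)
  obtain Q where Q: "P ** Q = mat 1" using right_inverse_exists[OF P(1)] by blast
  then have QP: "Q ** P = mat 1" using matrix_left_right_inverse by blast
  have Pv: "P *v axis 3 1 = v"
    using P(2-4) by (simp add: vec_eq_iff forall_3 matrix_vector_mult_def axis_def sum_3)
  have "(Q ** X ** P) *v axis 3 1 = Q *v (X *v (P *v axis 3 1))"
    by (simp add: matrix_vector_mul_assoc matrix_mul_assoc)
  also have "\<dots> = \<kappa> *s (Q *v v)" by (simp add: Pv v(2) vector_scalar_commute)
  also have "Q *v v = (Q ** P) *v axis 3 1" by (simp only: Pv flip: matrix_vector_mul_assoc)
  finally have "(Q ** X ** P) *v axis 3 1 = \<kappa> *s axis 3 1" by (simp add: QP)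
  have col: "(Q ** X ** P) $ i $ 3 = (if i = 3 then \<kappa> else 0)" for i
  proof -
    have "(Q ** X ** P) $ i $ 3 = ((Q ** X ** P) *v axis 3 1) $ i"
      by (simp add: matrix_vector_mult_def axis_def sum_3)
    then show ?thesis using \<open>(Q ** X ** P) *v axis 3 1 = \<kappa> *s axis 3 1\<close> by (simp add: axis_def)
  qed
  obtain p q c1 r s c2 g h i where "Q ** X ** P = m3 p q c1 r s c2 g h i" using m3_cases by blast
  then have T: "Q ** X ** P = m3 p q 0 r s 0 g h i"
    using col[of 1] col[of 2] by simp
  obtain P' p' r' s' g' h' where P': "det P' \<noteq> 0" "P' ** m3 p' 0 0 r' s' 0 g' h' i = m3 p q 0 r s 0 g h i ** P'"
    using triangularise_block[of i p q r s g h] by blast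
  have "P ** m3 p q 0 r s 0 g h i = (P ** Q) ** X ** P"
    by (simp only: matrix_mul_assoc flip: T)
  then have "P ** m3 p q 0 r s 0 g h i = X ** P" by (simp add: Q)
  from conjugation_compose[OF this P'(2)] have "(P ** P') ** m3 p' 0 0 r' s' 0 g' h' i = X ** (P ** P')" .
  moreover have "det (P ** P') \<noteq> 0" using P(1) P'(1) by (simp add: det_mul)
  ultimately show ?thesis by blast
qed

lemma nilpotent_case:
  assumes f: "foliation_form \<omega>" and Z: "lie Z \<omega> = 0" "Z \<noteq> 0" "Z ** Z ** Z = 0" and big: "big_stabiliser \<omega>"
  shows "normalizable \<omega>"
proof -
  obtain P a b c d e k where P: "det P \<noteq> 0" "P ** m3 a 0 0 b c 0 d e k = Z ** P"
    using triangularise by blast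
  let ?T = "m3 a 0 0 b c 0 d e k"
  obtain Q where Q: "P ** Q = mat 1" using right_inverse_exists[OF P(1)] by blast
  then have QP: "Q ** P = mat 1" using matrix_left_right_inverse by blast
  have "P ** (?T ** ?T ** ?T) = P ** ?T ** ?T ** ?T" by (simp only: matrix_mul_assoc)
  also have "\<dots> = Z ** P ** ?T ** ?T" by (simp only: P(2))
  also have "\<dots> = Z ** (P ** ?T) ** ?T" by (simp only: matrix_mul_assoc)
  also have "\<dots> = Z ** (Z ** P) ** ?T" by (simp only: P(2))
  also have "\<dots> = Z ** Z ** (P ** ?T)" by (simp only: matrix_mul_assoc)
  also have "\<dots> = Z ** Z ** (Z ** P)" by (simp only: P(2))
  also have "\<dots> = Z ** Z ** Z ** P" by (simp only: matrix_mul_assoc)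
  finally have "P ** (?T ** ?T ** ?T) = 0" by (simp add: Z(3))
  then have "(Q ** P) ** (?T ** ?T ** ?T) = 0" by (simp flip: matrix_mul_assoc)
  then have "?T ** ?T ** ?T = 0" by (simp only: QP matrix_mul_lid)
  then have 0: "a = 0" "c = 0" "k = 0" by (auto simp: m3_simps zero_m3)
  have "b \<noteq> 0 \<or> d \<noteq> 0 \<or> e \<noteq> 0"
  proof (rule ccontr)
    assume "\<not> ?thesis"
    then have "Z ** P = 0" using P(2) 0 by (simp flip: zero_m3)
    then have "Z ** (P ** Q) = 0" by (simp add: matrix_mul_assoc)
    then show False using Z(2) Q by simp
  qed
  then show ?thesis
    using transfer_case[OF f big Z(1) P] strictly_lower_case 0 by blast
qed

text \<open>Together with the total degree, two independent weight conditions determine the exponent of every coefficient,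
  where the differential counts as one more variable. Since no variable divides the form, each entry of this
  exponent is at most one; but they add up to five.\<close>

lemma two_diagonals:
  assumes f: "foliation_form \<omega>" and D: "lie (diag3 a b c) \<omega> = 0" and D': "lie (diag3 a' b' c') \<omega> = 0"
  shows "a * b' = a' * b" "b * c' = b' * c" "a * c' = a' * c"
proof -
  define c1 c2 c3 where c: "c1 = b * c' - c * b'" "c2 = c * a' - a * c'" "c3 = a * b' - b * a'"
  let ?M1 = "\<lambda>l :: 3. \<lambda>i. of_nat i + (if l = 1 then 1 else 0) :: complex"
  let ?M2 = "\<lambda>l :: 3. \<lambda>j. of_nat j + (if l = 2 then 1 else 0) :: complex"
  let ?M3 = "\<lambda>l :: 3. \<lambda>k. of_nat k + (if l = 3 then 1 else 0) :: complex"
  have gen: "x * (c1 + c2 + c3) = 5 * c1 \<and> y * (c1 + c2 + c3) = 5 * c2 \<and> z * (c1 + c2 + c3) = 5 * c3"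
    if "x * c2 = y * c1" "x * c3 = z * c1" "y * c3 = z * c2" "x + y + z = 5" for x y z
    using that by (intro conjI; algebra)
  have M: "?M1 l i * (c1 + c2 + c3) = 5 * c1" "?M2 l j * (c1 + c2 + c3) = 5 * c2"
    "?M3 l k * (c1 + c2 + c3) = 5 * c3" if nz: "cf \<omega> l i j k \<noteq> 0" for l i j k
  proof -
    have "i + j + k = 4" using nz cf_degree f unfolding foliation_form_def by blast
    then have "of_nat (i + j + k) = (4 :: complex)" by simp
    then have s: "?M1 l i + ?M2 l j + ?M3 l k = 5" using exhaust_3[of l] by (auto simp: add.assoc)
    have w: "a * ?M1 l i + b * ?M2 l j + c * ?M3 l k = 0" "a' * ?M1 l i + b' * ?M2 l j + c' * ?M3 l k = 0"
    proof -
      have "weight a b c l i j k = 0" "weight a' b' c' l i j k = 0"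
        using D[unfolded lie_diag_eq_0, rule_format, of l i j k] D'[unfolded lie_diag_eq_0, rule_format, of l i j k] nz
        by simp_all
      then show "a * ?M1 l i + b * ?M2 l j + c * ?M3 l k = 0" "a' * ?M1 l i + b' * ?M2 l j + c' * ?M3 l k = 0"
        using exhaust_3[of l] by (auto simp: weight_def algebra_simps)
    qed
    have "?M1 l i * c2 = ?M2 l j * c1" "?M1 l i * c3 = ?M3 l k * c1" "?M2 l j * c3 = ?M3 l k * c2"
      unfolding c using w by algebra+
    then show "?M1 l i * (c1 + c2 + c3) = 5 * c1" "?M2 l j * (c1 + c2 + c3) = 5 * c2"
      "?M3 l k * (c1 + c2 + c3) = 5 * c3"
      using s gen by blast+
  qed
  obtain l1 j1 k1 where 1: "cf \<omega> l1 0 j1 k1 \<noteq> 0" using not_divisible(1)[OF f] by blast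
  obtain l2 i2 k2 where 2: "cf \<omega> l2 i2 0 k2 \<noteq> 0" using not_divisible(2)[OF f] by blast
  obtain l3 i3 j3 where 3: "cf \<omega> l3 i3 j3 0 \<noteq> 0" using not_divisible(3)[OF f] by blast
  let ?\<epsilon> = "\<lambda>b. if b then 1 else 0 :: complex"
  have "(?\<epsilon> (l1 = 1) + ?\<epsilon> (l2 = 2) + ?\<epsilon> (l3 = 3)) * (c1 + c2 + c3) = 5 * (c1 + c2 + c3)"
    using M(1)[OF 1] M(2)[OF 2] M(3)[OF 3] by (simp add: algebra_simps)
  then have "c1 + c2 + c3 = 0 \<or> ?\<epsilon> (l1 = 1) + ?\<epsilon> (l2 = 2) + ?\<epsilon> (l3 = 3) = 5"
    by (simp only: mult_cancel_right)
  moreover have "?\<epsilon> (l1 = 1) + ?\<epsilon> (l2 = 2) + ?\<epsilon> (l3 = 3) \<noteq> 5" by simp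
  ultimately have S: "c1 + c2 + c3 = 0" by blast
  then have "c1 = 0" "c2 = 0" "c3 = 0" using M[OF 1] by auto
  then show "a * b' = a' * b" "b * c' = b' * c" "a * c' = a' * c"
    unfolding c by (simp_all add: algebra_simps)
qed

text \<open>The second symmetry commutes with the first, so it is block diagonal, and its block can be made triangular
  without changing the first. Its nilpotent part is nonzero, as otherwise there are two independent diagonal symmetries.\<close>

lemma two_equal_eigenvalues_case:
  assumes f: "foliation_form \<omega>" and D: "lie (diag3 d d e) \<omega> = 0" "d \<noteq> e"
    and X: "lie (m3 p q 0 r s 0 0 0 g) \<omega> = 0" "\<And>c. m3 p q 0 r s 0 0 0 g \<noteq> smul c (diag3 d d e)"
    and big: "big_stabiliser \<omega>"
  shows "normalizable \<omega>"
proof -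
  obtain P p' r' s' where P: "det P \<noteq> 0" "P ** m3 p' 0 0 r' s' 0 0 0 g = m3 p q 0 r s 0 0 0 g ** P"
    "P ** diag3 d d e = diag3 d d e ** P"
    using triangularise_block[of g p q r s 0 0] by blast
  let ?X = "m3 p' 0 0 r' s' 0 0 0 g"
  obtain U t where U: "U = m3 1 0 0 t 1 0 0 0 1" and
    "\<exists>m. (m \<noteq> 0 \<longrightarrow> p' = s') \<and> ?X ** U = U ** (diag3 p' s' g + m3 0 0 0 m 0 0 0 0 0)"
  proof (cases "p' = s'")
    case True
    then show ?thesis
      by (intro that[of "m3 1 0 0 0 1 0 0 0 1" 0] exI[of _ r']) (simp_all add: m3_simps)
  next
    case False
    then show ?thesis
      by (intro that[of "m3 1 0 0 (r' / (p' - s')) 1 0 0 0 1" "r' / (p' - s')"] exI[of _ 0])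
        (simp_all add: m3_simps field_simps)
  qed
  then obtain m where m: "m \<noteq> 0 \<longrightarrow> p' = s'" "?X ** U = U ** (diag3 p' s' g + m3 0 0 0 m 0 0 0 0 0)" by blast
  let ?V = "P ** U"
  have "det U = 1" by (simp add: U det_m3)
  then have "det ?V \<noteq> 0" using P(1) by (simp add: det_mul)
  then obtain Q where Q: "?V ** Q = mat 1" using right_inverse_exists by blast
  let ?\<eta> = "pullback ?V \<omega>"
  have f': "foliation_form ?\<eta>" using f Q by (rule foliation_form_pullback)
  have big': "big_stabiliser ?\<eta>" using big Q by (rule big_stabiliser_pullback)
  have UD: "U ** diag3 d d e = diag3 d d e ** U" by (simp add: U m3_simps)
  have VD: "?V ** diag3 d d e = diag3 d d e ** ?V"
    using conjugation_compose[OF P(3) UD] .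
  have VX: "?V ** (diag3 p' s' g + m3 0 0 0 m 0 0 0 0 0) = m3 p q 0 r s 0 0 0 g ** ?V"
    using conjugation_compose[OF P(2) m(2)[symmetric]] .
  have D': "lie (diag3 d d e) ?\<eta> = 0" using lie_pullback_eq_0[OF D(1) VD] .
  have X': "lie (diag3 p' s' g + m3 0 0 0 m 0 0 0 0 0) ?\<eta> = 0" using lie_pullback_eq_0[OF X(1) VX] .
  have parts: "lie (diag3 p' s' g) ?\<eta> = 0" "lie (m3 0 0 0 m 0 0 0 0 0) ?\<eta> = 0"
    using lie_jordan_parts[OF _ refl refl _ _ _ X'] f' m(1) by (auto simp: foliation_form_def)
  have "m \<noteq> 0"
  proof
    assume m0: "m = 0"
    note dep = two_diagonals[OF f' D' parts(1)]
    have de: "d \<noteq> 0 \<or> e \<noteq> 0" using D(2) by auto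
    obtain k where k: "p' = k * d" "s' = k * d" "g = k * e"
    proof (cases "d = 0")
      case True
      then show ?thesis using that[of "g / e"] dep de by (auto simp: field_simps)
    next
      case False
      then show ?thesis using that[of "p' / d"] dep by (auto simp: field_simps)
    qed
    have "m3 p q 0 r s 0 0 0 g ** ?V = ?V ** smul k (diag3 d d e)"
      unfolding VX[symmetric] by (simp add: m0 k m3_simps)
    also have "\<dots> = smul k (diag3 d d e) ** ?V" by (simp only: matrix_mult_smul VD)
    finally have "m3 p q 0 r s 0 0 0 g ** (?V ** Q) = smul k (diag3 d d e) ** (?V ** Q)"
      by (simp only: matrix_mul_assoc)
    then show False using X(2)[of k] Q by simp
  qed
  then have "normalizable ?\<eta>" using strictly_lower_case[of ?\<eta> m 0 0] parts(2) f' big' by blast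
  then show ?thesis using Q by (rule normalizable_pullback)
qed

text \<open>Applying polynomials in \<open>ad D\<close> isolates the components of \<open>X\<close> in the eigenspaces of \<open>ad D\<close>.\<close>

lemma ad_diagonal_polynomial:
  assumes D: "lie D \<omega> = 0" "\<And>i j. i \<noteq> j \<Longrightarrow> D $ i $ j = 0" and X: "lie X \<omega> = 0" and S: "finite S"
  shows "\<exists>Z. lie Z \<omega> = 0 \<and> (\<forall>i j. Z $ i $ j = (\<Prod>\<mu>\<in>S. D $ i $ i - D $ j $ j - \<mu>) * X $ i $ j)"
  using S
proof (induction S rule: finite_induct)
  case empty
  then show ?case using X by (intro exI[of _ X]) simp
next
  case (insert \<mu> S)
  then obtain Z where Z: "lie Z \<omega> = 0" "\<And>i j. Z $ i $ j = (\<Prod>\<mu>\<in>S. D $ i $ i - D $ j $ j - \<mu>) * X $ i $ j"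
    by blast
  have "lie (D ** Z - Z ** D - smul \<mu> Z) \<omega> = 0"
    unfolding lie_diff[of _ "smul \<mu> Z"] by (simp add: lie_commutator D(1) Z(1) lie_smul_eq_0)
  moreover have "(D ** Z - Z ** D - smul \<mu> Z) $ i $ j = (D $ i $ i - D $ j $ j - \<mu>) * Z $ i $ j" for i j
  proof -
    have "(D ** Z) $ i $ j = (\<Sum>k\<in>UNIV. if k = i then D $ i $ i * Z $ i $ j else 0)"
      unfolding matrix_matrix_mult_def vec_lambda_beta by (intro sum.cong refl) (use D(2) in auto)
    moreover have "(Z ** D) $ i $ j = (\<Sum>k\<in>UNIV. if k = j then Z $ i $ j * D $ j $ j else 0)"
      unfolding matrix_matrix_mult_def vec_lambda_beta by (intro sum.cong refl) (use D(2) in auto)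
    ultimately show ?thesis by (simp add: algebra_simps)
  qed
  ultimately show ?case
    using insert.hyps Z(2) by (intro exI[of _ "D ** Z - Z ** D - smul \<mu> Z"]) (simp add: mult.assoc)
qed

text \<open>If a further symmetry does not commute with the diagonal one, then one of its components outside the centraliser
  is a symmetry too, and it is nilpotent because it shifts the three eigenvalues by a nonzero amount.\<close>

lemma diagonal_case:
  assumes f: "foliation_form \<omega>" and D: "lie (diag3 d1 d2 d3) \<omega> = 0" "diag3 d1 d2 d3 \<noteq> 0" and big: "big_stabiliser \<omega>"
  shows "normalizable \<omega>"
proof -
  let ?D = "diag3 d1 d2 d3"
  have off: "?D $ i $ j = 0" if "i \<noteq> j" for i j
    using that exhaust_3[of i] exhaust_3[of j] by auto
  obtain X where X: "lie X \<omega> = 0" "\<And>c. X \<noteq> smul c ?D"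
    using big unfolding big_stabiliser_def by blast
  show ?thesis
  proof (cases "\<exists>i j. ?D $ i $ i \<noteq> ?D $ j $ j \<and> X $ i $ j \<noteq> 0")
    case True
    then obtain i j where ij: "?D $ i $ i \<noteq> ?D $ j $ j" "X $ i $ j \<noteq> 0" by blast
    define \<kappa> where "\<kappa> = ?D $ i $ i - ?D $ j $ j"
    define S where "S = (\<lambda>(k, l). ?D $ k $ k - ?D $ l $ l) ` UNIV - {\<kappa>}"
    have fin: "finite S" unfolding S_def by simp
    obtain Z where Z: "lie Z \<omega> = 0" "\<And>k l. Z $ k $ l = (\<Prod>\<mu>\<in>S. ?D $ k $ k - ?D $ l $ l - \<mu>) * X $ k $ l"
      using ad_diagonal_polynomial[OF D(1) off X(1) fin] by blast
    have "Z $ i $ j \<noteq> 0"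
      using ij(2) fin by (simp add: Z(2) S_def \<kappa>_def)
    then have "Z \<noteq> 0" by auto
    have Z0: "Z $ k $ l = 0 \<or> ?D $ k $ k = ?D $ l $ l + \<kappa>" for k l
    proof (rule disjCI)
      assume "?D $ k $ k \<noteq> ?D $ l $ l + \<kappa>"
      then have "?D $ k $ k - ?D $ l $ l \<in> S" by (auto simp: S_def algebra_simps)
      then show "Z $ k $ l = 0" using fin by (auto simp: Z(2))
    qed
    have \<kappa>: "\<kappa> \<noteq> 0" using ij(1) by (simp add: \<kappa>_def)
    have Z3: "Z $ k $ a * Z $ a $ b * Z $ b $ l = 0" for k a b l
    proof (rule ccontr)
      assume "Z $ k $ a * Z $ a $ b * Z $ b $ l \<noteq> 0"
      then have e: "?D $ k $ k = ?D $ a $ a + \<kappa>" "?D $ a $ a = ?D $ b $ b + \<kappa>" "?D $ b $ b = ?D $ l $ l + \<kappa>"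
        using Z0[of k a] Z0[of a b] Z0[of b l] by auto
      have "3 * \<kappa> \<noteq> 0" "2 * \<kappa> \<noteq> 0" using \<kappa> by auto
      then have "k \<noteq> a" "k \<noteq> b" "k \<noteq> l" "a \<noteq> b" "a \<noteq> l" "b \<noteq> l"
        using e \<kappa> by auto
      then show False
        using exhaust_3[of k] exhaust_3[of a] exhaust_3[of b] exhaust_3[of l] by auto
    qed
    have "Z ** Z ** Z = 0"
      unfolding vec_eq_iff by (simp add: matrix_matrix_mult_def sum_distrib_right Z3)
    then show ?thesis using nilpotent_case[OF f Z(1) \<open>Z \<noteq> 0\<close>] big by blast
  next
    case False
    then have comm: "X $ i $ j = 0" if "?D $ i $ i \<noteq> ?D $ j $ j" for i j using that by blast
    obtain x11 x12 x13 x21 x22 x23 x31 x32 x33 where Xm: "X = m3 x11 x12 x13 x21 x22 x23 x31 x32 x33"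
      using m3_cases by blast
    have z: "d1 \<noteq> d2 \<longrightarrow> x12 = 0 \<and> x21 = 0" "d1 \<noteq> d3 \<longrightarrow> x13 = 0 \<and> x31 = 0" "d2 \<noteq> d3 \<longrightarrow> x23 = 0 \<and> x32 = 0"
      using comm[of 1 2] comm[of 2 1] comm[of 1 3] comm[of 3 1] comm[of 2 3] comm[of 3 2] by (auto simp: Xm)
    have ns: "\<not> (d1 = d2 \<and> d2 = d3)"
    proof
      assume eq: "d1 = d2 \<and> d2 = d3"
      then have "d3 = 0" using lie_scalar[OF f, of d3] D(1) by simp
      then show False using D(2) eq by (simp flip: zero_m3)
    qed
    consider "d1 \<noteq> d2" "d2 \<noteq> d3" "d1 \<noteq> d3" | "d1 = d2" "d2 \<noteq> d3" | "d1 = d3" "d2 \<noteq> d3" | "d2 = d3" "d1 \<noteq> d2"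
      using ns by blast
    then show ?thesis
    proof cases
      case 1
      then have Xd: "X = diag3 x11 x22 x33" using z by (simp add: Xm)
      note dep = two_diagonals[OF f D(1) X(1)[unfolded Xd]]
      have "\<exists>k. X = smul k ?D"
      proof -
        have "d1 \<noteq> 0 \<or> d2 \<noteq> 0" using 1 by auto
        then show ?thesis
        proof
          assume "d1 \<noteq> 0"
          then show ?thesis
            unfolding Xd smul_m3 m3_eq_iff by (intro exI[of _ "x11 / d1"]) (use dep in \<open>simp add: field_simps\<close>)
        next
          assume "d2 \<noteq> 0"
          then show ?thesis
            unfolding Xd smul_m3 m3_eq_iff by (intro exI[of _ "x22 / d2"]) (use dep in \<open>simp add: field_simps\<close>)
        qed
      qed
      then show ?thesis using X(2) by blast
    next
      case 2
      show ?thesis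
        by (rule two_equal_eigenvalues_case[OF f, of d2 d3 x11 x12 x21 x22 x33]) (use 2 z D X big in \<open>auto simp: Xm\<close>)
    next
      case 3
      let ?P = "m3 1 0 0 0 0 1 0 1 0"
      have PP: "?P ** ?P = mat 1" by (simp add: m3_simps mat_m3)
      show ?thesis
      proof (rule normalizable_pullback[OF _ PP], rule two_equal_eigenvalues_case[of _ d3 d2 x11 x13 x31 x33 x22])
        show "lie (diag3 d3 d3 d2) (pullback ?P \<omega>) = 0"
          by (rule lie_pullback_eq_0[OF D(1)]) (simp add: m3_simps 3)
        show "lie (m3 x11 x13 0 x31 x33 0 0 0 x22) (pullback ?P \<omega>) = 0"
          by (rule lie_pullback_eq_0[OF X(1)]) (use 3 z in \<open>simp add: m3_simps Xm\<close>)
        show "m3 x11 x13 0 x31 x33 0 0 0 x22 \<noteq> smul c (diag3 d3 d3 d2)" for c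
          using X(2)[of c] 3 z by (auto simp: Xm m3_simps)
      qed (use 3 f big PP foliation_form_pullback big_stabiliser_pullback in auto)
    next
      case 4
      let ?P = "m3 0 0 1 0 1 0 1 0 0"
      have PP: "?P ** ?P = mat 1" by (simp add: m3_simps mat_m3)
      show ?thesis
      proof (rule normalizable_pullback[OF _ PP], rule two_equal_eigenvalues_case[of _ d3 d1 x33 x32 x23 x22 x11])
        show "lie (diag3 d3 d3 d1) (pullback ?P \<omega>) = 0"
          by (rule lie_pullback_eq_0[OF D(1)]) (simp add: m3_simps 4)
        show "lie (m3 x33 x32 0 x23 x22 0 0 0 x11) (pullback ?P \<omega>) = 0"
          by (rule lie_pullback_eq_0[OF X(1)]) (use 4 z in \<open>simp add: m3_simps Xm\<close>)
        show "m3 x33 x32 0 x23 x22 0 0 0 x11 \<noteq> smul c (diag3 d3 d3 d1)" for c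
          using X(2)[of c] 4 z by (auto simp: Xm m3_simps)
      qed (use 4 f big PP foliation_form_pullback big_stabiliser_pullback in auto)
    qed
  qed
qed

lemma big_stabiliser_normalizable:
  assumes f: "foliation_form \<omega>" and big: "big_stabiliser \<omega>"
  shows "normalizable \<omega>"
proof -
  obtain X where X: "lie X \<omega> = 0" "\<And>c. X \<noteq> smul c 0"
    using big unfolding big_stabiliser_def by blast
  obtain P a b c d e k where P: "det P \<noteq> 0" "P ** m3 a 0 0 b c 0 d e k = X ** P"
    using triangularise by blast
  obtain u v w s t r where U: "m3 a 0 0 b c 0 d e k ** m3 1 0 0 u 1 0 w v 1 = m3 1 0 0 u 1 0 w v 1 ** (diag3 a c k + m3 0 0 0 s 0 0 r t 0)"
    "s \<noteq> 0 \<longrightarrow> a = c" "t \<noteq> 0 \<longrightarrow> c = k" "r \<noteq> 0 \<longrightarrow> a = k"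
    using lower_triangular_split[OF refl, of a b c d e k] by blast
  let ?V = "P ** m3 1 0 0 u 1 0 w v 1" and ?DN = "diag3 a c k + m3 0 0 0 s 0 0 r t 0"
  have V: "?V ** ?DN = X ** ?V"
    using conjugation_compose[OF P(2) U(1)[symmetric]] .
  have "det (m3 1 0 0 u 1 0 w v 1) = 1" by (simp add: det_m3)
  then have "det ?V \<noteq> 0" using P(1) by (simp add: det_mul)
  then obtain Q where Q: "?V ** Q = mat 1" using right_inverse_exists by blast
  let ?\<eta> = "pullback ?V \<omega>"
  have f': "foliation_form ?\<eta>" using f Q by (rule foliation_form_pullback)
  have big': "big_stabiliser ?\<eta>" using big Q by (rule big_stabiliser_pullback)
  have DN: "lie ?DN ?\<eta> = 0" using lie_pullback_eq_0[OF X(1) V] .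
  have parts: "lie (diag3 a c k) ?\<eta> = 0" "lie (m3 0 0 0 s 0 0 r t 0) ?\<eta> = 0"
    using lie_jordan_parts[OF _ refl refl _ _ _ DN] f' U(2-4) by (auto simp: foliation_form_def)
  have "normalizable ?\<eta>"
  proof (cases "s \<noteq> 0 \<or> r \<noteq> 0 \<or> t \<noteq> 0")
    case True
    then show ?thesis using strictly_lower_case[OF f' parts(2) big'] by blast
  next
    case False
    have "diag3 a c k \<noteq> 0"
    proof
      assume "diag3 a c k = 0"
      then have "?DN = 0" using False by (simp flip: zero_m3)
      then have "X ** (?V ** Q) = 0" using V by (simp add: matrix_mul_assoc)
      moreover have "smul 0 0 = 0" by (simp add: vec_eq_iff)
      ultimately show False using X(2)[of 0] Q by simp
    qed
    then show ?thesis using diagonal_case[OF f' parts(1)] big' by blast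
  qed
  then show ?thesis using Q by (rule normalizable_pullback)
qed

section \<open>The two model foliations\<close>

definition Om1 :: "3 form" where "Om1 = pq_form (Var 2 ^ 3) (Var 1 ^ 3)"
definition Om2 :: "3 form" where "Om2 = pq_form (Var 1 ^ 3) (Var 2 ^ 3)"

lemma eval_injective:
  fixes p :: "3 cpoly"
  assumes "\<And>x. eval_poly x p = 0"
  shows "p = 0"
proof -
  obtain N where N: "\<And>m. m \<in> Poly_Mapping.keys p \<Longrightarrow> mdeg m < N"
    using finite_nat_set_iff_bounded[of "mdeg ` Poly_Mapping.keys p"] by auto
  let ?I = "{1, 2, 3 :: nat}" and ?f = "\<lambda>\<alpha> :: nat \<Rightarrow> nat. mon (\<alpha> 1) (\<alpha> 2) (\<alpha> 3)"
  let ?B = "PiE ?I (\<lambda>_. {..<N})"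
  have inj: "inj_on ?f ?B"
  proof (rule inj_onI)
    fix \<alpha> \<beta> assume "\<alpha> \<in> ?B" "\<beta> \<in> ?B" "?f \<alpha> = ?f \<beta>"
    then show "\<alpha> = \<beta>" by (intro PiE_ext[of \<alpha> ?I _ \<beta>]) (auto simp: mon_eq_iff)
  qed
  have keys: "Poly_Mapping.keys p \<subseteq> ?f ` ?B"
  proof
    fix m assume m: "m \<in> Poly_Mapping.keys p"
    obtain i j k where ijk: "m = mon i j k" using mon_exists by blast
    have "i < N" "j < N" "k < N" using N[OF m] by (simp_all add: ijk mdeg_mon)
    then have "(\<lambda>n\<in>?I. if n = 1 then i else if n = 2 then j else k) \<in> ?B" by auto
    moreover have "?f (\<lambda>n\<in>?I. if n = 1 then i else if n = 2 then j else k) = m" by (simp add: ijk)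
    ultimately show "m \<in> ?f ` ?B" by (intro image_eqI[where f = ?f]) (rule sym)
  qed
  have fin: "finite (?f ` ?B)" by (intro finite_imageI finite_PiE) auto
  have "(\<Sum>\<alpha>\<in>?B. Poly_Mapping.lookup p (?f \<alpha>) * (\<Prod>n\<in>?I. y n ^ \<alpha> n)) = 0" for y :: "nat \<Rightarrow> complex"
  proof -
    let ?x = "\<lambda>v :: 3. if v = 1 then y 1 else if v = 2 then y 2 else y 3"
    have pr: "(\<Prod>v\<in>Poly_Mapping.keys (mon i j k). ?x v ^ Poly_Mapping.lookup (mon i j k) v) = y 1 ^ i * (y 2 ^ j * y 3 ^ k)" for i j k
    proof -
      have "(\<Prod>v\<in>Poly_Mapping.keys (mon i j k). ?x v ^ Poly_Mapping.lookup (mon i j k) v) =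
          (\<Prod>v\<in>UNIV. ?x v ^ Poly_Mapping.lookup (mon i j k) v)"
        by (rule prod.mono_neutral_left) (auto simp: in_keys_iff)
      then show ?thesis unfolding UNIV_3 by (simp del: One_nat_def)
    qed
    have "(\<Sum>\<alpha>\<in>?B. Poly_Mapping.lookup p (?f \<alpha>) * (\<Prod>n\<in>?I. y n ^ \<alpha> n)) = eval_poly ?x p"
      by (subst insertion_by_supset[OF fin keys]) (simp_all add: sum.reindex[OF inj] pr del: One_nat_def)
    then show ?thesis using assms by simp
  qed
  then have zero: "Poly_Mapping.lookup p (?f \<alpha>) = 0" if "\<alpha> \<in> ?B" for \<alpha>
    using that by (intro box_monomials_independent[where c = "\<lambda>\<alpha>. Poly_Mapping.lookup p (?f \<alpha>)" and I = ?I]) auto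
  show ?thesis
  proof (rule ccontr)
    assume "p \<noteq> 0"
    then obtain m where "m \<in> Poly_Mapping.keys p" by (metis ex_in_conv keys_eq_empty)
    then show False using keys zero by (auto simp: in_keys_iff)
  qed
qed

lemma Var_mult_eq_0: "Var v * p = 0 \<Longrightarrow> p = 0"
proof (rule poly_mapping_eqI)
  fix m assume "Var v * p = 0"
  then have "Poly_Mapping.lookup (Var v * p) (m + Poly_Mapping.single v 1) = 0" by simp
  then show "Poly_Mapping.lookup p m = Poly_Mapping.lookup 0 m"
    by (simp add: lookup_Var_mult lookup_add)
qed

lemma eval_injective_off:
  fixes p :: "3 cpoly"
  assumes "\<And>x. x v \<noteq> 0 \<Longrightarrow> eval_poly x p = 0"
  shows "p = 0"
proof -
  have "eval_poly x (Var v * p) = 0" for x using assms[of x] by (auto simp: eval_mult)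
  then have "Var v * p = 0" by (rule eval_injective)
  then show ?thesis by (rule Var_mult_eq_0)
qed

lemma eval_line: "\<exists>q. \<forall>s. eval_poly (\<lambda>v. b v + s * c v) p = poly q s"
proof (induction p rule: cpoly_generators_induct)
  case (Const c)
  then show ?case by (intro exI[of _ "[:c:]"]) simp
next
  case (Var v)
  then show ?case by (intro exI[of _ "[:b v, c v:]"]) simp
next
  case (add p q)
  then obtain f g where "\<forall>s. eval_poly (\<lambda>v. b v + s * c v) p = poly f s" "\<forall>s. eval_poly (\<lambda>v. b v + s * c v) q = poly g s"
    by blast
  then show ?case by (intro exI[of _ "f + g"]) (simp add: eval_add)
next
  case (mult p q)
  then obtain f g where "\<forall>s. eval_poly (\<lambda>v. b v + s * c v) p = poly f s" "\<forall>s. eval_poly (\<lambda>v. b v + s * c v) q = poly g s"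
    by blast
  then show ?case by (intro exI[of _ "f * g"]) (simp add: eval_mult)
qed

text \<open>A common factor of the components has no zeros on the lines through the point \<open>(0, 1, 1)\<close> that
  leave the plane \<open>x = 0\<close>, so it is constant on them.\<close>

lemma no_common_factorI:
  fixes \<omega> :: "3 form"
  assumes off: "\<And>x. x 1 \<noteq> 0 \<Longrightarrow> \<exists>i. eval_poly x (\<omega> $ i) \<noteq> 0"
    and base: "\<exists>i. eval_poly (\<lambda>v. if v = 1 then 0 else 1) (\<omega> $ i) \<noteq> 0"
  shows "no_common_factor \<omega>"
  unfolding no_common_factor_def
proof (intro allI impI)
  fix p assume p: "\<forall>i. p dvd \<omega> $ i"
  have nz: "eval_poly x p \<noteq> 0" if ex: "\<exists>i. eval_poly x (\<omega> $ i) \<noteq> 0" for x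
  proof -
    obtain i where i: "eval_poly x (\<omega> $ i) \<noteq> 0" using ex by blast
    obtain q where "\<omega> $ i = p * q" using p by (auto simp: dvd_def)
    then show ?thesis using i by (auto simp: eval_mult)
  qed
  define b where "b = (\<lambda>v :: 3. if v = 1 then 0 else 1 :: complex)"
  define k where "k = eval_poly b p"
  have k: "k \<noteq> 0" using nz base by (simp add: k_def b_def)
  have "eval_poly a (p - Const k) = 0" if a: "a 1 \<noteq> 0" for a
  proof -
    obtain q where q: "\<And>s. eval_poly (\<lambda>v. b v + s * (a v - b v)) p = poly q s"
      using eval_line[of b "\<lambda>v. a v - b v" p] by blast
    have "poly q s \<noteq> 0" for s
    proof (cases "s = 0")
      case True
      then show ?thesis using k by (simp add: k_def flip: q)
    next
      case False
      then have "(\<lambda>v. b v + s * (a v - b v)) 1 \<noteq> 0" using a by (simp add: b_def)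
      from nz[OF off[of "\<lambda>v. b v + s * (a v - b v)", OF this]] show ?thesis by (simp add: q)
    qed
    then have "constant (poly q)" using fundamental_theorem_of_algebra by blast
    then have "poly q 1 = poly q 0" by (simp add: constant_def)
    then show ?thesis by (simp add: eval_diff k_def flip: q)
  qed
  then have "p - Const k = 0" by (rule eval_injective_off)
  then have "p * Const (1 / k) = 1"
    using k by (simp add: Const_1 flip: Const_mult)
  then show "p dvd 1" by (metis dvd_triv_left)
qed

lemma foliation_form_models: "foliation_form Om1" "foliation_form Om2"
proof -
  have h: "homogeneous 3 (Var v ^ 3)" for v :: 3
    using homogeneous_power[OF homogeneous_Var, of 3 v] by simp
  have "no_common_factor Om1"
  proof (rule no_common_factorI)
    fix x :: "3 \<Rightarrow> complex" assume "x 1 \<noteq> 0"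
    then show "\<exists>i. eval_poly x (Om1 $ i) \<noteq> 0"
      by (intro exI[of _ 2]) (simp add: Om1_def eval_mult eval_power)
  qed (intro exI[of _ 1], simp add: Om1_def eval_mult eval_power eval_diff)
  moreover have "no_common_factor Om2"
  proof (rule no_common_factorI)
    fix x :: "3 \<Rightarrow> complex" assume "x 1 \<noteq> 0"
    then show "\<exists>i. eval_poly x (Om2 $ i) \<noteq> 0"
      by (intro exI[of _ 3]) (simp add: Om2_def eval_mult eval_power eval_minus)
  qed (intro exI[of _ 1], simp add: Om2_def eval_mult eval_power eval_diff)
  ultimately show "foliation_form Om1" "foliation_form Om2"
    unfolding foliation_form_def Om1_def Om2_def by (simp_all add: twisted_pq_form h)
qed

lemma twisted_diff: "\<omega> \<in> twisted_forms d \<Longrightarrow> \<eta> \<in> twisted_forms d \<Longrightarrow> \<omega> - \<eta> \<in> twisted_forms d"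
  by (simp add: twisted_forms_def homogeneous_diff right_diff_distrib sum_subtractf)

lemma twisted_scale: "\<omega> \<in> twisted_forms d \<Longrightarrow> Const k *s \<omega> \<in> twisted_forms d"
  by (simp add: twisted_forms_def homogeneous_scale mult.left_commute[of _ "Const k"] flip: sum_distrib_left)

lemma no_common_factor_scale:
  assumes "no_common_factor \<omega>" "k \<noteq> 0"
  shows "no_common_factor (Const k *s \<omega>)"
  unfolding no_common_factor_def
proof (intro allI impI)
  fix p assume p: "\<forall>i. p dvd (Const k *s \<omega>) $ i"
  have "\<omega> $ i = Const (1 / k) * (Const k *s \<omega>) $ i" for i
    using assms(2) by (simp add: Const_1 mult.assoc[symmetric] flip: Const_mult)
  then have "p dvd \<omega> $ i" for i using p by (metis dvd_mult)
  then show "p dvd 1" using assms(1) by (simp add: no_common_factor_def)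
qed

lemma chart_form_nth:
  "chart_form \<omega> $ 1 = subst_poly (\<lambda>i. vector [Var 1, Var 2, 1] $ i) (\<omega> $ 1)"
  "chart_form \<omega> $ 2 = subst_poly (\<lambda>i. vector [Var 1, Var 2, 1] $ i) (\<omega> $ 2)"
  by (simp_all add: chart_form_def Let_def)

lemma chart_form_scale: "chart_form (Const k *s \<omega>) = Const k *s chart_form \<omega>"
  by (simp add: vec_eq_iff forall_2 chart_form_nth subst_mult)

lemma chart_form_diff: "chart_form (\<omega> - \<eta>) = chart_form \<omega> - chart_form \<eta>"
  by (simp add: vec_eq_iff forall_2 chart_form_nth subst_diff)

text \<open>A homogeneous polynomial is determined by its values at \<open>z = 1\<close>, and the third component by tangency.\<close>

lemma chart_form_injective:
  assumes \<omega>: "\<omega> \<in> twisted_forms d" and 0: "chart_form \<omega> = 0"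
  shows "\<omega> = 0"
proof -
  have dehom: "p = 0" if p: "homogeneous n p" "subst_poly (\<lambda>i. vector [Var 1, Var 2, 1] $ i :: 2 cpoly) p = 0" for n and p :: "3 cpoly"
  proof (rule eval_injective_off[of 3])
    fix x :: "3 \<Rightarrow> complex" assume x: "x 3 \<noteq> 0"
    let ?y = "\<lambda>v :: 2. if v = 1 then x 1 / x 3 else x 2 / x 3"
    have "(\<lambda>v. x 3 * eval_poly ?y (vector [Var 1, Var 2, 1] $ v)) = x"
    proof
      fix v show "x 3 * eval_poly ?y (vector [Var 1, Var 2, 1] $ v) = x v"
        using exhaust_3[of v] x by (auto simp: vector_3)
    qed
    then have "eval_poly x p = x 3 ^ n * eval_poly (\<lambda>v. eval_poly ?y (vector [Var 1, Var 2, 1] $ v)) p"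
      using eval_homogeneous_scale[OF p(1), of "x 3" "\<lambda>v. eval_poly ?y (vector [Var 1, Var 2, 1] $ v)"] by simp
    also have "\<dots> = x 3 ^ n * eval_poly ?y (subst_poly (\<lambda>i. vector [Var 1, Var 2, 1] $ i) p)"
      by (simp add: eval_subst)
    finally show "eval_poly x p = 0" using p(2) by simp
  qed
  have h: "homogeneous (d + 1) (\<omega> $ i)" for i using \<omega> by (simp add: twisted_forms_def)
  have 1: "\<omega> $ 1 = 0" using dehom[OF h] chart_form_nth(1)[of \<omega>] 0 by simp
  have 2: "\<omega> $ 2 = 0" using dehom[OF h] chart_form_nth(2)[of \<omega>] 0 by simp
  have "Var 3 * \<omega> $ 3 = 0" using \<omega> 1 2 by (simp add: twisted_forms_def sum_3)
  then have "\<omega> $ 3 = 0" by (rule Var_mult_eq_0)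
  then show ?thesis using 1 2 by (simp add: vec_eq_iff forall_3)
qed

lemma foliation_of_chart_eq:
  assumes f: "foliation_form \<Omega>" and c: "chart_form \<Omega> = \<theta>"
  shows "foliation_of_chart 3 \<theta> = proj_point \<Omega>"
proof (rule set_eqI)
  fix \<omega>
  have \<Omega>: "\<Omega> \<in> twisted_forms 3" "no_common_factor \<Omega>" using f by (auto simp: foliation_form_def)
  show "\<omega> \<in> foliation_of_chart 3 \<theta> \<longleftrightarrow> \<omega> \<in> proj_point \<Omega>"
  proof
    assume "\<omega> \<in> foliation_of_chart 3 \<theta>"
    then obtain k where k: "\<omega> \<in> twisted_forms 3" "k \<noteq> 0" "chart_form \<omega> = Const k *s \<theta>"
      by (auto simp: foliation_of_chart_def)
    have "\<omega> - Const k *s \<Omega> = 0"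
      by (rule chart_form_injective[of _ 3])
        (use k \<Omega> c in \<open>simp_all add: twisted_diff twisted_scale chart_form_diff chart_form_scale\<close>)
    then show "\<omega> \<in> proj_point \<Omega>" using k(2) by (auto simp: proj_point_def)
  next
    assume "\<omega> \<in> proj_point \<Omega>"
    then obtain k where k: "k \<noteq> 0" "\<omega> = Const k *s \<Omega>" by (auto simp: proj_point_def)
    then show "\<omega> \<in> foliation_of_chart 3 \<theta>"
      using \<Omega> c by (auto simp: foliation_of_chart_def twisted_scale no_common_factor_scale chart_form_scale)
  qed
qed

lemma chart_models:
  "foliation_of_chart 3 omega_bar1 = proj_point Om1" "foliation_of_chart 3 omega_bar2 = proj_point Om2"
proof -
  have "chart_form Om1 = omega_bar1"
    by (simp add: vec_eq_iff forall_2 chart_form_nth Om1_def omega_bar1_def Let_def subst_simps vector_3 axis_def)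
  then show "foliation_of_chart 3 omega_bar1 = proj_point Om1"
    by (rule foliation_of_chart_eq[OF foliation_form_models(1)])
  have "chart_form Om2 = omega_bar2"
    by (simp add: vec_eq_iff forall_2 chart_form_nth Om2_def omega_bar2_def Let_def subst_simps vector_3 axis_def)
  then show "foliation_of_chart 3 omega_bar2 = proj_point Om2"
    by (rule foliation_of_chart_eq[OF foliation_form_models(2)])
qed

lemma pullback_pq_form:
  "pullback (m3 a 0 0 0 b 0 c 0 e) (pq_form p q) =
    pq_form (Const (a * e) * subst_poly (row_form (m3 a 0 0 0 b 0 c 0 e)) p)
      (Const (a * b) * subst_poly (row_form (m3 a 0 0 0 b 0 c 0 e)) q)"
proof -
  let ?M = "m3 a 0 0 0 b 0 c 0 e"
  have r: "row_form ?M 1 = Const a * Var 1" "row_form ?M 2 = Const b * Var 2"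
    "row_form ?M 3 = Const c * Var 1 + Const e * Var 3"
    by (simp_all add: row_form_def sum_3)
  show ?thesis
    by (simp add: vec_eq_iff forall_3 pullback_nth sum_3 subst_simps r Const_mult algebra_simps)
qed

lemma scale_pq_form: "Const k *s pq_form p q = pq_form (Const k * p) (Const k * q)"
  by (simp add: vec_eq_iff forall_3 algebra_simps)

lemma subst_row_power:
  "subst_poly (row_form (m3 a 0 0 0 b 0 c 0 e)) (Var 1 ^ 3) = Const (a ^ 3) * Var 1 ^ 3"
  "subst_poly (row_form (m3 a 0 0 0 b 0 c 0 e)) (Var 2 ^ 3) = Const (b ^ 3) * Var 2 ^ 3"
  by (simp_all add: subst_power row_form_def sum_3 Const_power power_mult_distrib)

lemma models_symmetric:
  assumes "a \<noteq> 0" "b \<noteq> 0"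
  shows "\<exists>e k. e \<noteq> 0 \<and> pullback (m3 a 0 0 0 b 0 c 0 e) Om1 = Const k *s Om1"
    "\<exists>e k. e \<noteq> 0 \<and> pullback (m3 a 0 0 0 b 0 c 0 e) Om2 = Const k *s Om2"
proof -
  have *: "Const u * (Const v * p) = Const (u * v) * p" for u v and p :: "3 cpoly"
    by (simp add: Const_mult mult.assoc)
  have eq1: "a * (a ^ 3 / b ^ 2) * b ^ 3 = a * b * a ^ 3"
    using assms by (simp add: field_simps power3_eq_cube power2_eq_square)
  show "\<exists>e k. e \<noteq> 0 \<and> pullback (m3 a 0 0 0 b 0 c 0 e) Om1 = Const k *s Om1"
  proof (intro exI conjI)
    show "a ^ 3 / b ^ 2 \<noteq> 0" using assms by simp
    show "pullback (m3 a 0 0 0 b 0 c 0 (a ^ 3 / b ^ 2)) Om1 = Const (a * b * a ^ 3) *s Om1"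
      unfolding Om1_def pullback_pq_form subst_row_power scale_pq_form * eq1 ..
  qed
  have eq2: "a * (b ^ 4 / a ^ 3) * a ^ 3 = a * b * b ^ 3"
    using assms by (simp add: field_simps eval_nat_numeral)
  show "\<exists>e k. e \<noteq> 0 \<and> pullback (m3 a 0 0 0 b 0 c 0 e) Om2 = Const k *s Om2"
  proof (intro exI conjI)
    show "b ^ 4 / a ^ 3 \<noteq> 0" using assms by simp
    show "pullback (m3 a 0 0 0 b 0 c 0 (b ^ 4 / a ^ 3)) Om2 = Const (a * b * b ^ 3) *s Om2"
      unfolding Om2_def pullback_pq_form subst_row_power scale_pq_form * eq2 ..
  qed
qed

lemma cubic_powers: "cubic p 0 0 0 = Const p * Var 1 ^ 3" "cubic 0 0 0 p = Const p * Var 2 ^ 3"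
proof -
  have "Var v ^ n = Poly_Mapping.single (Poly_Mapping.single v n) 1" for v :: 3 and n
    by (induction n) (simp_all add: Var_def mult_single flip: single_add single_one)
  then show "cubic p 0 0 0 = Const p * Var 1 ^ 3" "cubic 0 0 0 p = Const p * Var 2 ^ 3"
    by (simp_all add: cubic_def Const_def mult_single mon_def)
qed

lemma normalizable_model:
  assumes "normalizable \<omega>"
  shows "\<exists>P k. invertible P \<and> k \<noteq> 0 \<and> (pullback P \<omega> = Const k *s Om1 \<or> pullback P \<omega> = Const k *s Om2)"
proof -
  have *: "Const u * (Const v * p) = Const (u * v) * p" for u v and p :: "3 cpoly"
    by (simp add: Const_mult mult.assoc)
  obtain P p q where P: "invertible P" "p \<noteq> 0" "q \<noteq> 0"
    and c: "pullback P \<omega> = pq_form (cubic 0 0 0 p) (cubic q 0 0 0) \<or> pullback P \<omega> = pq_form (cubic p 0 0 0) (cubic 0 0 0 q)"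
    using assms unfolding normalizable_def by blast
  let ?D = "diag3 1 1 (q / p)"
  have "invertible ?D" using P by (simp add: invertible_det_nz det_m3)
  then have "invertible (P ** ?D)" using P(1) by (rule invertible_mult[rotated])
  moreover have "pullback (P ** ?D) \<omega> = Const q *s Om1 \<or> pullback (P ** ?D) \<omega> = Const q *s Om2"
    using c P(2) unfolding pullback_pullback[symmetric] cubic_powers
    by (auto simp: pullback_pq_form subst_mult subst_row_power scale_pq_form Om1_def Om2_def * simp del: One_nat_def)
  ultimately show ?thesis using P(3) by blast
qed


section \<open>Orbits of conjugate forms\<close>

lemma image_proj_point: "pullback M ` proj_point \<omega> = proj_point (pullback M \<omega>)"
proof
  show "pullback M ` proj_point \<omega> \<subseteq> proj_point (pullback M \<omega>)"
    unfolding proj_point_def by (auto simp: pullback_scale)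
  show "proj_point (pullback M \<omega>) \<subseteq> pullback M ` proj_point \<omega>"
  proof
    fix \<eta> assume "\<eta> \<in> proj_point (pullback M \<omega>)"
    then obtain k where "k \<noteq> 0" "\<eta> = Const k *s pullback M \<omega>" by (auto simp: proj_point_def)
    then show "\<eta> \<in> pullback M ` proj_point \<omega>"
      by (intro image_eqI[of _ _ "Const k *s \<omega>"]) (auto simp: pullback_scale proj_point_def)
  qed
qed

lemma fol_orbit_eq: "fol_orbit (proj_point \<omega>) = orbit \<omega>"
  by (auto simp: fol_orbit_def orbit_def image_proj_point)

lemma orbit_pullback:
  assumes "invertible P"
  shows "orbit (pullback P \<omega>) = orbit \<omega>"
proof -
  have sub: "orbit (pullback P \<omega>) \<subseteq> orbit \<omega>" if "invertible P" for P \<omega>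
    using that invertible_mult unfolding orbit_def pullback_pullback by blast
  obtain Q where Q: "P ** Q = mat 1" "Q ** P = mat 1" using assms by (auto simp: invertible_def)
  then have "invertible Q" by (auto simp: invertible_def)
  then have "orbit (pullback Q (pullback P \<omega>)) \<subseteq> orbit (pullback P \<omega>)" by (rule sub)
  then show ?thesis using sub[OF assms] by (simp add: pullback_inverse[OF Q(1)] set_eq_subset)
qed

lemma orbit_scale: "k \<noteq> 0 \<Longrightarrow> orbit (Const k *s \<omega>) = orbit \<omega>"
  by (simp add: orbit_def pullback_scale proj_point_scale)

lemma proj_point_in_orbit: "proj_point \<omega> \<in> orbit \<omega>"
  unfolding orbit_def using pullback_mat[of \<omega>] by (intro CollectI exI[of _ "mat 1"]) (simp add: invertible_det_nz)

lemma proj_pointD: "proj_point \<omega> = proj_point \<eta> \<Longrightarrow> \<exists>k. k \<noteq> 0 \<and> \<omega> = Const k *s \<eta>"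
proof -
  assume eq: "proj_point \<omega> = proj_point \<eta>"
  have "\<omega> \<in> proj_point \<omega>"
    unfolding proj_point_def by (rule CollectI, rule exI[of _ 1]) (simp add: Const_1)
  then show ?thesis unfolding eq by (auto simp: proj_point_def)
qed

lemma orbit_eqI:
  assumes "proj_point \<omega> \<in> orbit \<eta>"
  shows "orbit \<omega> = orbit \<eta>"
proof -
  obtain M where M: "invertible M" "proj_point \<omega> = proj_point (pullback M \<eta>)"
    using assms by (auto simp: orbit_def)
  then obtain k where "k \<noteq> 0" "\<omega> = Const k *s pullback M \<eta>" using proj_pointD by blast
  then show ?thesis using M(1) by (simp add: orbit_scale orbit_pullback)
qed


text \<open>The matrices with first column \<open>(1, 1, 0)\<close> form an affine space of dimension six that meets almost every coset
  of the group of maps \<open>x \<mapsto> ax, y \<mapsto> by, z \<mapsto> ez + cx\<close> that preserve the foliation.\<close>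

lemma krull_dim_model_le:
  assumes f: "foliation_form \<Omega>"
    and sym: "\<And>a b c. a \<noteq> 0 \<Longrightarrow> b \<noteq> 0 \<Longrightarrow> \<exists>e k. e \<noteq> 0 \<and> pullback (m3 a 0 0 0 b 0 c 0 e) \<Omega> = Const k *s \<Omega>"
  shows "krull_dim (subtopology (zariski 3) (orbit \<Omega>)) \<le> 6"
proof -
  have tw: "\<Omega> \<in> twisted_forms 3" using f by (simp add: foliation_form_def)
  let ?S = "\<lambda>t :: nat \<Rightarrow> complex. m3 1 (t 1) (t 2) 1 (t 3) (t 4) 0 (t 5) (t 6)"
  let ?A = "\<lambda>t :: nat \<Rightarrow> complex. m3 (t 1) (t 2) (t 3) (t 4) (t 5) (t 6) (t 7) (t 8) (t 9)"
  have S: "polyfun {1..6} 1 (\<lambda>t. ?S t $ i $ j)" for i j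
    using exhaust_3[of i] exhaust_3[of j] by (elim disjE) (simp_all add: polyfun_const polyfun_var)
  have A: "polyfun {1..9} 1 (\<lambda>t. ?A t $ i $ j)" for i j
    using exhaust_3[of i] exhaust_3[of j] by (elim disjE) (simp_all add: polyfun_const polyfun_var)
  have dom: "vanishes_on u (orbit \<Omega>)" if u: "hom_fun M u" and 0: "\<And>t. u (pullback (?S t) \<Omega>) = 0" for M u
  proof -
    have gen: "u (pullback (?A t) \<Omega>) = 0" if t: "t 1 \<noteq> 0" "t 4 \<noteq> 0" for t
    proof -
      obtain e k where e: "e \<noteq> 0" "pullback (m3 (t 1) 0 0 0 (t 4) 0 (t 7) 0 e) \<Omega> = Const k *s \<Omega>"
        using sym t by blast
      \<comment> \<open>Divide the first two rows by their first entries, then clear the first entry of the third row and rescale it.\<close>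
      let ?s = "(\<lambda>_. 0)(1 := t 2 / t 1, 2 := t 3 / t 1, 3 := t 5 / t 4, 4 := t 6 / t 4,
        5 := (t 8 - t 7 * (t 2 / t 1)) / e, 6 := (t 9 - t 7 * (t 3 / t 1)) / e)"
      have "?A t = m3 (t 1) 0 0 0 (t 4) 0 (t 7) 0 e ** ?S ?s"
        using t e(1) by (simp add: m3_simps)
      then have "pullback (?A t) \<Omega> = Const k *s pullback (?S ?s) \<Omega>"
        by (simp only: pullback_pullback[symmetric] e(2) pullback_scale)
      then have "u (pullback (?A t) \<Omega>) = k ^ M * u (pullback (?S ?s) \<Omega>)"
        by (simp only: hom_fun_scale[OF u])
      also have "\<dots> = 0" by (simp only: 0 mult_zero_right)
      finally show ?thesis .
    qed
    have all: "u (pullback (?A t) \<Omega>) = 0" for t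
    proof (rule ccontr)
      assume "u (pullback (?A t) \<Omega>) \<noteq> 0"
      have U: "polyfun {1..9} (M * (3 + 2)) (\<lambda>t. u (pullback (?A t) \<Omega>))"
        by (rule polyfun_hom_fun[OF polyfun_pullback[OF A tw] u])
      have v: "polyfun {1..9} 2 (\<lambda>t. t 1 * t 4)"
        by (rule polyfun_mult[of _ 1 _ 1]) (auto intro: polyfun_var)
      obtain s where "u (pullback (?A s) \<Omega>) \<noteq> 0" "s 1 * s 4 \<noteq> 0"
        using polyfun_mult_nonzero[OF U \<open>u (pullback (?A t) \<Omega>) \<noteq> 0\<close> v, of "\<lambda>_. 1"] by auto
      then show False using gen[of s] by auto
    qed
    show ?thesis
      unfolding vanishes_on_def
    proof (intro allI impI)
      fix \<omega> assume "proj_point \<omega> \<in> orbit \<Omega>"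
      then obtain M' where "proj_point \<omega> = proj_point (pullback M' \<Omega>)" by (auto simp: orbit_def)
      then obtain k where k: "\<omega> = Const k *s pullback M' \<Omega>" using proj_pointD by blast
      obtain a b c d e g h i j where "M' = m3 a b c d e g h i j" using m3_cases by blast
      then have "u (pullback M' \<Omega>) = 0"
        using all[of "(\<lambda>_. 0)(1 := a, 2 := b, 3 := c, 4 := d, 5 := e, 6 := g, 7 := h, 8 := i, 9 := j)"] by simp
      then show "u \<omega> = 0" using k hom_fun_scale[OF u] by simp
    qed
  qed
  have "krull_dim (subtopology (zariski 3) (orbit \<Omega>)) \<le> enat 6"
    by (rule krull_dim_le[where I = "{1..6}" and \<psi> = "\<lambda>t. pullback (?S t) \<Omega>" and D = "3 + 2"])
      (use orbit_subset[OF tw foliation_form_nonzero[OF f]] polyfun_pullback[OF S tw] dom in auto)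
  then show ?thesis by (simp add: numeral_eq_enat)
qed

section \<open>The dimension of an orbit in terms of its stabiliser\<close>

interpretation gl: vector_space "\<lambda>c X. smul c X :: complex^3^3"
  by unfold_locales (simp_all add: vec_eq_iff algebra_simps)

interpretation forms: vector_space_pair "\<lambda>c \<omega>. Const c *s \<omega> :: 3 form" "(*) :: complex \<Rightarrow> complex \<Rightarrow> complex"
  by unfold_locales (simp_all add: vec_eq_iff algebra_simps Const_add Const_mult Const_1)

lemma gl_basis_card:
  assumes "gl.independent B" "gl.span B = UNIV"
  shows "finite B" "card B = 9"
proof -
  let ?e = "\<lambda>(i, j). (\<chi> a b. if a = i \<and> b = j then 1 else 0) :: complex^3^3"
  let ?E = "range ?e"
  have inj: "inj ?e"
  proof (rule injI, clarify)
    fix i j i' j' :: 3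
    assume "((\<chi> a b. if a = i \<and> b = j then 1 else 0) :: complex^3^3) = (\<chi> a b. if a = i' \<and> b = j' then 1 else 0)"
    then have "(if i = i \<and> j = j then 1 else 0 :: complex) = (if i = i' \<and> j = j' then 1 else 0)"
      by (simp only: vec_eq_iff vec_lambda_beta)
    then show "i = i' \<and> j = j'" by (simp split: if_splits)
  qed
  have sum: "(\<Sum>x\<in>?E. smul (f x) x) = (\<chi> a b. f (?e (a, b)))" for f
  proof -
    have "(\<Sum>x\<in>?E. smul (f x) x) = (\<Sum>p\<in>UNIV. smul (f (?e p)) (?e p))"
      by (rule sum.reindex[OF inj, unfolded o_def])
    moreover have "(\<Sum>p\<in>UNIV. smul (f (?e p)) (?e p)) $ a $ b = f (?e (a, b))" for a b
    proof -
      have "(\<Sum>p\<in>UNIV. smul (f (?e p)) (?e p)) $ a $ b = (\<Sum>p\<in>UNIV. if p = (a, b) then f (?e p) else 0)"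
        unfolding sum_component by (intro sum.cong refl) (auto split: if_splits)
      then show ?thesis by simp
    qed
    ultimately show ?thesis by (simp add: vec_eq_iff)
  qed
  have fin: "finite ?E" by simp
  have card: "card ?E = 9" by (simp add: card_image[OF inj])
  have ind: "gl.independent ?E"
  proof (rule gl.independent_if_scalars_zero[OF fin])
    fix f x assume 0: "(\<Sum>x\<in>?E. smul (f x) x) = 0" and x: "x \<in> ?E"
    obtain p where p: "x = ?e p" using x by blast
    obtain a b where ab: "p = (a, b)" by (cases p)
    have "(\<chi> a b. f (?e (a, b))) $ a $ b = 0" using 0 unfolding sum by (simp only: zero_index)
    then show "f x = 0" unfolding p ab by (simp only: vec_lambda_beta)
  qed
  have "X \<in> gl.span ?E" for X
  proof -
    define h where "h x = X $ fst (inv ?e x) $ snd (inv ?e x)" for x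
    have "h (?e (a, b)) = X $ a $ b" for a b
      unfolding h_def inv_f_f[OF inj] by simp
    then have X: "X = (\<Sum>x\<in>?E. smul (h x) x)"
      unfolding sum by (simp only: vec_eq_iff vec_lambda_beta simp_thms)
    have "(\<Sum>x\<in>?E. smul (h x) x) \<in> gl.span ?E"
      by (intro gl.span_sum gl.span_scale gl.span_base)
    then show ?thesis by (rule ssubst[OF X, of "\<lambda>Y. Y \<in> gl.span ?E"])
  qed
  then have span: "gl.span ?E = UNIV" by blast
  have "finite B \<and> card B \<le> card ?E"
    using gl.independent_span_bound[OF fin assms(1)] span by simp
  then show "finite B" by blast
  have "card ?E \<le> card B"
    using gl.independent_span_bound[OF \<open>finite B\<close> ind] assms(2) by simp
  then show "card B = 9" using \<open>finite B \<and> card B \<le> card ?E\<close> card by simp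
qed

lemma lie_form_homogeneous:
  assumes "\<omega> \<in> twisted_forms 3" "i + j + k \<noteq> 4"
  shows "cf (lie X \<omega>) l i j k = 0"
  using assms(2) cf_degree[OF assms(1)] by (simp add: cf_lie)

text \<open>On a complement of the stabiliser the derivative of the orbit map is injective, so there are linear functionals
  dual to the images of a basis of the complement.\<close>

lemma krull_dim_orbit_stabiliser:
  assumes f: "foliation_form \<omega>" and S: "finite S" "card S \<le> 8" "gl.independent (insert (mat 1) S)" "mat 1 \<notin> S"
    and stab: "\<And>X. lie X \<omega> = 0 \<Longrightarrow> X \<in> gl.span S"
  shows "enat (8 - card S) \<le> krull_dim (subtopology (zariski 3) (orbit \<omega>))"
proof -
  have tw: "\<omega> \<in> twisted_forms 3" using f by (simp add: foliation_form_def)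
  let ?r = "8 - card S"
  define B where "B = gl.extend_basis (insert (mat 1) S)"
  have B: "insert (mat 1) S \<subseteq> B" "gl.independent B" "gl.span B = UNIV"
    unfolding B_def using gl.extend_basis_superset[OF S(3)] gl.independent_extend_basis[OF S(3)]
      gl.span_extend_basis[OF S(3)] by blast+
  have finB: "finite B" "card B = 9" using gl_basis_card B by blast+
  have "card (B - insert (mat 1) S) = ?r"
    using finB B(1) S by (simp add: card_Diff_subset)
  then obtain w where w: "bij_betw w {0..<?r} (B - insert (mat 1) S)"
    using ex_bij_betw_nat_finite[of "B - insert (mat 1) S"] finB by auto
  define v where "v j = (if j = 0 then mat 1 else w (j - 1))" for j :: nat
  have w_in: "w j \<in> B - insert (mat 1) S" if "j < ?r" for j
    by (rule bij_betw_apply[OF w]) (use that in simp)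
  have v_in: "v j \<in> B - S" if "j \<le> ?r" for j
    using w_in[of "j - 1"] that B(1) S(4) by (auto simp: v_def)
  have v_inj: "inj_on v {0..?r}"
  proof (rule inj_onI)
    fix i j assume ij: "i \<in> {0..?r}" "j \<in> {0..?r}" "v i = v j"
    have lt: "k - 1 < ?r" if "k \<in> {0..?r}" "k \<noteq> 0" for k using that by auto
    show "i = j"
    proof (cases "i = 0 \<or> j = 0")
      case True
      then show ?thesis
        using ij w_in[OF lt[OF ij(1)]] w_in[OF lt[OF ij(2)]] by (auto simp: v_def split: if_splits)
    next
      case False
      then have "w (i - 1) = w (j - 1)" using ij(3) by (simp add: v_def)
      then have "i - 1 = j - 1"
        using bij_betw_imp_inj_on[OF w] lt[OF ij(1)] lt[OF ij(2)] False by (auto dest!: inj_onD)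
      then show ?thesis using False by arith
    qed
  qed
  have ind: "c j = 0" if lie0: "lie (\<Sum>j\<in>{0..?r}. smul (c j) (v j)) \<omega> = 0" and j: "j \<le> ?r" for c j
  proof -
    have "(\<Sum>j\<in>{0..?r}. smul (c j) (v j)) \<in> gl.span S" using stab[OF lie0] .
    then obtain b where b: "(\<Sum>j\<in>{0..?r}. smul (c j) (v j)) = (\<Sum>x\<in>S. smul (b x) x)"
      unfolding gl.span_finite[OF S(1)] by blast
    define u where "u x = (if x \<in> S then - b x else c (inv_into {0..?r} v x))" for x
    have "(\<Sum>x\<in>v ` {0..?r} \<union> S. smul (u x) x) = (\<Sum>x\<in>v ` {0..?r}. smul (u x) x) + (\<Sum>x\<in>S. smul (u x) x)"
      using v_in S(1) by (intro sum.union_disjoint) auto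
    also have "(\<Sum>x\<in>v ` {0..?r}. smul (u x) x) = (\<Sum>j\<in>{0..?r}. smul (c j) (v j))"
    proof -
      have "(\<Sum>x\<in>v ` {0..?r}. smul (u x) x) = (\<Sum>j\<in>{0..?r}. smul (u (v j)) (v j))"
        by (rule sum.reindex[OF v_inj, unfolded o_def])
      also have "\<dots> = (\<Sum>j\<in>{0..?r}. smul (c j) (v j))"
        using v_in by (intro sum.cong refl) (auto simp: u_def inv_into_f_f[OF v_inj])
      finally show ?thesis .
    qed
    also have "(\<Sum>x\<in>S. smul (u x) x) = - (\<Sum>x\<in>S. smul (b x) x)"
      by (simp add: u_def vec_eq_iff sum_component sum_negf)
    finally have "(\<Sum>x\<in>v ` {0..?r} \<union> S. smul (u x) x) = 0" using b by simp
    then have "u (v j) = 0"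
      using j v_in B(1) S(1) by (intro gl.independentD[OF B(2), of "v ` {0..?r} \<union> S" u]) auto
    then show ?thesis using v_in[OF j] j by (simp add: u_def inv_into_f_f[OF v_inj])
  qed
  let ?L = "\<lambda>j. lie (v j) \<omega>"
  have L_inj: "inj_on ?L {0..?r}"
  proof (rule inj_onI, rule ccontr)
    fix i j assume ij: "i \<in> {0..?r}" "j \<in> {0..?r}" "?L i = ?L j" "i \<noteq> j"
    let ?c = "\<lambda>k. if k = i then 1 else if k = j then - 1 else 0 :: complex"
    have "lie (\<Sum>k\<in>{0..?r}. smul (?c k) (v k)) \<omega> = (\<Sum>k\<in>{0..?r}. Const (?c k) *s ?L k)"
      by (rule lie_sum)
    also have "\<dots> = (\<Sum>k\<in>{0..?r}. (if k = i then ?L k else 0) - (if k = j then ?L k else 0))"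
      using ij(4) by (intro sum.cong refl) (auto simp: Const_1 Const_minus vec_eq_iff)
    also have "\<dots> = 0" using ij by (simp add: sum_subtractf)
    finally have "?c i = 0" using ij(1) by (intro ind) auto
    then show False by simp
  qed
  have L_ind: "forms.vs1.independent (?L ` {0..?r})"
  proof (rule forms.vs1.independent_if_scalars_zero)
    fix g x assume 0: "(\<Sum>x\<in>?L ` {0..?r}. Const (g x) *s x) = 0" and "x \<in> ?L ` {0..?r}"
    then obtain j where j: "j \<le> ?r" "x = ?L j" by auto
    have "(\<Sum>j\<in>{0..?r}. Const (g (?L j)) *s ?L j) = 0"
      using 0 by (simp add: sum.reindex[OF L_inj])
    then have "lie (\<Sum>j\<in>{0..?r}. smul (g (?L j)) (v j)) \<omega> = 0" by (simp only: lie_sum)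
    then show "g x = 0" using ind[of "\<lambda>j. g (?L j)" j] j by simp
  qed simp
  have "\<forall>a. \<exists>g. Vector_Spaces.linear (\<lambda>c \<omega>. Const c *s \<omega>) (*) g \<and>
      (\<forall>x\<in>?L ` {0..?r}. g x = (if x = ?L a then 1 else 0))"
    by (intro allI forms.linear_independent_extend[OF L_ind])
  from choice[OF this] obtain g where g': "\<forall>a. Vector_Spaces.linear (\<lambda>c \<omega>. Const c *s \<omega>) (*) (g a) \<and>
      (\<forall>x\<in>?L ` {0..?r}. g a x = (if x = ?L a then 1 else 0))" by (elim exE)
  have g_lin: "Vector_Spaces.linear (\<lambda>c \<omega>. Const c *s \<omega>) (*) (g a)" for a
    using g' by (elim allE conjE)
  have g: "g a x = (if x = ?L a then 1 else 0)" if "x \<in> ?L ` {0..?r}" for a x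
    using g'[THEN spec, THEN conjunct2, THEN bspec, OF that] .
  let ?V = "(UNIV :: 3 set) \<times> {m :: 3 \<Rightarrow>\<^sub>0 nat. mdeg m = 4}"
  have V: "finite ?V" by (intro finite_cartesian_product finite finite_monomials)
  let ?b = "\<lambda>x :: 3 \<times> (3 \<Rightarrow>\<^sub>0 nat). axis (fst x) (Poly_Mapping.single (snd x) 1) :: 3 form"
  define F where "F a = (\<lambda>\<eta>. \<Sum>x\<in>?V. g a (?b x) * form_coord \<eta> x)" for a
  have F_lie: "F a (lie X \<omega>) = g a (lie X \<omega>)" for a X
  proof -
    have "lie X \<omega> = (\<Sum>x\<in>?V. Const (form_coord (lie X \<omega>) x) *s ?b x)"
    proof (rule form_eqI)
      fix l i j k
      have "cf (\<Sum>x\<in>?V. Const (form_coord (lie X \<omega>) x) *s ?b x) l i j k =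
          (\<Sum>x\<in>?V. if x = (l, mon i j k) then form_coord (lie X \<omega>) x else 0)"
        unfolding sum_component lookup_sum
        by (intro sum.cong refl) (auto simp: Const_mult_lookup axis_def lookup_single when_def)
      also have "\<dots> = cf (lie X \<omega>) l i j k"
        using V lie_form_homogeneous[OF tw, of i j k X l] by (simp add: form_coord_def mdeg_mon)
      finally show "cf (lie X \<omega>) l i j k = cf (\<Sum>x\<in>?V. Const (form_coord (lie X \<omega>) x) *s ?b x) l i j k" ..
    qed
    then have "g a (lie X \<omega>) = g a (\<Sum>x\<in>?V. Const (form_coord (lie X \<omega>) x) *s ?b x)" by simp
    also have "\<dots> = (\<Sum>x\<in>?V. form_coord (lie X \<omega>) x * g a (?b x))"
      by (simp add: forms.linear_sum[OF g_lin] forms.linear_scale[OF g_lin])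
    finally show ?thesis by (simp add: F_def mult.commute)
  qed
  show ?thesis
  proof (rule krull_dim_orbit_ge[OF tw _ _ V])
    show "F a = (\<lambda>\<omega>. \<Sum>x\<in>?V. g a (?b x) * form_coord \<omega> x)" for a by (simp add: F_def)
    show "F a (lie (v b) \<omega>) = (if a = b then 1 else 0)" if "a \<le> ?r" "b \<le> ?r" for a b
      using that g[of "?L b" a] inj_onD[OF L_inj, of b a] unfolding F_lie by auto
  qed (simp_all add: v_def)
qed

lemma independent_pair:
  assumes "\<And>c. B \<noteq> smul c A" "A \<noteq> 0"
  shows "gl.independent {A, B}" "A \<noteq> B"
proof -
  have "smul 1 A = A" by (simp add: vec_eq_iff)
  then show "A \<noteq> B" using assms(1)[of 1] by auto
  have "B \<notin> gl.span {A}" using assms(1) by (auto simp: gl.span_singleton)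
  then show "gl.independent {A, B}"
    using gl.independent_insertI[of B "{A}"] assms(2) by (simp add: gl.dependent_single insert_commute)
qed

text \<open>A stabiliser that lies in a line lies in a line different from that of the scalar matrices, because no nonzero
  scalar matrix annihilates the form.\<close>

lemma krull_dim_small_stabiliser:
  assumes f: "foliation_form \<omega>" and small: "\<not> big_stabiliser \<omega>"
  shows "7 \<le> krull_dim (subtopology (zariski 3) (orbit \<omega>))"
proof -
  obtain N where N: "\<And>X. lie X \<omega> = 0 \<Longrightarrow> \<exists>c. X = smul c N"
    using small unfolding big_stabiliser_def by blast
  obtain S where S: "\<And>c. S \<noteq> smul c (mat 1)" "\<And>X. lie X \<omega> = 0 \<Longrightarrow> X \<in> gl.span {S}"
  proof (cases "\<exists>c. N = smul c (mat 1)")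
    case True
    then obtain c where c: "N = smul c (mat 1)" by blast
    have "X \<in> gl.span {E31}" if X: "lie X \<omega> = 0" for X
    proof -
      obtain b where "X = smul b N" using N[OF X] by blast
      then have X': "X = diag3 (b * c) (b * c) (b * c)" by (simp add: c mat_m3 smul_m3)
      then have "b * c = 0" using lie_scalar[OF f, of "b * c"] X by simp
      then have "X = 0" using X' by (simp only: zero_m3)
      then show ?thesis by (simp add: gl.span_zero)
    qed
    moreover have "E31 \<noteq> smul c (mat 1)" for c unfolding mat_m3 smul_m3 m3_eq_iff by simp
    ultimately show ?thesis using that by blast
  next
    case False
    show ?thesis
    proof (rule that)
      show "X \<in> gl.span {N}" if "lie X \<omega> = 0" for X
        using N[OF that] by (auto simp: gl.span_singleton)
    qed (use False in blast)
  qed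
  have one: "(mat 1 :: complex^3^3) \<noteq> 0" by (simp add: mat_m3 zero_m3 m3_eq_iff)
  have "enat (8 - card {S}) \<le> krull_dim (subtopology (zariski 3) (orbit \<omega>))"
    by (rule krull_dim_orbit_stabiliser[OF f]) (use independent_pair[OF S(1) one] S(2) in auto)
  then show ?thesis by (simp add: numeral_eq_enat)
qed

text \<open>The stabiliser is spanned by \<open>E31\<close> and a diagonal matrix, and the scalars meet it only in zero.\<close>

lemma krull_dim_model_ge:
  assumes f: "foliation_form \<omega>" and stab: "\<And>X. lie X \<omega> = 0 \<Longrightarrow> \<exists>r d. X = smul r E31 + smul d (diag3 a b c)"
    and abc: "a \<noteq> b"
  shows "6 \<le> krull_dim (subtopology (zariski 3) (orbit \<omega>))"
proof -
  let ?D = "diag3 a b c"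
  have ne: "?D \<noteq> smul u (mat 1)" for u using abc unfolding mat_m3 smul_m3 m3_eq_iff by auto
  have one: "(mat 1 :: complex^3^3) \<noteq> 0" by (simp add: mat_m3 zero_m3 m3_eq_iff)
  note pair = independent_pair[OF ne one]
  have "E31 \<notin> gl.span {mat 1, ?D}"
  proof
    assume "E31 \<in> gl.span {mat 1, ?D}"
    then obtain k where "E31 - smul k (mat 1) \<in> gl.span {?D}" unfolding gl.span_insert by blast
    then obtain l where "E31 - smul k (mat 1) = smul l ?D" by (auto simp: gl.span_singleton)
    then show False unfolding mat_m3 smul_m3 m3_diff m3_eq_iff by simp
  qed
  then have "gl.independent (insert E31 {mat 1, ?D})"
    using pair(1) by (rule gl.independent_insertI)
  moreover have "insert E31 {mat 1, ?D} = insert (mat 1) {E31, ?D}" by blast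
  ultimately have ind: "gl.independent (insert (mat 1) {E31, ?D})" by simp
  have ne': "E31 \<noteq> ?D" "mat 1 \<noteq> E31" using abc by (auto simp: m3_eq_iff mat_m3)
  have "enat (8 - card {E31, ?D}) \<le> krull_dim (subtopology (zariski 3) (orbit \<omega>))"
  proof (rule krull_dim_orbit_stabiliser[OF f _ _ ind])
    show "X \<in> gl.span {E31, ?D}" if X: "lie X \<omega> = 0" for X
    proof -
      obtain r d where X: "X = smul r E31 + smul d ?D" using stab[OF X] by blast
      show ?thesis
        unfolding X by (rule gl.span_add; rule gl.span_scale, rule gl.span_base, simp)
    qed
  qed (use ne' pair(2) in auto)
  then show ?thesis using ne' by (simp add: numeral_eq_enat)
qed

lemma stabiliser_models:
  "lie X Om1 = 0 \<Longrightarrow> \<exists>r d. X = smul r E31 + smul d (diag3 1 (- 4) 11)"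
  "lie X Om2 = 0 \<Longrightarrow> \<exists>r d. X = smul r E31 + smul d (diag3 (- 4) 1 16)"
proof -
  obtain x11 x12 x13 x21 x22 x23 x31 x32 x33 where X: "X = m3 x11 x12 x13 x21 x22 x23 x31 x32 x33"
    using m3_cases by blast
  have Om: "Om1 = pq_form (cubic 0 0 0 1) (cubic 1 0 0 0)" "Om2 = pq_form (cubic 1 0 0 0) (cubic 0 0 0 1)"
    by (simp_all add: Om1_def Om2_def cubic_powers Const_1)
  note cs = cf_lie X lookup_minus coeff_Var_mult coeff_cubic
  {
    assume "lie X Om1 = 0"
    then have L: "cf (lie X Om1) l i j k = 0" for l i j k by simp
    note L' = L[unfolded Om]
    have "x22 + 4 * x11 = 0" "x11 + 3 * x22 + x33 = 0" "x12 = 0" "x13 = 0" "x23 = 0" "x21 = 0" "x32 = 0"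
      using L'[of 2 4 0 0] L'[of 1 0 3 1] L'[of 2 3 1 0] L'[of 2 3 0 1] L'[of 3 1 2 1] L'[of 3 2 2 0] L'[of 1 0 4 0]
      by (simp_all add: cs algebra_simps)
    moreover from this(1,2) have "x22 = - 4 * x11" "x33 = 11 * x11" by algebra+
    ultimately show "\<exists>r d. X = smul r E31 + smul d (diag3 1 (- 4) 11)"
      unfolding X smul_m3 m3_add m3_eq_iff by (intro exI[of _ x31] exI[of _ x11]) simp
  next
    assume "lie X Om2 = 0"
    then have L: "cf (lie X Om2) l i j k = 0" for l i j k by simp
    note L' = L[unfolded Om]
    have "- x33 = 4 * x11" "x11 + 4 * x22 = 0" "x21 = 0" "x12 = 0" "x13 = 0" "x23 = 0" "x32 = 0"
      using L'[of 3 4 0 0] L'[of 2 1 3 0] L'[of 2 2 2 0] L'[of 3 3 1 0] L'[of 3 3 0 1] L'[of 2 1 2 1] L'[of 1 3 1 0]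
      by (simp_all add: cs algebra_simps)
    moreover from this(1,2) have "x11 = - 4 * x22" "x33 = 16 * x22" by algebra+
    ultimately show "\<exists>r d. X = smul r E31 + smul d (diag3 (- 4) 1 16)"
      unfolding X smul_m3 m3_add m3_eq_iff by (intro exI[of _ x31] exI[of _ x22]) simp
  }
qed

section \<open>The minimal orbits in degree three\<close>

theorem mainTheorem2:
  shows "foliation_of_chart 3 omega_bar1 \<in> foliations 3 \<and>
    foliation_of_chart 3 omega_bar2 \<in> foliations 3 \<and>
    (\<forall>F\<in>foliations 3. orbit_dim 3 F \<ge> 6) \<and>
    (\<forall>F\<in>foliations 3. orbit_dim 3 F = 6 \<longleftrightarrow>
       fol_conjugate F (foliation_of_chart 3 omega_bar1) \<or>
       fol_conjugate F (foliation_of_chart 3 omega_bar2))"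
proof -
  have fol: "F \<in> foliations 3 \<longleftrightarrow> (\<exists>\<omega>. foliation_form \<omega> \<and> F = proj_point \<omega>)" for F
    by (auto simp: foliations_def foliation_form_def)
  have dim: "orbit_dim 3 (proj_point \<omega>) = krull_dim (subtopology (zariski 3) (orbit \<omega>))" for \<omega>
    by (simp add: orbit_dim_def fol_orbit_eq)
  have dim1: "orbit_dim 3 (proj_point Om1) = 6"
    unfolding dim
  proof (rule antisym)
    show "krull_dim (subtopology (zariski 3) (orbit Om1)) \<le> 6"
      by (rule krull_dim_model_le[OF foliation_form_models(1) models_symmetric(1)])
    show "6 \<le> krull_dim (subtopology (zariski 3) (orbit Om1))"
      by (rule krull_dim_model_ge[OF foliation_form_models(1) stabiliser_models(1)]) simp_all
  qed
  have dim2: "orbit_dim 3 (proj_point Om2) = 6"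
    unfolding dim
  proof (rule antisym)
    show "krull_dim (subtopology (zariski 3) (orbit Om2)) \<le> 6"
      by (rule krull_dim_model_le[OF foliation_form_models(2) models_symmetric(2)])
    show "6 \<le> krull_dim (subtopology (zariski 3) (orbit Om2))"
      by (rule krull_dim_model_ge[OF foliation_form_models(2) stabiliser_models(2)]) simp_all
  qed
  have conj: "orbit_dim 3 (proj_point \<omega>) = 6"
    if "proj_point \<omega> \<in> orbit Om1 \<or> proj_point \<omega> \<in> orbit Om2" for \<omega>
    using that orbit_eqI dim dim1 dim2 by metis
  have dichotomy: "proj_point \<omega> \<in> orbit Om1 \<or> proj_point \<omega> \<in> orbit Om2 \<or> 7 \<le> orbit_dim 3 (proj_point \<omega>)"
    if f: "foliation_form \<omega>" for \<omega>
  proof (cases "big_stabiliser \<omega>")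
    case True
    then obtain P k \<Omega> where P: "invertible P" "k \<noteq> 0" "pullback P \<omega> = Const k *s \<Omega>" and \<Omega>: "\<Omega> = Om1 \<or> \<Omega> = Om2"
      using normalizable_model[OF big_stabiliser_normalizable[OF f]] by blast
    have "orbit \<omega> = orbit \<Omega>"
      using orbit_pullback[OF P(1), of \<omega>] orbit_scale[OF P(2)] P(3) by simp
    then have "proj_point \<omega> \<in> orbit \<Omega>" using proj_point_in_orbit by blast
    then show ?thesis using \<Omega> by blast
  next
    case False
    then show ?thesis using krull_dim_small_stabiliser[OF f] by (simp add: dim)
  qed
  have "6 \<le> orbit_dim 3 (proj_point \<omega>) \<and> (orbit_dim 3 (proj_point \<omega>) = 6 \<longleftrightarrow>
      proj_point \<omega> \<in> orbit Om1 \<or> proj_point \<omega> \<in> orbit Om2)" if f: "foliation_form \<omega>" for \<omega>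
  proof -
    have "(6 :: enat) < 7" by simp
    then show ?thesis using dichotomy[OF f] conj[of \<omega>] by (metis leD less_le_trans less_imp_le order_refl)
  qed
  then show ?thesis
    using foliation_form_models by (auto simp: fol chart_models fol_conjugate_def fol_orbit_eq)
qed

end
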